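(* Let the root system be of affine type $\hat A_1$ and assume $\mathbb{Q}\subseteq R$. Let $\mathbf{D}_{Q^\vee,\mathrm{loc}}=\mathbf{D}_{Q^\vee}[\tfrac{1}{\mathfrak{Y}_{\sigma_{2i}}},\ i\ge 1]$ be the localization of the formal Peterson subalgebra at the multiplicative set generated by the elements $\mathfrak{Y}_{\sigma_{2i}}$, $i\ge1$. Then $$\mathbf{D}_{Q^\vee,\mathrm{loc}}\cong S[\mathfrak{t},\mathfrak{t}^{-1}][\mathfrak{s}]/(\mathfrak{s}^2=x_{-1}\mathfrak{s}\mathfrak{t}+\mu\mathfrak{t})$$ as $S$-algebras, where $x_{-1}=x_{-\alpha}$, $x_1=x_\alpha$ and $\mu=-\frac{x_{-1}}{x_1}$.
   Context: $R$ is a commutative ring of characteristic $0$ and $F$ is a (one-dimensional commutative) formal group law over $R$. The finite root system is of type $A_1$: $\Phi=\{\pm\alpha\}$, $\theta=\alpha_1=\alpha$, $\alpha_0=-\alpha+\delta$, root lattice $Q=\mathbb{Z}\alpha$, coroot lattice $Q^\vee=\mathbb{Z}\alpha^\vee$, Weyl group $W=\{e,s_1\}$, $s_1=s_\alpha$. $W_a=Q^\vee\rtimes W$ has elements $t_\lambda w$ and is generated by $s_1$ and $s_0=t_{\alpha^\vee}s_\alpha$; each element has a unique reduced word. $S=R[[Q]]_F$ is the quotient of $R[[x_\lambda\mid\lambda\in Q]]$ by the closure of the ideal generated by $x_0$ and $x_{\lambda_1+\lambda_2}-F(x_{\lambda_1},x_{\lambda_2})$. (In the case $F_\beta(x,y)=x+y-\beta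 xy$ over $R=\mathbb{Z}[\beta]$ one takes instead the quotient of the polynomial ring by the ideal generated by the same elements.) Write $x_n=x_{n\alpha}$. $W_a$ acts on $S$ through $W$ (translations act trivially). The elements $x_{\pm\alpha}$ are assumed regular in $S$ and $\mathcal{Q}=S[\frac1{x_\alpha},\frac1{x_{-\alpha}}]$. $\mathcal{Q}_{W_a}$ is the free left $\mathcal{Q}$-module with basis $\eta_u$, $u\in W_a$, with product $c\eta_u\cdot c'\eta_{u'}=c\,u(c')\eta_{uu'}$; $\mathcal{Q}_{Q^\vee}$ is the analogous commutative algebra with basis $\eta_{t_\lambda}$, $\lambda\in Q^\vee$. Let $\mathrm{pr}:\mathcal{Q}_{W_a}\to\mathcal{Q}_{Q^\vee}$, $c\eta_{t_\lambda w}\mapsto c\eta_{t_\lambda}$ ($w\in W$), and let $\imath:\mathcal{Q}_{Q^\vee}\to\mathcal{Q}_{W_a}$, $c\eta_{t_\lambda}\mapsto c\eta_{t_\lambda}$. Let $\kappa_\alpha=\frac1{x_\alpha}+\frac1{x_{-\alpha}}\in S$, $X_1=\frac1{x_\alpha}(1-\eta_{s_1})$, $X_0=\frac1{x_{-\alpha}}(1-\eta_{s_0})$, $Y_j=\kappa_\alpha-X_j$ ($j=0,1$), and for $w\in W_a$ with reduced word $w=s_{i_1}\cdots s_{i_k}$ let $Y_w=Y_{i_1}\cdots Y_{i_k}$ and $\mathfrak{Y}_w=\mathrm{pr}(Y_w)$. $\mathbf{D}_{W_a}$ is the subring of $\mathcal{Q}_{W_a}$ generated by $S,X_0,X_1$.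 The formal Peterson subalgebra is $\mathbf{D}_{Q^\vee}=\imath(\mathrm{pr}(\mathbf{D}_{W_a}))$, a commutative subring of $\mathbf{D}_{W_a}$, identified via $\imath$ with $\mathrm{pr}(\mathbf{D}_{W_a})\subset\mathcal{Q}_{Q^\vee}$ (so that $\mathfrak{Y}_w\in\mathbf{D}_{Q^\vee}$). For $i\ge1$, $\sigma_{2i}=(s_1s_0)^i=t_{-i\alpha^\vee}$; the set $\{\mathfrak{Y}_{\sigma_{2i}}\mid i\ge1\}$ is closed under multiplication. *)

theory Defs
  imports
    "HOL-Algebra.Algebra"
    "HOL-Algebra.Algebraic_Closure_Type"
    "HOL-Computational_Algebra.Formal_Power_Series"
    "HOL-Library.Poly_Mapping"
begin

section \<open>General ring constructions\<close>

definition regular_elt :: "('a, 'm) ring_scheme \<Rightarrow> 'a \<Rightarrow> bool" where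
  "regular_elt A x \<longleftrightarrow>
     x \<in> carrier A \<and> (\<forall>a\<in>carrier A. x \<otimes>\<^bsub>A\<^esub> a = \<zero>\<^bsub>A\<^esub> \<longrightarrow> a = \<zero>\<^bsub>A\<^esub>)"

definition submonoid_generated :: "('a, 'm) monoid_scheme \<Rightarrow> 'a set \<Rightarrow> 'a set" where
  "submonoid_generated G B = \<Inter>{H. submonoid H G \<and> B \<subseteq> H}"

text \<open>
  The localization of a commutative ring \<open>A\<close> at a multiplicative set \<open>M\<close>. The fraction \<open>a / s\<close> is
  the class of \<open>(a, s)\<close> for the relation \<open>(a, s) \<sim> (b, t) \<longleftrightarrow> (\<exists>u\<in>M. u (t a) = u (s b))\<close>, which does not
  require \<open>A\<close> to be a domain.
\<close>

definition loc_frac :: "('a, 'm) ring_scheme \<Rightarrow> 'a set \<Rightarrow> 'a \<Rightarrow> 'a \<Rightarrow> ('a \<times> 'a) set" where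
  "loc_frac A M a s = {(b, t). b \<in> carrier A \<and> t \<in> M \<and>
     (\<exists>u\<in>M. u \<otimes>\<^bsub>A\<^esub> (t \<otimes>\<^bsub>A\<^esub> a) = u \<otimes>\<^bsub>A\<^esub> (s \<otimes>\<^bsub>A\<^esub> b))}"

definition localization :: "('a, 'm) ring_scheme \<Rightarrow> 'a set \<Rightarrow> ('a \<times> 'a) set ring" where
  "localization A M =
    \<lparr>carrier = {loc_frac A M a s | a s. a \<in> carrier A \<and> s \<in> M},
     monoid.mult = (\<lambda>C D. \<Union>(a, s)\<in>C. \<Union>(b, t)\<in>D. loc_frac A M (a \<otimes>\<^bsub>A\<^esub> b) (s \<otimes>\<^bsub>A\<^esub> t)),
     one = loc_frac A M \<one>\<^bsub>A\<^esub> \<one>\<^bsub>A\<^esub>,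
     ring.zero = loc_frac A M \<zero>\<^bsub>A\<^esub> \<one>\<^bsub>A\<^esub>,
     add = (\<lambda>C D. \<Union>(a, s)\<in>C. \<Union>(b, t)\<in>D.
              loc_frac A M ((t \<otimes>\<^bsub>A\<^esub> a) \<oplus>\<^bsub>A\<^esub> (s \<otimes>\<^bsub>A\<^esub> b)) (s \<otimes>\<^bsub>A\<^esub> t))\<rparr>"

text \<open>
  The free left \<open>A\<close>-module with basis \<open>\<eta>\<^sub>u\<close>, \<open>u \<in> G\<close>, and product
  \<open>c \<eta>\<^sub>u \<cdot> c' \<eta>\<^sub>v = c u(c') \<eta>\<^sub>u\<^sub>v\<close>, where the group \<open>G\<close> acts on \<open>A\<close> through \<open>act\<close>. An element is its
  family of coefficients, of finite support; \<open>eta A G c u\<close> is \<open>c \<eta>\<^sub>u\<close>.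
\<close>

definition twisted_group_ring ::
  "('a, 'm) ring_scheme \<Rightarrow> ('g, 'n) monoid_scheme \<Rightarrow> ('g \<Rightarrow> 'a \<Rightarrow> 'a) \<Rightarrow> ('g \<Rightarrow> 'a) ring" where
  "twisted_group_ring A G act =
    \<lparr>carrier = {f \<in> carrier G \<rightarrow>\<^sub>E carrier A. finite {u \<in> carrier G. f u \<noteq> \<zero>\<^bsub>A\<^esub>}},
     monoid.mult = (\<lambda>f g. \<lambda>w\<in>carrier G. \<Oplus>\<^bsub>A\<^esub>u\<in>{u \<in> carrier G. f u \<noteq> \<zero>\<^bsub>A\<^esub>}.
                       f u \<otimes>\<^bsub>A\<^esub> act u (g (inv\<^bsub>G\<^esub> u \<otimes>\<^bsub>G\<^esub> w))),
     one = (\<lambda>w\<in>carrier G. if w = \<one>\<^bsub>G\<^esub> then \<one>\<^bsub>A\<^esub> else \<zero>\<^bsub>A\<^esub>),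
     ring.zero = (\<lambda>w\<in>carrier G. \<zero>\<^bsub>A\<^esub>),
     add = (\<lambda>f g. \<lambda>w\<in>carrier G. f w \<oplus>\<^bsub>A\<^esub> g w)\<rparr>"

definition eta :: "('a, 'm) ring_scheme \<Rightarrow> ('g, 'n) monoid_scheme \<Rightarrow> 'a \<Rightarrow> 'g \<Rightarrow> 'g \<Rightarrow> 'a" where
  "eta A G c u = (\<lambda>w\<in>carrier G. if w = u then c else \<zero>\<^bsub>A\<^esub>)"

abbreviation group_algebra ::
  "('a, 'm) ring_scheme \<Rightarrow> ('g, 'n) monoid_scheme \<Rightarrow> ('g \<Rightarrow> 'a) ring" where
  "group_algebra A G \<equiv> twisted_group_ring A G (\<lambda>_ c. c)"

text \<open>\<open>S\<close>-algebras are given by their structure maps.\<close>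

definition algebra_isomorphic ::
  "('s, 'k) ring_scheme \<Rightarrow> ('a, 'm) ring_scheme \<Rightarrow> ('s \<Rightarrow> 'a) \<Rightarrow> ('b, 'n) ring_scheme \<Rightarrow> ('s \<Rightarrow> 'b) \<Rightarrow> bool"
  where
  "algebra_isomorphic S A \<phi> B \<psi> \<longleftrightarrow>
     \<phi> \<in> ring_hom S A \<and> \<psi> \<in> ring_hom S B \<and>
     (\<exists>h\<in>ring_iso A B. \<forall>s\<in>carrier S. h (\<phi> s) = \<psi> s)"

section \<open>Power series and formal group laws\<close>

text \<open>
  The ring \<open>R[[x\<^sub>v | v]]\<close> is the completion of the polynomial ring with respect to the powers of its
  augmentation ideal \<open>(x\<^sub>v | v)\<close>: when there are infinitely many variables, every homogeneous
  component of a series is still a polynomial. With arbitrary coefficient families and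
  coefficientwise convergence, \<open>x\<^sub>1 = lim (x\<^sub>1 - x\<^sub>N / N)\<close> would lie in the closed ideal that
  defines the formal group ring when \<open>R\<close> contains the rationals and \<open>F = x + y\<close>.
\<close>

definition total_degree :: "('v \<Rightarrow>\<^sub>0 nat) \<Rightarrow> nat" where
  "total_degree m = (\<Sum>v\<in>Poly_Mapping.keys m. Poly_Mapping.lookup m v)"

definition pser_ring :: "(('v \<Rightarrow>\<^sub>0 nat) \<Rightarrow> 'r::comm_ring_1) ring" where
  "pser_ring =
    \<lparr>carrier = {f. \<forall>d. finite {m. total_degree m = d \<and> f m \<noteq> 0}},
     monoid.mult = (\<lambda>f g m. \<Sum>(p, q)\<in>{(p, q). p + q = m}. f p * g q),
     one = (\<lambda>m. if m = 0 then 1 else 0),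
     ring.zero = (\<lambda>m. 0),
     add = (\<lambda>f g m. f m + g m)\<rparr>"

definition pser_var :: "'v \<Rightarrow> ('v \<Rightarrow>\<^sub>0 nat) \<Rightarrow> 'r::comm_ring_1" where
  "pser_var v = (\<lambda>m. if m = Poly_Mapping.single v 1 then 1 else 0)"

text \<open>
  A series \<open>F(x, y)\<close> in two variables is an element of \<open>R[[x]][[y]]\<close>; \<open>F $ j $ i\<close> is the coefficient
  of \<open>x\<^sup>i y\<^sup>j\<close>. The substitution \<open>F(f, g)\<close> is only used for \<open>f\<close> and \<open>g\<close> without constant term, so that
  terms with \<open>i + j\<close> greater than the degree of the monomial do not contribute.
\<close>

definition pser_subst2 ::
  "'r::comm_ring_1 fps fps \<Rightarrow> (('v \<Rightarrow>\<^sub>0 nat) \<Rightarrow> 'r) \<Rightarrow> (('v \<Rightarrow>\<^sub>0 nat) \<Rightarrow> 'r) \<Rightarrow> ('v \<Rightarrow>\<^sub>0 nat) \<Rightarrow> 'r" where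
  "pser_subst2 F f g = (\<lambda>m. \<Sum>(i, j)\<in>{(i, j). i + j \<le> total_degree m}.
     F $ j $ i * ((f [^]\<^bsub>pser_ring\<^esub> i) \<otimes>\<^bsub>pser_ring\<^esub> (g [^]\<^bsub>pser_ring\<^esub> j)) m)"

definition formal_group_law :: "'r::comm_ring_1 fps fps \<Rightarrow> bool" where
  "formal_group_law F \<longleftrightarrow>
    (let x = pser_var (0::nat) :: (nat \<Rightarrow>\<^sub>0 nat) \<Rightarrow> 'r; y = pser_var 1; z = pser_var 2 in
       pser_subst2 F x \<zero>\<^bsub>pser_ring\<^esub> = x \<and>
       pser_subst2 F \<zero>\<^bsub>pser_ring\<^esub> x = x \<and>
       pser_subst2 F x y = pser_subst2 F y x \<and>
       pser_subst2 F (pser_subst2 F x y) z = pser_subst2 F x (pser_subst2 F y z))"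

section \<open>The formal group ring of the root lattice of type A1\<close>

text \<open>
  The integer \<open>n\<close> stands for \<open>n \<alpha>\<close> in the root lattice, and \<open>pser_var n\<close> for \<open>x\<^sub>n\<^sub>\<alpha>\<close>. The closure
  is taken in the topology of the completion, for which the sets of series without terms of degree
  less than \<open>d\<close> form a basis of neighbourhoods of 0.
\<close>

definition fgr_relations :: "'r::comm_ring_1 fps fps \<Rightarrow> ((int \<Rightarrow>\<^sub>0 nat) \<Rightarrow> 'r) set" where
  "fgr_relations F = insert (pser_var 0)
     {pser_var (a + b) \<ominus>\<^bsub>pser_ring\<^esub> pser_subst2 F (pser_var a) (pser_var b) | a b. True}"

definition pser_closure :: "(('v \<Rightarrow>\<^sub>0 nat) \<Rightarrow> 'r::comm_ring_1) set \<Rightarrow> (('v \<Rightarrow>\<^sub>0 nat) \<Rightarrow> 'r) set" where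
  "pser_closure J =
     {f \<in> carrier pser_ring. \<forall>n. \<exists>g\<in>J. \<forall>m. total_degree m < n \<longrightarrow> f m = g m}"

definition fgr_ideal :: "'r::comm_ring_1 fps fps \<Rightarrow> ((int \<Rightarrow>\<^sub>0 nat) \<Rightarrow> 'r) set" where
  "fgr_ideal F = pser_closure (Idl\<^bsub>pser_ring\<^esub> (fgr_relations F))"

definition fgr :: "'r::comm_ring_1 fps fps \<Rightarrow> ((int \<Rightarrow>\<^sub>0 nat) \<Rightarrow> 'r) set ring" where
  "fgr F = pser_ring Quot fgr_ideal F"

definition fgr_x :: "'r::comm_ring_1 fps fps \<Rightarrow> int \<Rightarrow> ((int \<Rightarrow>\<^sub>0 nat) \<Rightarrow> 'r) set" where
  "fgr_x F n = fgr_ideal F +>\<^bsub>pser_ring\<^esub> pser_var n"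

text \<open>
  The Weyl group is \<open>{1, -1}\<close>, acting on the root lattice by multiplication. The induced
  automorphism \<open>x\<^sub>\<lambda> \<mapsto> x\<^bsub>w\<lambda>\<^esub>\<close> of the power series ring moves the coefficient of the monomial with
  exponents \<open>\<lambda> \<mapsto> m (w\<lambda>)\<close> to the one with exponents \<open>m\<close> (as \<open>w\<close> is its own inverse); it preserves
  the ideal and acts on cosets elementwise.
\<close>

definition weyl_pser :: "int \<Rightarrow> ((int \<Rightarrow>\<^sub>0 nat) \<Rightarrow> 'r) \<Rightarrow> (int \<Rightarrow>\<^sub>0 nat) \<Rightarrow> 'r" where
  "weyl_pser w f = (\<lambda>m. f (Poly_Mapping.map_key (\<lambda>n. w * n) m))"

definition weyl_fgr :: "int \<Rightarrow> ((int \<Rightarrow>\<^sub>0 nat) \<Rightarrow> 'r) set \<Rightarrow> ((int \<Rightarrow>\<^sub>0 nat) \<Rightarrow> 'r) set" where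
  "weyl_fgr w C = weyl_pser w ` C"

type_synonym 'r fgr_elt = "((int \<Rightarrow>\<^sub>0 nat) \<Rightarrow> 'r) set"
type_synonym 'r fgrQ_elt = "('r fgr_elt \<times> 'r fgr_elt) set"

definition fgr_denoms :: "'r::comm_ring_1 fps fps \<Rightarrow> 'r fgr_elt set" where
  "fgr_denoms F = submonoid_generated (fgr F) {fgr_x F 1, fgr_x F (-1)}"

definition fgrQ :: "'r::comm_ring_1 fps fps \<Rightarrow> 'r fgrQ_elt ring" where
  "fgrQ F = localization (fgr F) (fgr_denoms F)"

abbreviation fgrQ_frac :: "'r::comm_ring_1 fps fps \<Rightarrow> 'r fgr_elt \<Rightarrow> 'r fgr_elt \<Rightarrow> 'r fgrQ_elt" where
  "fgrQ_frac F \<equiv> loc_frac (fgr F) (fgr_denoms F)"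

abbreviation fgrQ_of :: "'r::comm_ring_1 fps fps \<Rightarrow> 'r fgr_elt \<Rightarrow> 'r fgrQ_elt" where
  "fgrQ_of F a \<equiv> fgrQ_frac F a \<one>\<^bsub>fgr F\<^esub>"

definition weyl_fgrQ :: "int \<Rightarrow> 'r fgrQ_elt \<Rightarrow> 'r fgrQ_elt" where
  "weyl_fgrQ w C = map_prod (weyl_fgr w) (weyl_fgr w) ` C"

definition inv_x :: "'r::comm_ring_1 fps fps \<Rightarrow> int \<Rightarrow> 'r fgrQ_elt" where
  "inv_x F n = fgrQ_frac F \<one>\<^bsub>fgr F\<^esub> (fgr_x F n)"

definition kappa :: "'r::comm_ring_1 fps fps \<Rightarrow> 'r fgrQ_elt" where
  "kappa F = inv_x F 1 \<oplus>\<^bsub>fgrQ F\<^esub> inv_x F (-1)"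

section \<open>The affine Weyl group\<close>

text \<open>
  The pair \<open>(n, w)\<close> is \<open>t\<^sub>\<lambda> w\<close> with \<open>\<lambda> = n \<alpha>\<^sup>\<or>\<close>; the Weyl group \<open>{1, -1}\<close> acts on the coroot lattice by
  multiplication.
\<close>

definition affine_weyl :: "(int \<times> int) monoid" where
  "affine_weyl =
    \<lparr>carrier = UNIV \<times> {1, -1},
     monoid.mult = (\<lambda>(a, v) (b, w). (a + v * b, v * w)),
     one = (0, 1)\<rparr>"

datatype affine_node = Node0 | Node1

primrec simple_refl :: "affine_node \<Rightarrow> int \<times> int" where
  "simple_refl Node0 = (1, -1)"
| "simple_refl Node1 = (0, -1)"

definition word_prod :: "affine_node list \<Rightarrow> int \<times> int" where
  "word_prod js = foldr (monoid.mult affine_weyl) (map simple_refl js) \<one>\<^bsub>affine_weyl\<^esub>"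

definition reduced_word :: "affine_node list \<Rightarrow> bool" where
  "reduced_word js \<longleftrightarrow> (\<forall>ks. word_prod ks = word_prod js \<longrightarrow> length js \<le> length ks)"

definition sigma_even :: "nat \<Rightarrow> int \<times> int" where
  "sigma_even i = (simple_refl Node1 \<otimes>\<^bsub>affine_weyl\<^esub> simple_refl Node0) [^]\<^bsub>affine_weyl\<^esub> i"

section \<open>The formal affine Demazure algebra and the formal Peterson subalgebra\<close>

definition QWa :: "'r::comm_ring_1 fps fps \<Rightarrow> (int \<times> int \<Rightarrow> 'r fgrQ_elt) ring" where
  "QWa F = twisted_group_ring (fgrQ F) affine_weyl (\<lambda>u. weyl_fgrQ (snd u))"

definition QQv :: "'r::comm_ring_1 fps fps \<Rightarrow> (int \<Rightarrow> 'r fgrQ_elt) ring" where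
  "QQv F = group_algebra (fgrQ F) integer_group"

abbreviation etaWa :: "'r::comm_ring_1 fps fps \<Rightarrow> 'r fgrQ_elt \<Rightarrow> int \<times> int \<Rightarrow> int \<times> int \<Rightarrow> 'r fgrQ_elt" where
  "etaWa F \<equiv> eta (fgrQ F) affine_weyl"

text \<open>The projection \<open>pr\<close> from \<open>QWa F\<close> onto \<open>QQv F\<close>, and the inclusion of \<open>QQv F\<close> into \<open>QWa F\<close>.\<close>

definition peterson_pr :: "'r::comm_ring_1 fps fps \<Rightarrow> (int \<times> int \<Rightarrow> 'r fgrQ_elt) \<Rightarrow> int \<Rightarrow> 'r fgrQ_elt" where
  "peterson_pr F f = (\<lambda>n. \<Oplus>\<^bsub>fgrQ F\<^esub>w\<in>{1, -1}. f (n, w))"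

definition iota :: "'r::comm_ring_1 fps fps \<Rightarrow> (int \<Rightarrow> 'r fgrQ_elt) \<Rightarrow> int \<times> int \<Rightarrow> 'r fgrQ_elt" where
  "iota F g = (\<lambda>(n, w)\<in>carrier affine_weyl. if w = 1 then g n else \<zero>\<^bsub>fgrQ F\<^esub>)"

text \<open>\<open>X\<^sub>0 = 1/x\<^bsub>-\<alpha>\<^esub> (1 - \<eta>\<^sub>s\<^sub>0)\<close> and \<open>X\<^sub>1 = 1/x\<^sub>\<alpha> (1 - \<eta>\<^sub>s\<^sub>1)\<close>.\<close>

primrec node_root :: "affine_node \<Rightarrow> int" where
  "node_root Node0 = -1"
| "node_root Node1 = 1"

definition demX :: "'r::comm_ring_1 fps fps \<Rightarrow> affine_node \<Rightarrow> int \<times> int \<Rightarrow> 'r fgrQ_elt" where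
  "demX F j = etaWa F (inv_x F (node_root j)) \<one>\<^bsub>affine_weyl\<^esub> \<otimes>\<^bsub>QWa F\<^esub>
     (\<one>\<^bsub>QWa F\<^esub> \<ominus>\<^bsub>QWa F\<^esub> etaWa F \<one>\<^bsub>fgrQ F\<^esub> (simple_refl j))"

definition demY :: "'r::comm_ring_1 fps fps \<Rightarrow> affine_node \<Rightarrow> int \<times> int \<Rightarrow> 'r fgrQ_elt" where
  "demY F j = etaWa F (kappa F) \<one>\<^bsub>affine_weyl\<^esub> \<ominus>\<^bsub>QWa F\<^esub> demX F j"

text \<open>Every element of the affine Weyl group has exactly one reduced word.\<close>

definition demYw :: "'r::comm_ring_1 fps fps \<Rightarrow> int \<times> int \<Rightarrow> int \<times> int \<Rightarrow> 'r fgrQ_elt" where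
  "demYw F w = foldr (monoid.mult (QWa F))
     (map (demY F) (THE js. reduced_word js \<and> word_prod js = w)) \<one>\<^bsub>QWa F\<^esub>"

definition frakY :: "'r::comm_ring_1 fps fps \<Rightarrow> int \<times> int \<Rightarrow> int \<Rightarrow> 'r fgrQ_elt" where
  "frakY F w = peterson_pr F (demYw F w)"

definition DWa :: "'r::comm_ring_1 fps fps \<Rightarrow> (int \<times> int \<Rightarrow> 'r fgrQ_elt) set" where
  "DWa F = generate_ring (QWa F)
     ({etaWa F (fgrQ_of F c) \<one>\<^bsub>affine_weyl\<^esub> | c. c \<in> carrier (fgr F)} \<union> {demX F Node0, demX F Node1})"

definition peterson :: "'r::comm_ring_1 fps fps \<Rightarrow> (int \<times> int \<Rightarrow> 'r fgrQ_elt) ring" where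
  "peterson F = QWa F\<lparr>carrier := iota F ` peterson_pr F ` DWa F\<rparr>"

definition peterson_denoms :: "'r::comm_ring_1 fps fps \<Rightarrow> (int \<times> int \<Rightarrow> 'r fgrQ_elt) set" where
  "peterson_denoms F =
     submonoid_generated (peterson F) {iota F (frakY F (sigma_even i)) | i. i \<ge> 1}"

definition peterson_loc ::
  "'r::comm_ring_1 fps fps \<Rightarrow> ((int \<times> int \<Rightarrow> 'r fgrQ_elt) \<times> (int \<times> int \<Rightarrow> 'r fgrQ_elt)) set ring" where
  "peterson_loc F = localization (peterson F) (peterson_denoms F)"

definition peterson_loc_of ::
  "'r::comm_ring_1 fps fps \<Rightarrow> 'r fgr_elt \<Rightarrow> ((int \<times> int \<Rightarrow> 'r fgrQ_elt) \<times> (int \<times> int \<Rightarrow> 'r fgrQ_elt)) set" where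
  "peterson_loc_of F c = loc_frac (peterson F) (peterson_denoms F)
     (etaWa F (fgrQ_of F c) \<one>\<^bsub>affine_weyl\<^esub>) \<one>\<^bsub>peterson F\<^esub>"

section \<open>The algebra \<open>S[t, t\<inverse>][s] / (s\<^sup>2 - x\<^sub>-\<^sub>1 s t - \<mu> t)\<close>\<close>

text \<open>Laurent polynomials are the group algebra of the integers, with \<open>c t\<^sup>n\<close> given by \<open>eta\<close>.\<close>

definition laurent :: "('a, 'm) ring_scheme \<Rightarrow> (int \<Rightarrow> 'a) ring" where
  "laurent A = group_algebra A integer_group"

abbreviation laurent_monom :: "('a, 'm) ring_scheme \<Rightarrow> 'a \<Rightarrow> int \<Rightarrow> int \<Rightarrow> 'a" where
  "laurent_monom A \<equiv> eta A integer_group"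

definition quadratic_rel :: "'r::comm_ring_1 fps fps \<Rightarrow> 'r fgr_elt \<Rightarrow> nat \<Rightarrow> int \<Rightarrow> 'r fgr_elt" where
  "quadratic_rel F \<mu> =
    (let L = laurent (fgr F); P = UP L in
       UnivPoly.monom P \<one>\<^bsub>L\<^esub> 2 \<ominus>\<^bsub>P\<^esub>
       (UnivPoly.monom P (laurent_monom (fgr F) (fgr_x F (-1)) 1) 1 \<oplus>\<^bsub>P\<^esub>
        UnivPoly.monom P (laurent_monom (fgr F) \<mu> 1) 0))"

definition quadratic_ideal :: "'r::comm_ring_1 fps fps \<Rightarrow> 'r fgr_elt \<Rightarrow> (nat \<Rightarrow> int \<Rightarrow> 'r fgr_elt) set" where
  "quadratic_ideal F \<mu> = PIdl\<^bsub>UP (laurent (fgr F))\<^esub> (quadratic_rel F \<mu>)"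

definition quadratic_alg :: "'r::comm_ring_1 fps fps \<Rightarrow> 'r fgr_elt \<Rightarrow> (nat \<Rightarrow> int \<Rightarrow> 'r fgr_elt) set ring" where
  "quadratic_alg F \<mu> = UP (laurent (fgr F)) Quot quadratic_ideal F \<mu>"

definition quadratic_alg_of ::
  "'r::comm_ring_1 fps fps \<Rightarrow> 'r fgr_elt \<Rightarrow> 'r fgr_elt \<Rightarrow> (nat \<Rightarrow> int \<Rightarrow> 'r fgr_elt) set" where
  "quadratic_alg_of F \<mu> c = quadratic_ideal F \<mu> +>\<^bsub>UP (laurent (fgr F))\<^esub>
     UnivPoly.monom (UP (laurent (fgr F))) (laurent_monom (fgr F) c 0) 0"

end

theory Submission
  imports Defs
begin

text \<open>
  Write \<open>x = x\<^sub>1\<close>, \<open>y = x\<^sub>-\<^sub>1\<close> and \<open>q\<close> for the basis element of the simple coroot translation, and put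
  \<open>b = 1/x + q/y\<close> and \<open>\<Theta> = q\<^sup>-\<^sup>1 b\<^sup>2\<close>. The ring \<open>QWa F\<close> acts on \<open>QQv F\<close> with \<open>z \<cdot> 1 = pr z\<close>, and there \<open>\<Theta>\<close>
  commutes with \<open>Y\<^sub>0\<close> and \<open>Y\<^sub>1\<close>, \<open>Y\<^sub>0 \<cdot> 1 = b\<close> and \<open>Y\<^sub>1 \<cdot> b = \<Theta>\<close>. Hence \<open>\<YY>\<^sub>\<sigma> = \<Theta>\<^sup>i\<close> for \<open>\<sigma> = (s\<^sub>1 s\<^sub>0)\<^sup>i\<close>, and the
  Peterson subalgebra is the free \<open>S[\<Theta>]\<close>-module with basis \<open>1\<close>, \<open>b\<close>. Since \<open>y b = q - \<mu>\<close>, we get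
  \<open>b\<^sup>2 = q \<Theta> = y b \<Theta> + \<mu> \<Theta>\<close>, so \<open>\<tt> \<mapsto> \<Theta>\<close> and \<open>\<ss> \<mapsto> b\<close> give the isomorphism. That \<open>\<mu>\<close>, \<open>1/x + 1/y\<close> and
  the divided differences \<open>(c - s\<^sub>1 c)/x\<close> lie in \<open>S\<close> follows from the fact that, modulo the closed ideal
  defining \<open>S\<close>, a power series of order \<open>k\<close> is divisible by \<open>x\<^sup>k\<close>.
\<close>

section \<open>Localization\<close>

text \<open>Passing from products in \<open>QWa F\<close> to its action on \<open>QQv F\<close>
  leaves commutative algebra with one involution \<open>\<tau>\<close>, which reflects coefficients
  and inverts \<open>q\<close>: \<open>s_1\<close> acts as \<open>\<tau>\<close> and
  \<open>s_0\<close> as \<open>q\<close> times \<open>\<tau>\<close>. Since \<open>\<tau>\<close>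
  sends \<open>b\<close> to \<open>b/q\<close>, the exponent of \<open>q\<close> in \<Theta> is the
  one that makes \<Theta> invariant under \<open>\<tau>\<close>; this is why multiplication by it
  commutes with the operators. The relation contains \<mu> because \<mu> is the root of
  \<open>b\<close>, a polynomial of degree one in \<open>q\<close>. Evaluating \<open>q\<close> at
  \<mu> kills both \<open>b\<close> and \<Theta>, and freeness over \<open>S\<close> follows by
  isolating one coefficient at a time. Two obstacles shape the proof. \<open>S\<close> is not
  assumed to be a domain, so every cancellation goes through regular elements or unit coefficients.
  And \<open>S\<close> is a quotient by a closed ideal in infinitely many variables, so divisibility
  by \<open>x\<close> has to be established for infinite series, by summing congruences degree by
  degree.\<close>

locale multiplicative_set = cring A for A (structure) +
  fixes M
  assumes submonoid_M: "submonoid M A"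
begin

lemma M_closed [simp]: "s \<in> M \<Longrightarrow> s \<in> carrier A"
  using submonoid_M by (auto simp: submonoid_def)

lemma M_one [simp]: "\<one> \<in> M"
  using submonoid_M by (auto simp: submonoid_def)

lemma M_mult [simp]: "s \<in> M \<Longrightarrow> t \<in> M \<Longrightarrow> s \<otimes> t \<in> M"
  using submonoid_M by (auto simp: submonoid_def)

abbreviation frac where "frac \<equiv> loc_frac A M"

abbreviation L where "L \<equiv> localization A M"

lemma mem_frac:
  "(b, t) \<in> frac a s \<longleftrightarrow> b \<in> carrier A \<and> t \<in> M \<and> (\<exists>u\<in>M. u \<otimes> (t \<otimes> a) = u \<otimes> (s \<otimes> b))"
  by (auto simp: loc_frac_def)

lemma frac_self: "a \<in> carrier A \<Longrightarrow> s \<in> M \<Longrightarrow> (a, s) \<in> frac a s"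
  unfolding mem_frac using M_one by blast

text \<open>Transitivity of equality of fractions: the witness has to contain the middle denominator
  \<open>t\<close> besides \<open>u\<close> and \<open>v\<close>, since nothing can be cancelled in
  the presence of zero divisors.\<close>

lemma frac_trans_identity:
  assumes c: "a \<in> carrier A" "b \<in> carrier A" "c \<in> carrier A" "s \<in> carrier A" "t \<in> carrier A"
      "r \<in> carrier A" "u \<in> carrier A" "v \<in> carrier A"
    and ab: "u \<otimes> (t \<otimes> a) = u \<otimes> (s \<otimes> b)" and bc: "v \<otimes> (r \<otimes> b) = v \<otimes> (t \<otimes> c)"
  shows "u \<otimes> v \<otimes> t \<otimes> (r \<otimes> a) = u \<otimes> v \<otimes> t \<otimes> (s \<otimes> c)"
proof -
  have "u \<otimes> v \<otimes> t \<otimes> (r \<otimes> a) = v \<otimes> r \<otimes> (u \<otimes> (t \<otimes> a))" using c by (simp add: m_ac)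
  also have "\<dots> = u \<otimes> s \<otimes> (v \<otimes> (r \<otimes> b))" unfolding ab using c by (simp add: m_ac)
  also have "\<dots> = u \<otimes> v \<otimes> t \<otimes> (s \<otimes> c)" unfolding bc using c by (simp add: m_ac)
  finally show ?thesis .
qed

lemma frac_eqI:
  assumes c: "a \<in> carrier A" "s \<in> M" and bt: "(b, t) \<in> frac a s"
  shows "frac b t = frac a s"
proof -
  obtain u where b: "b \<in> carrier A" "t \<in> M" and u: "u \<in> M" "u \<otimes> (t \<otimes> a) = u \<otimes> (s \<otimes> b)"
    using bt unfolding mem_frac by blast
  have "frac b t \<subseteq> frac a s"
  proof clarify
    fix d r assume "(d, r) \<in> frac b t"
    then obtain v where "d \<in> carrier A" "r \<in> M" "v \<in> M" "v \<otimes> (r \<otimes> b) = v \<otimes> (t \<otimes> d)"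
      unfolding mem_frac by blast
    then show "(d, r) \<in> frac a s"
      unfolding mem_frac using frac_trans_identity[of a b d s t r u v] b c u
      by (intro conjI bexI[of _ "u \<otimes> v \<otimes> t"]) auto
  qed
  moreover have "frac a s \<subseteq> frac b t"
  proof clarify
    fix d r assume "(d, r) \<in> frac a s"
    then obtain v where "d \<in> carrier A" "r \<in> M" "v \<in> M" "v \<otimes> (r \<otimes> a) = v \<otimes> (s \<otimes> d)"
      unfolding mem_frac by blast
    then show "(d, r) \<in> frac b t"
      unfolding mem_frac using frac_trans_identity[of b a d t s r u v] b c u
      by (intro conjI bexI[of _ "u \<otimes> v \<otimes> s"]) auto
  qed
  ultimately show ?thesis by blast
qed

lemma frac_eq_iff:
  assumes "a \<in> carrier A" "s \<in> M" "b \<in> carrier A" "t \<in> M"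
  shows "frac a s = frac b t \<longleftrightarrow> (\<exists>u\<in>M. u \<otimes> (t \<otimes> a) = u \<otimes> (s \<otimes> b))"
proof
  assume "frac a s = frac b t"
  then have "(b, t) \<in> frac a s" using frac_self assms by blast
  then show "\<exists>u\<in>M. u \<otimes> (t \<otimes> a) = u \<otimes> (s \<otimes> b)" by (simp add: mem_frac)
next
  assume "\<exists>u\<in>M. u \<otimes> (t \<otimes> a) = u \<otimes> (s \<otimes> b)"
  then have "(b, t) \<in> frac a s" using assms by (simp add: mem_frac)
  then show "frac a s = frac b t" using frac_eqI[OF assms(1,2)] by blast
qed

lemma frac_eq:
  assumes "a \<in> carrier A" "s \<in> M" "b \<in> carrier A" "t \<in> M" "t \<otimes> a = s \<otimes> b"
  shows "frac a s = frac b t"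
  unfolding frac_eq_iff[OF assms(1-4)] using assms(5) M_one by metis

lemma frac_memE:
  assumes "p \<in> frac a s"
  obtains b t u where "p = (b, t)" "b \<in> carrier A" "t \<in> M" "u \<in> M" "u \<otimes> (t \<otimes> a) = u \<otimes> (s \<otimes> b)"
  using assms by (cases p) (auto simp: mem_frac)

text \<open>The operations of \<open>localization\<close> are unions over all representatives. When
  every choice yields the same class the union is this class; it is not an empty union because each
  class contains its own representative.\<close>

lemma UN_frac_const:
  assumes "a \<in> carrier A" "s \<in> M" "b \<in> carrier A" "t \<in> M"
    and "\<And>a' s' b' t'. (a', s') \<in> frac a s \<Longrightarrow> (b', t') \<in> frac b t \<Longrightarrow> f a' s' b' t' = p"
  shows "(\<Union>(a, s)\<in>frac a s. \<Union>(b, t)\<in>frac b t. f a s b t) = p"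
  using frac_self[of a s] frac_self[of b t] assms by blast

lemma frac_mult:
  assumes c: "a \<in> carrier A" "s \<in> M" "b \<in> carrier A" "t \<in> M"
  shows "frac a s \<otimes>\<^bsub>L\<^esub> frac b t = frac (a \<otimes> b) (s \<otimes> t)"
proof -
  have "(\<Union>(a, s)\<in>frac a s. \<Union>(b, t)\<in>frac b t. frac (a \<otimes> b) (s \<otimes> t)) = frac (a \<otimes> b) (s \<otimes> t)"
  proof (rule UN_frac_const[OF c])
    fix a' s' b' t' assume "(a', s') \<in> frac a s" "(b', t') \<in> frac b t"
    then obtain u v where d: "a' \<in> carrier A" "s' \<in> M" "b' \<in> carrier A" "t' \<in> M" "u \<in> M" "v \<in> M"
      and u: "u \<otimes> (s' \<otimes> a) = u \<otimes> (s \<otimes> a')" and v: "v \<otimes> (t' \<otimes> b) = v \<otimes> (t \<otimes> b')"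
      unfolding mem_frac by blast
    have "u \<otimes> v \<otimes> (s' \<otimes> t' \<otimes> (a \<otimes> b)) = (u \<otimes> (s' \<otimes> a)) \<otimes> (v \<otimes> (t' \<otimes> b))"
      using c d by (simp add: m_ac)
    also have "\<dots> = u \<otimes> v \<otimes> (s \<otimes> t \<otimes> (a' \<otimes> b'))"
      unfolding u v using c d by (simp add: m_ac)
    finally show "frac (a' \<otimes> b') (s' \<otimes> t') = frac (a \<otimes> b) (s \<otimes> t)"
      using c d by (intro frac_eqI) (auto simp: mem_frac intro!: bexI[of _ "u \<otimes> v"])
  qed
  then show ?thesis by (simp add: localization_def)
qed

lemma frac_add:
  assumes c: "a \<in> carrier A" "s \<in> M" "b \<in> carrier A" "t \<in> M"
  shows "frac a s \<oplus>\<^bsub>L\<^esub> frac b t = frac ((t \<otimes> a) \<oplus> (s \<otimes> b)) (s \<otimes> t)"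
proof -
  have "(\<Union>(a, s)\<in>frac a s. \<Union>(b, t)\<in>frac b t. frac ((t \<otimes> a) \<oplus> (s \<otimes> b)) (s \<otimes> t))
      = frac ((t \<otimes> a) \<oplus> (s \<otimes> b)) (s \<otimes> t)"
  proof (rule UN_frac_const[OF c])
    fix a' s' b' t' assume "(a', s') \<in> frac a s" "(b', t') \<in> frac b t"
    then obtain u v where d: "a' \<in> carrier A" "s' \<in> M" "b' \<in> carrier A" "t' \<in> M" "u \<in> M" "v \<in> M"
      and u: "u \<otimes> (s' \<otimes> a) = u \<otimes> (s \<otimes> a')" and v: "v \<otimes> (t' \<otimes> b) = v \<otimes> (t \<otimes> b')"
      unfolding mem_frac by blast
    have "u \<otimes> v \<otimes> (s' \<otimes> t' \<otimes> ((t \<otimes> a) \<oplus> (s \<otimes> b)))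
        = v \<otimes> t \<otimes> t' \<otimes> (u \<otimes> (s' \<otimes> a)) \<oplus> u \<otimes> s \<otimes> s' \<otimes> (v \<otimes> (t' \<otimes> b))"
      using c d by (simp add: m_ac r_distr)
    also have "\<dots> = u \<otimes> v \<otimes> (s \<otimes> t \<otimes> ((t' \<otimes> a') \<oplus> (s' \<otimes> b')))"
      unfolding u v using c d by (simp add: m_ac r_distr)
    finally show "frac ((t' \<otimes> a') \<oplus> (s' \<otimes> b')) (s' \<otimes> t') = frac ((t \<otimes> a) \<oplus> (s \<otimes> b)) (s \<otimes> t)"
      using c d by (intro frac_eqI) (auto simp: mem_frac intro!: bexI[of _ "u \<otimes> v"])
  qed
  then show ?thesis by (simp add: localization_def)
qed

lemma carrier_L: "carrier L = {frac a s | a s. a \<in> carrier A \<and> s \<in> M}"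
  by (simp add: localization_def)

lemma frac_closed [simp]: "a \<in> carrier A \<Longrightarrow> s \<in> M \<Longrightarrow> frac a s \<in> carrier L"
  by (auto simp: carrier_L)

lemma L_cases:
  assumes "p \<in> carrier L"
  obtains a s where "a \<in> carrier A" "s \<in> M" "p = frac a s"
  using assms by (auto simp: carrier_L)

lemma one_L: "\<one>\<^bsub>L\<^esub> = frac \<one> \<one>"
  by (simp add: localization_def)

lemma zero_L: "\<zero>\<^bsub>L\<^esub> = frac \<zero> \<one>"
  by (simp add: localization_def)

lemma cring_L: "cring L"
proof (rule cringI)
  show "abelian_group L"
  proof (rule abelian_groupI)
    fix p assume "p \<in> carrier L"
    then obtain a s where p: "a \<in> carrier A" "s \<in> M" "p = frac a s" by (rule L_cases)
    have "frac (\<ominus> a) s \<oplus>\<^bsub>L\<^esub> p = \<zero>\<^bsub>L\<^esub>"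
      using p by (simp add: frac_add zero_L l_neg r_minus) (rule frac_eq; simp)
    moreover have "frac (\<ominus> a) s \<in> carrier L" using p by simp
    ultimately show "\<exists>q\<in>carrier L. q \<oplus>\<^bsub>L\<^esub> p = \<zero>\<^bsub>L\<^esub>" by blast
  qed (auto elim!: L_cases simp: frac_add zero_L r_distr intro!: frac_eq simp: m_ac a_ac)
  show "comm_monoid L"
    by (rule comm_monoidI) (auto elim!: L_cases simp: frac_mult one_L m_ac)
  fix p q r assume "p \<in> carrier L" "q \<in> carrier L" "r \<in> carrier L"
  then obtain a s b t d v where *: "p = frac a s" "q = frac b t" "r = frac d v"
    and c: "a \<in> carrier A" "s \<in> M" "b \<in> carrier A" "t \<in> M" "d \<in> carrier A" "v \<in> M"
    by (elim L_cases) blast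
  have "s \<otimes> v \<otimes> (t \<otimes> v) \<otimes> ((t \<otimes> a \<oplus> s \<otimes> b) \<otimes> d)
      = s \<otimes> t \<otimes> v \<otimes> (t \<otimes> v \<otimes> (a \<otimes> d) \<oplus> s \<otimes> v \<otimes> (b \<otimes> d))"
    using c[simplified] M_closed[OF c(2)] M_closed[OF c(4)] M_closed[OF c(6)] by algebra
  then show "(p \<oplus>\<^bsub>L\<^esub> q) \<otimes>\<^bsub>L\<^esub> r = p \<otimes>\<^bsub>L\<^esub> r \<oplus>\<^bsub>L\<^esub> q \<otimes>\<^bsub>L\<^esub> r"
    using c by (simp add: * frac_add frac_mult) (rule frac_eq; simp)
qed

lemma frac_hom: "(\<lambda>a. frac a \<one>) \<in> ring_hom A L"
  by (rule ring_hom_memI) (auto simp: frac_mult frac_add one_L)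

lemma frac_split: "a \<in> carrier A \<Longrightarrow> s \<in> M \<Longrightarrow> frac a s = frac a \<one> \<otimes>\<^bsub>L\<^esub> frac \<one> s"
  by (simp add: frac_mult)

lemma frac_inverse: "s \<in> M \<Longrightarrow> frac s \<one> \<otimes>\<^bsub>L\<^esub> frac \<one> s = \<one>\<^bsub>L\<^esub>"
  by (simp add: frac_mult one_L) (rule frac_eq; simp)

lemma frac_uminus: "a \<in> carrier A \<Longrightarrow> s \<in> M \<Longrightarrow> \<ominus>\<^bsub>L\<^esub> frac a s = frac (\<ominus> a) s"
proof -
  interpret L: cring L by (rule cring_L)
  assume c: "a \<in> carrier A" "s \<in> M"
  have "frac (\<ominus> a) s \<oplus>\<^bsub>L\<^esub> frac a s = \<zero>\<^bsub>L\<^esub>"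
    using c by (simp add: frac_add zero_L l_neg r_minus) (rule frac_eq; simp)
  then show ?thesis using c by (intro L.minus_equality) auto
qed

text \<open>Equal fractions only agree after multiplication by some \<open>u \<in> M\<close>;
  regularity of \<open>u\<close> removes it.\<close>

lemma frac_inject:
  assumes "\<And>s. s \<in> M \<Longrightarrow> regular_elt A s" "a \<in> carrier A" "b \<in> carrier A" "frac a \<one> = frac b \<one>"
  shows "a = b"
proof -
  obtain u where u: "u \<in> M" "u \<otimes> a = u \<otimes> b"
    using assms by (auto simp: frac_eq_iff)
  then have "u \<otimes> (a \<ominus> b) = \<zero>"
    using assms(2,3) by (simp add: minus_eq r_distr r_minus r_neg)
  then have "a \<ominus> b = \<zero>" using assms u unfolding regular_elt_def by simp
  then show ?thesis using assms by simp
qed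

text \<open>The image of a class is a full class, not just a subset of one, because \<open>w\<close>
  is bijective and permutes \<open>M\<close>. This makes \<open>weyl_fgrQ\<close>, an elementwise
  image, computable on fractions.\<close>

lemma map_prod_frac:
  assumes w: "w \<in> ring_hom A A" and bij: "bij_betw w (carrier A) (carrier A)"
    and M: "w ` M = M" and c: "a \<in> carrier A" "s \<in> M"
  shows "map_prod w w ` frac a s = frac (w a) (w s)"
proof -
  interpret w: ring_hom_ring A A w by (rule ring_hom_ringI2) (auto simp: w ring_axioms)
  have wM: "w t \<in> M" if "t \<in> M" for t using M that by blast
  show ?thesis
  proof (rule Set.set_eqI)
    fix p
    show "p \<in> map_prod w w ` frac a s \<longleftrightarrow> p \<in> frac (w a) (w s)"
    proof
      assume "p \<in> map_prod w w ` frac a s"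
      then obtain b t u where p: "p = (w b, w t)" "b \<in> carrier A" "t \<in> M" "u \<in> M"
        and e: "u \<otimes> (t \<otimes> a) = u \<otimes> (s \<otimes> b)" by (auto elim!: frac_memE)
      have "w u \<otimes> (w t \<otimes> w a) = w u \<otimes> (w s \<otimes> w b)"
        using arg_cong[OF e, of w] p c by simp
      then show "p \<in> frac (w a) (w s)" using p wM by (auto simp: mem_frac)
    next
      assume "p \<in> frac (w a) (w s)"
      then obtain b t u where p: "p = (b, t)" "b \<in> carrier A" "t \<in> M" "u \<in> M"
        "u \<otimes> (t \<otimes> w a) = u \<otimes> (w s \<otimes> b)" by (auto elim!: frac_memE)
      obtain b' where b': "b' \<in> carrier A" "b = w b'" using p bij by (auto simp: bij_betw_def)
      have "t \<in> w ` M" "u \<in> w ` M" using p unfolding M by auto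
      then obtain t' u' where t': "t' \<in> M" "t = w t'" "u' \<in> M" "u = w u'" by (elim imageE)
      have e: "w (u' \<otimes> (t' \<otimes> a)) = w (u' \<otimes> (s \<otimes> b'))" using p c b' t' by simp
      have "u' \<otimes> (t' \<otimes> a) = u' \<otimes> (s \<otimes> b')"
        by (rule inj_onD[OF bij_betw_imp_inj_on[OF bij] e]) (use c b' t' in auto)
      then have "(b', t') \<in> frac a s" using b' t' by (auto simp: mem_frac)
      then show "p \<in> map_prod w w ` frac a s" using p b' t' by (auto intro!: image_eqI[of _ _ "(b', t')"])
    qed
  qed
qed

end

lemma submonoid_generated_submonoid:
  assumes "monoid G" "B \<subseteq> carrier G"
  shows "submonoid (submonoid_generated G B) G"
proof -
  interpret monoid G by fact
  have "submonoid (carrier G) G" by unfold_locales auto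
  then show ?thesis
    using assms unfolding submonoid_generated_def submonoid_def by auto
qed

lemma submonoid_generated_incl: "B \<subseteq> submonoid_generated G B"
  by (auto simp: submonoid_generated_def)

lemma submonoid_generated_minimal: "submonoid H G \<Longrightarrow> B \<subseteq> H \<Longrightarrow> submonoid_generated G B \<subseteq> H"
  by (auto simp: submonoid_generated_def)

text \<open>Thus regularity of all denominators only has to be checked on generators.\<close>

lemma (in cring) submonoid_regular: "submonoid {a. regular_elt R a} R"
proof
  fix a b assume "a \<in> {a. regular_elt R a}" "b \<in> {a. regular_elt R a}"
  then have a: "a \<in> carrier R" "\<And>c. c \<in> carrier R \<Longrightarrow> a \<otimes> c = \<zero> \<Longrightarrow> c = \<zero>"
    and b: "b \<in> carrier R" "\<And>c. c \<in> carrier R \<Longrightarrow> b \<otimes> c = \<zero> \<Longrightarrow> c = \<zero>"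
    unfolding regular_elt_def by blast+
  have "c = \<zero>" if c: "c \<in> carrier R" "a \<otimes> b \<otimes> c = \<zero>" for c
    by (rule b(2)[OF c(1) a(2)]) (use c m_assoc[OF a(1) b(1) c(1)] b(1) in auto)
  then show "a \<otimes> b \<in> {a. regular_elt R a}"
    using m_closed[OF a(1) b(1)] unfolding regular_elt_def by blast
qed (auto simp: regular_elt_def)

section \<open>Twisted group rings\<close>

locale twisted = R: cring A + group G for A (structure) and G (structure) +
  fixes act
  assumes act_hom: "u \<in> carrier G \<Longrightarrow> act u \<in> ring_hom A A"
    and act_mult: "u \<in> carrier G \<Longrightarrow> v \<in> carrier G \<Longrightarrow> c \<in> carrier A
      \<Longrightarrow> act (u \<otimes>\<^bsub>G\<^esub> v) c = act u (act v c)"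
    and act_one: "c \<in> carrier A \<Longrightarrow> act \<one>\<^bsub>G\<^esub> c = c"
begin

abbreviation T where "T \<equiv> twisted_group_ring A G act"

abbreviation supp where "supp f \<equiv> {u \<in> carrier G. f u \<noteq> \<zero>}"

abbreviation mono where "mono \<equiv> eta A G"

lemma act_closed [simp]: "u \<in> carrier G \<Longrightarrow> c \<in> carrier A \<Longrightarrow> act u c \<in> carrier A"
  using act_hom by (rule ring_hom_closed)

lemma act_add [simp]:
  "u \<in> carrier G \<Longrightarrow> c \<in> carrier A \<Longrightarrow> d \<in> carrier A \<Longrightarrow> act u (c \<oplus> d) = act u c \<oplus> act u d"
  using act_hom by (rule ring_hom_add)

lemma act_times [simp]:
  "u \<in> carrier G \<Longrightarrow> c \<in> carrier A \<Longrightarrow> d \<in> carrier A \<Longrightarrow> act u (c \<otimes> d) = act u c \<otimes> act u d"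
  using act_hom by (rule ring_hom_mult)

lemma act_1 [simp]: "u \<in> carrier G \<Longrightarrow> act u \<one> = \<one>"
  using act_hom by (rule ring_hom_one)

lemma act_0 [simp]: "u \<in> carrier G \<Longrightarrow> act u \<zero> = \<zero>"
  using ring_hom_zero[OF act_hom] R.ring_axioms by blast

lemma carrier_T: "carrier T = {f \<in> carrier G \<rightarrow>\<^sub>E carrier A. finite (supp f)}"
  by (simp add: twisted_group_ring_def)

lemma T_coeff [simp]: "f \<in> carrier T \<Longrightarrow> u \<in> carrier G \<Longrightarrow> f u \<in> carrier A"
  by (auto simp: carrier_T)

lemma T_finite: "f \<in> carrier T \<Longrightarrow> finite (supp f)"
  by (auto simp: carrier_T)

lemma T_eqI:
  assumes "f \<in> carrier T" "g \<in> carrier T" "\<And>w. w \<in> carrier G \<Longrightarrow> f w = g w"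
  shows "f = g"
  using assms by (auto simp: carrier_T intro: PiE_ext)

lemma T_add: "w \<in> carrier G \<Longrightarrow> (f \<oplus>\<^bsub>T\<^esub> g) w = f w \<oplus> g w"
  by (simp add: twisted_group_ring_def)

lemma T_zero: "w \<in> carrier G \<Longrightarrow> \<zero>\<^bsub>T\<^esub> w = \<zero>"
  by (simp add: twisted_group_ring_def)

lemma T_one_eq: "\<one>\<^bsub>T\<^esub> = mono \<one> \<one>\<^bsub>G\<^esub>"
  by (simp add: twisted_group_ring_def eta_def)

lemma mono_apply: "w \<in> carrier G \<Longrightarrow> mono c u w = (if w = u then c else \<zero>)"
  by (simp add: eta_def)

lemma mono_closed [simp]: "c \<in> carrier A \<Longrightarrow> mono c u \<in> carrier T"
  by (auto simp: carrier_T eta_def intro: finite_subset[of _ "{u}"])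

lemma T_add_closed [simp]:
  assumes "f \<in> carrier T" "g \<in> carrier T"
  shows "f \<oplus>\<^bsub>T\<^esub> g \<in> carrier T"
proof -
  have "supp (f \<oplus>\<^bsub>T\<^esub> g) \<subseteq> supp f \<union> supp g" by (auto simp: T_add)
  then have "finite (supp (f \<oplus>\<^bsub>T\<^esub> g))" using T_finite assms finite_subset by blast
  then show ?thesis using assms by (auto simp: carrier_T T_add) (auto simp: twisted_group_ring_def)
qed

lemma T_zero_closed [simp]: "\<zero>\<^bsub>T\<^esub> \<in> carrier T"
  by (auto simp: twisted_group_ring_def)

text \<open>The definition sums over the exact support of the left factor; allowing any larger
  finite index set lets products with different left factors be added.\<close>

lemma T_mult_apply:
  assumes f: "f \<in> carrier T" and g: "g \<in> carrier T" and w: "w \<in> carrier G"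
    and U: "finite U" "supp f \<subseteq> U" "U \<subseteq> carrier G"
  shows "(f \<otimes>\<^bsub>T\<^esub> g) w = (\<Oplus>u\<in>U. f u \<otimes> act u (g (inv\<^bsub>G\<^esub> u \<otimes>\<^bsub>G\<^esub> w)))"
proof -
  have "(\<Oplus>u\<in>U. f u \<otimes> act u (g (inv\<^bsub>G\<^esub> u \<otimes>\<^bsub>G\<^esub> w)))
      = (\<Oplus>u\<in>supp f. f u \<otimes> act u (g (inv\<^bsub>G\<^esub> u \<otimes>\<^bsub>G\<^esub> w)))"
    using U by (intro R.add.finprod_mono_neutral_cong_right) (use f g w in auto)
  then show ?thesis using w by (simp add: twisted_group_ring_def)
qed

lemma mono_mult_apply:
  assumes c: "c \<in> carrier A" "u \<in> carrier G" and g: "g \<in> carrier T" and w: "w \<in> carrier G"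
  shows "(mono c u \<otimes>\<^bsub>T\<^esub> g) w = c \<otimes> act u (g (inv\<^bsub>G\<^esub> u \<otimes>\<^bsub>G\<^esub> w))"
  using assms by (subst T_mult_apply[of _ _ _ "{u}"]) (auto simp: mono_apply split: if_splits)

text \<open>Gives finiteness of the support of a product: a nonzero summand needs \<open>u\<close>
  in one support and the complementary factor in the other.\<close>

lemma supp_mult:
  assumes f: "f \<in> carrier T" and g: "g \<in> carrier T"
  shows "supp (f \<otimes>\<^bsub>T\<^esub> g) \<subseteq> (\<lambda>(u, v). u \<otimes>\<^bsub>G\<^esub> v) ` (supp f \<times> supp g)"
proof
  fix w assume "w \<in> supp (f \<otimes>\<^bsub>T\<^esub> g)"
  then have w: "w \<in> carrier G" and nz: "(f \<otimes>\<^bsub>T\<^esub> g) w \<noteq> \<zero>" by auto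
  obtain u where u: "u \<in> supp f" "f u \<otimes> act u (g (inv\<^bsub>G\<^esub> u \<otimes>\<^bsub>G\<^esub> w)) \<noteq> \<zero>"
    using nz R.add.finprod_one_eqI[of "supp f" "\<lambda>u. f u \<otimes> act u (g (inv\<^bsub>G\<^esub> u \<otimes>\<^bsub>G\<^esub> w))"]
    using T_mult_apply[OF f g w T_finite[OF f]] by auto
  then have "inv\<^bsub>G\<^esub> u \<otimes>\<^bsub>G\<^esub> w \<in> supp g" using f w by auto
  moreover have "w = u \<otimes>\<^bsub>G\<^esub> (inv\<^bsub>G\<^esub> u \<otimes>\<^bsub>G\<^esub> w)" using u w by (simp add: m_assoc[symmetric])
  ultimately show "w \<in> (\<lambda>(u, v). u \<otimes>\<^bsub>G\<^esub> v) ` (supp f \<times> supp g)"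
    using u by (intro image_eqI[of _ _ "(u, inv\<^bsub>G\<^esub> u \<otimes>\<^bsub>G\<^esub> w)"]) auto
qed

lemma T_mult_closed [simp]:
  assumes f: "f \<in> carrier T" and g: "g \<in> carrier T"
  shows "f \<otimes>\<^bsub>T\<^esub> g \<in> carrier T"
proof -
  have "finite (supp (f \<otimes>\<^bsub>T\<^esub> g))"
    using finite_subset[OF supp_mult[OF f g]] T_finite f g by blast
  moreover have "f \<otimes>\<^bsub>T\<^esub> g \<in> carrier G \<rightarrow> carrier A"
  proof
    fix w assume w: "w \<in> carrier G"
    show "(f \<otimes>\<^bsub>T\<^esub> g) w \<in> carrier A"
      unfolding T_mult_apply[OF f g w T_finite[OF f] order_refl Collect_restrict]
      using f g w by (intro R.finsum_closed) auto
  qed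
  moreover have "f \<otimes>\<^bsub>T\<^esub> g \<in> extensional (carrier G)"
    by (simp add: twisted_group_ring_def)
  ultimately show ?thesis unfolding carrier_T PiE_def by blast
qed

lemma abelian_group_T: "abelian_group T"
proof (rule abelian_groupI)
  fix f assume f: "f \<in> carrier T"
  let ?g = "\<lambda>w\<in>carrier G. \<ominus> f w"
  have "?g \<in> carrier T"
    using f by (auto simp: carrier_T cong: conj_cong)
  moreover have "?g \<oplus>\<^bsub>T\<^esub> f = \<zero>\<^bsub>T\<^esub>"
    by (rule T_eqI) (use calculation f in \<open>auto simp: T_add T_zero R.l_neg\<close>)
  ultimately show "\<exists>g\<in>carrier T. g \<oplus>\<^bsub>T\<^esub> f = \<zero>\<^bsub>T\<^esub>" by blast
qed (auto intro!: T_eqI simp: T_add T_zero R.a_ac)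

lemma T_distr:
  assumes f: "f \<in> carrier T" and g: "g \<in> carrier T" and h: "h \<in> carrier T"
  shows "(f \<oplus>\<^bsub>T\<^esub> g) \<otimes>\<^bsub>T\<^esub> h = f \<otimes>\<^bsub>T\<^esub> h \<oplus>\<^bsub>T\<^esub> g \<otimes>\<^bsub>T\<^esub> h"
    and "h \<otimes>\<^bsub>T\<^esub> (f \<oplus>\<^bsub>T\<^esub> g) = h \<otimes>\<^bsub>T\<^esub> f \<oplus>\<^bsub>T\<^esub> h \<otimes>\<^bsub>T\<^esub> g"
proof -
  let ?U = "supp f \<union> supp g"
  have U: "finite ?U" "?U \<subseteq> carrier G" using f g T_finite by auto
  have fg: "supp (f \<oplus>\<^bsub>T\<^esub> g) \<subseteq> ?U" by (auto simp: T_add)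
  show "(f \<oplus>\<^bsub>T\<^esub> g) \<otimes>\<^bsub>T\<^esub> h = f \<otimes>\<^bsub>T\<^esub> h \<oplus>\<^bsub>T\<^esub> g \<otimes>\<^bsub>T\<^esub> h"
  proof (rule T_eqI)
    fix w assume w: "w \<in> carrier G"
    have "(f \<oplus>\<^bsub>T\<^esub> g) u \<otimes> act u (h (inv\<^bsub>G\<^esub> u \<otimes>\<^bsub>G\<^esub> w))
        = f u \<otimes> act u (h (inv\<^bsub>G\<^esub> u \<otimes>\<^bsub>G\<^esub> w)) \<oplus> g u \<otimes> act u (h (inv\<^bsub>G\<^esub> u \<otimes>\<^bsub>G\<^esub> w))"
      if "u \<in> ?U" for u
      using that f g h w by (auto simp: T_add R.l_distr)
    then have "(\<Oplus>u\<in>?U. (f \<oplus>\<^bsub>T\<^esub> g) u \<otimes> act u (h (inv\<^bsub>G\<^esub> u \<otimes>\<^bsub>G\<^esub> w)))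
        = (\<Oplus>u\<in>?U. f u \<otimes> act u (h (inv\<^bsub>G\<^esub> u \<otimes>\<^bsub>G\<^esub> w)) \<oplus> g u \<otimes> act u (h (inv\<^bsub>G\<^esub> u \<otimes>\<^bsub>G\<^esub> w)))"
      using f g h w by (intro R.finsum_cong') auto
    also have "\<dots> = (\<Oplus>u\<in>?U. f u \<otimes> act u (h (inv\<^bsub>G\<^esub> u \<otimes>\<^bsub>G\<^esub> w)))
        \<oplus> (\<Oplus>u\<in>?U. g u \<otimes> act u (h (inv\<^bsub>G\<^esub> u \<otimes>\<^bsub>G\<^esub> w)))"
      using f g h w by (intro R.finsum_addf) auto
    finally show "((f \<oplus>\<^bsub>T\<^esub> g) \<otimes>\<^bsub>T\<^esub> h) w = (f \<otimes>\<^bsub>T\<^esub> h \<oplus>\<^bsub>T\<^esub> g \<otimes>\<^bsub>T\<^esub> h) w"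
      using f g h w U fg by (simp add: T_add T_mult_apply[of _ _ _ ?U])
  qed (use f g h in auto)
  show "h \<otimes>\<^bsub>T\<^esub> (f \<oplus>\<^bsub>T\<^esub> g) = h \<otimes>\<^bsub>T\<^esub> f \<oplus>\<^bsub>T\<^esub> h \<otimes>\<^bsub>T\<^esub> g"
  proof (rule T_eqI)
    fix w assume w: "w \<in> carrier G"
    let ?U = "supp h"
    have "h u \<otimes> act u ((f \<oplus>\<^bsub>T\<^esub> g) (inv\<^bsub>G\<^esub> u \<otimes>\<^bsub>G\<^esub> w))
        = h u \<otimes> act u (f (inv\<^bsub>G\<^esub> u \<otimes>\<^bsub>G\<^esub> w)) \<oplus> h u \<otimes> act u (g (inv\<^bsub>G\<^esub> u \<otimes>\<^bsub>G\<^esub> w))"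
      if "u \<in> ?U" for u
      using that f g h w by (auto simp: T_add R.r_distr)
    then have "(\<Oplus>u\<in>?U. h u \<otimes> act u ((f \<oplus>\<^bsub>T\<^esub> g) (inv\<^bsub>G\<^esub> u \<otimes>\<^bsub>G\<^esub> w)))
        = (\<Oplus>u\<in>?U. h u \<otimes> act u (f (inv\<^bsub>G\<^esub> u \<otimes>\<^bsub>G\<^esub> w)) \<oplus> h u \<otimes> act u (g (inv\<^bsub>G\<^esub> u \<otimes>\<^bsub>G\<^esub> w)))"
      using f g h w by (intro R.finsum_cong') auto
    also have "\<dots> = (\<Oplus>u\<in>?U. h u \<otimes> act u (f (inv\<^bsub>G\<^esub> u \<otimes>\<^bsub>G\<^esub> w)))
        \<oplus> (\<Oplus>u\<in>?U. h u \<otimes> act u (g (inv\<^bsub>G\<^esub> u \<otimes>\<^bsub>G\<^esub> w)))"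
      using f g h w by (intro R.finsum_addf) auto
    finally show "(h \<otimes>\<^bsub>T\<^esub> (f \<oplus>\<^bsub>T\<^esub> g)) w = (h \<otimes>\<^bsub>T\<^esub> f \<oplus>\<^bsub>T\<^esub> h \<otimes>\<^bsub>T\<^esub> g) w"
      using f g h w T_finite[OF h] by (simp add: T_add T_mult_apply[of _ _ _ ?U])
  qed (use f g h in auto)
qed

text \<open>Reduces additive statements to single terms \<open>c \<eta>_u\<close>; the proof empties
  the support one point at a time.\<close>

lemma T_induct [consumes 1, case_names zero add]:
  assumes "f \<in> carrier T"
    and "P \<zero>\<^bsub>T\<^esub>"
    and step: "\<And>c u f. c \<in> carrier A \<Longrightarrow> u \<in> carrier G \<Longrightarrow> f \<in> carrier T \<Longrightarrow> P f
      \<Longrightarrow> P (mono c u \<oplus>\<^bsub>T\<^esub> f)"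
  shows "P f"
proof -
  have "\<forall>f\<in>carrier T. supp f \<subseteq> U \<longrightarrow> P f" if "finite U" for U
    using that
  proof (induction U rule: finite_induct)
    case empty
    have "f = \<zero>\<^bsub>T\<^esub>" if "f \<in> carrier T" "supp f \<subseteq> {}" for f
      using that by (intro T_eqI) (auto simp: T_zero)
    then show ?case using assms(2) by auto
  next
    case (insert u U)
    show ?case
    proof (intro ballI impI)
      fix f assume f: "f \<in> carrier T" "supp f \<subseteq> insert u U"
      show "P f"
      proof (cases "u \<in> carrier G")
        case True
        let ?g = "\<lambda>w\<in>carrier G. if w = u then \<zero> else f w"
        have g: "?g \<in> carrier T"
        proof -
          have "supp ?g \<subseteq> supp f" by auto
          then have "finite (supp ?g)" using finite_subset T_finite[OF f(1)] by blast
          moreover have "?g \<in> carrier G \<rightarrow>\<^sub>E carrier A" using f by auto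
          ultimately show ?thesis unfolding carrier_T by blast
        qed
        have f_eq: "f = mono (f u) u \<oplus>\<^bsub>T\<^esub> ?g"
          by (rule T_eqI) (use f g True in \<open>auto simp: T_add mono_apply\<close>)
        have "supp ?g \<subseteq> U" using f by auto
        then have "P ?g" using g insert by blast
        then have "P (mono (f u) u \<oplus>\<^bsub>T\<^esub> ?g)" using step T_coeff f True g by blast
        then show "P f" using f_eq by simp
      qed (use f insert in auto)
    qed
  qed
  then show ?thesis using assms(1) T_finite by blast
qed

lemma mono_mult:
  assumes "c \<in> carrier A" "u \<in> carrier G" "d \<in> carrier A" "v \<in> carrier G"
  shows "mono c u \<otimes>\<^bsub>T\<^esub> mono d v = mono (c \<otimes> act u d) (u \<otimes>\<^bsub>G\<^esub> v)"
  by (rule T_eqI)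
    (use assms in \<open>auto simp: mono_mult_apply mono_apply inv_solve_left'\<close>)

lemma mono_add:
  assumes "c \<in> carrier A" "d \<in> carrier A"
  shows "mono c u \<oplus>\<^bsub>T\<^esub> mono d u = mono (c \<oplus> d) u"
  by (rule T_eqI) (use assms in \<open>auto simp: T_add mono_apply\<close>)

lemma mono_mult_zero: "c \<in> carrier A \<Longrightarrow> u \<in> carrier G \<Longrightarrow> mono c u \<otimes>\<^bsub>T\<^esub> \<zero>\<^bsub>T\<^esub> = \<zero>\<^bsub>T\<^esub>"
  by (rule T_eqI) (auto simp: mono_mult_apply T_zero)

lemma zero_mult: "f \<in> carrier T \<Longrightarrow> \<zero>\<^bsub>T\<^esub> \<otimes>\<^bsub>T\<^esub> f = \<zero>\<^bsub>T\<^esub>"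
  by (rule T_eqI) (auto simp: T_mult_apply[of _ _ _ "{}"] T_zero)

text \<open>The case of associativity that carries the content: with two single terms in front it
  comes down to \<open>act_mult\<close>. The general law follows by additivity in the second factor
  and then in the first.\<close>

lemma mono_mono_assoc:
  assumes "c \<in> carrier A" "u \<in> carrier G" "d \<in> carrier A" "v \<in> carrier G" "h \<in> carrier T"
  shows "mono c u \<otimes>\<^bsub>T\<^esub> mono d v \<otimes>\<^bsub>T\<^esub> h = mono c u \<otimes>\<^bsub>T\<^esub> (mono d v \<otimes>\<^bsub>T\<^esub> h)"
  by (rule T_eqI)
    (use assms in \<open>auto simp: mono_mult mono_mult_apply act_mult R.m_assoc m_assoc inv_mult_group\<close>)

lemma mono_assoc:
  assumes c: "c \<in> carrier A" "u \<in> carrier G" and g: "g \<in> carrier T" and h: "h \<in> carrier T"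
  shows "mono c u \<otimes>\<^bsub>T\<^esub> g \<otimes>\<^bsub>T\<^esub> h = mono c u \<otimes>\<^bsub>T\<^esub> (g \<otimes>\<^bsub>T\<^esub> h)"
  using g by (induction rule: T_induct) (use c h in \<open>auto simp: T_distr mono_mult_zero zero_mult mono_mono_assoc\<close>)

lemma T_assoc:
  assumes f: "f \<in> carrier T" and g: "g \<in> carrier T" and h: "h \<in> carrier T"
  shows "f \<otimes>\<^bsub>T\<^esub> g \<otimes>\<^bsub>T\<^esub> h = f \<otimes>\<^bsub>T\<^esub> (g \<otimes>\<^bsub>T\<^esub> h)"
  using f by (induction rule: T_induct) (use g h in \<open>auto simp: T_distr zero_mult mono_assoc\<close>)

lemma T_one_closed [simp]: "\<one>\<^bsub>T\<^esub> \<in> carrier T"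
  by (simp add: T_one_eq)

lemma one_mult: "f \<in> carrier T \<Longrightarrow> \<one>\<^bsub>T\<^esub> \<otimes>\<^bsub>T\<^esub> f = f"
  by (rule T_eqI) (auto simp: T_one_eq mono_mult_apply act_one)

lemma mult_one:
  assumes "f \<in> carrier T"
  shows "f \<otimes>\<^bsub>T\<^esub> \<one>\<^bsub>T\<^esub> = f"
  using assms by (induction rule: T_induct) (auto simp: T_distr T_one_eq mono_mult zero_mult)

lemma ring_T: "ring T"
proof (rule ringI)
  show "monoid T"
    by (rule monoidI) (auto simp: T_assoc one_mult mult_one)
qed (auto simp: abelian_group_T T_distr)

end

locale comm_group_algebra = twisted A G "\<lambda>_ c. c" + comm_group G
  for A (structure) and G (structure)
begin

text \<open>For the trivial action these rules degenerate: the closure rule, for instance, has its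
  own conclusion as a premise, which is unusable for rewriting.\<close>

declare act_closed [simp del] act_add [simp del] act_times [simp del] act_1 [simp del] act_0 [simp del]

lemma mono_mono_comm:
  assumes "c \<in> carrier A" "u \<in> carrier G" "d \<in> carrier A" "v \<in> carrier G"
  shows "mono c u \<otimes>\<^bsub>T\<^esub> mono d v = mono d v \<otimes>\<^bsub>T\<^esub> mono c u"
  unfolding mono_mult[OF assms] mono_mult[OF assms(3,4,1,2)] R.m_comm[OF assms(1,3)]
    m_comm[OF assms(2,4)] ..

lemma mult_zero: "f \<in> carrier T \<Longrightarrow> f \<otimes>\<^bsub>T\<^esub> \<zero>\<^bsub>T\<^esub> = \<zero>\<^bsub>T\<^esub>"
  by (rule ring.ring_simprules[OF ring_T])

lemma mono_comm:
  assumes c: "c \<in> carrier A" "u \<in> carrier G" and g: "g \<in> carrier T"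
  shows "mono c u \<otimes>\<^bsub>T\<^esub> g = g \<otimes>\<^bsub>T\<^esub> mono c u"
  using g
proof (induction rule: T_induct)
  case zero
  show ?case using c by (simp add: mult_zero zero_mult)
next
  case (add d v f)
  then show ?case using c mono_mono_comm[of c u d v] by (simp add: T_distr)
qed

lemma cring_T: "cring T"
proof -
  interpret T: ring T by (rule ring_T)
  have "f \<otimes>\<^bsub>T\<^esub> g = g \<otimes>\<^bsub>T\<^esub> f" if "f \<in> carrier T" "g \<in> carrier T" for f g
    using that by (induction f rule: T_induct) (auto simp: T_distr mono_comm)
  then show ?thesis by unfold_locales auto
qed

text \<open>The universal property of the group algebra: coefficients go through
  \<open>\<phi>\<close>, the basis through a multiplicative map \<open>\<chi>\<close>. It serves
  both for evaluating \<open>q\<close> in \<open>fgrQ F\<close> and for mapping Laurent polynomials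
  into the localized Peterson subalgebra.\<close>

definition lift where
  "lift B \<phi> \<chi> f = (\<Oplus>\<^bsub>B\<^esub>u\<in>supp f. \<phi> (f u) \<otimes>\<^bsub>B\<^esub> \<chi> u)"

context
  fixes B (structure) and \<phi> \<chi>
  assumes B: "cring B" and \<phi>: "\<phi> \<in> ring_hom A B"
    and \<chi>: "\<And>u. u \<in> carrier G \<Longrightarrow> \<chi> u \<in> carrier B"
      "\<And>u v. u \<in> carrier G \<Longrightarrow> v \<in> carrier G \<Longrightarrow> \<chi> (u \<otimes>\<^bsub>G\<^esub> v) = \<chi> u \<otimes>\<^bsub>B\<^esub> \<chi> v"
      "\<chi> \<one>\<^bsub>G\<^esub> = \<one>\<^bsub>B\<^esub>"
begin

interpretation B: cring B by (rule B)
interpretation phi: ring_hom_cring A B \<phi>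
  by (rule RingHom.ring_hom_cringI) (auto simp: R.cring_axioms B intro: ring_hom_ringI2 \<phi> R.ring_axioms B.ring_axioms)

lemma lift_eq_sum:
  assumes "f \<in> carrier T" "finite U" "supp f \<subseteq> U" "U \<subseteq> carrier G"
  shows "lift B \<phi> \<chi> f = (\<Oplus>\<^bsub>B\<^esub>u\<in>U. \<phi> (f u) \<otimes>\<^bsub>B\<^esub> \<chi> u)"
  unfolding lift_def using assms \<chi>
  by (intro B.add.finprod_mono_neutral_cong_left) (auto simp: subset_iff)

lemma lift_closed: "f \<in> carrier T \<Longrightarrow> lift B \<phi> \<chi> f \<in> carrier B"
  unfolding lift_def using \<chi> by (intro B.finsum_closed) auto

lemma lift_mono: "c \<in> carrier A \<Longrightarrow> u \<in> carrier G \<Longrightarrow> lift B \<phi> \<chi> (mono c u) = \<phi> c \<otimes>\<^bsub>B\<^esub> \<chi> u"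
  using \<chi> by (subst lift_eq_sum[of _ "{u}"]) (auto simp: mono_apply split: if_splits)

lemma lift_add:
  assumes f: "f \<in> carrier T" and g: "g \<in> carrier T"
  shows "lift B \<phi> \<chi> (f \<oplus>\<^bsub>T\<^esub> g) = lift B \<phi> \<chi> f \<oplus>\<^bsub>B\<^esub> lift B \<phi> \<chi> g"
proof -
  let ?U = "supp f \<union> supp g"
  have U: "finite ?U" using f g T_finite by auto
  have fg: "supp (f \<oplus>\<^bsub>T\<^esub> g) \<subseteq> ?U" by (auto simp: T_add)
  have "\<phi> ((f \<oplus>\<^bsub>T\<^esub> g) u) \<otimes>\<^bsub>B\<^esub> \<chi> u = \<phi> (f u) \<otimes>\<^bsub>B\<^esub> \<chi> u \<oplus>\<^bsub>B\<^esub> \<phi> (g u) \<otimes>\<^bsub>B\<^esub> \<chi> u"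
    if "u \<in> ?U" for u
    using that f g \<chi> by (auto simp: T_add B.l_distr)
  then have "(\<Oplus>\<^bsub>B\<^esub>u\<in>?U. \<phi> ((f \<oplus>\<^bsub>T\<^esub> g) u) \<otimes>\<^bsub>B\<^esub> \<chi> u)
      = (\<Oplus>\<^bsub>B\<^esub>u\<in>?U. \<phi> (f u) \<otimes>\<^bsub>B\<^esub> \<chi> u \<oplus>\<^bsub>B\<^esub> \<phi> (g u) \<otimes>\<^bsub>B\<^esub> \<chi> u)"
    using f g \<chi> by (intro B.finsum_cong') auto
  also have "\<dots> = (\<Oplus>\<^bsub>B\<^esub>u\<in>?U. \<phi> (f u) \<otimes>\<^bsub>B\<^esub> \<chi> u) \<oplus>\<^bsub>B\<^esub> (\<Oplus>\<^bsub>B\<^esub>u\<in>?U. \<phi> (g u) \<otimes>\<^bsub>B\<^esub> \<chi> u)"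
    using f g \<chi> by (intro B.finsum_addf) auto
  finally show ?thesis using f g U fg by (simp add: lift_eq_sum[of _ ?U])
qed

lemma lift_zero: "lift B \<phi> \<chi> \<zero>\<^bsub>T\<^esub> = \<zero>\<^bsub>B\<^esub>"
  by (simp add: lift_eq_sum[of _ "{}"] T_zero)

lemma lift_hom: "lift B \<phi> \<chi> \<in> ring_hom T B"
proof (rule ring_hom_memI)
  interpret T: cring T by (rule cring_T)
  note [simp] = lift_closed lift_add lift_zero lift_mono \<chi>
  show "lift B \<phi> \<chi> \<one>\<^bsub>T\<^esub> = \<one>\<^bsub>B\<^esub>" by (simp add: T_one_eq)
  fix f g assume f: "f \<in> carrier T" and g: "g \<in> carrier T"
  have *: "lift B \<phi> \<chi> (mono c u \<otimes>\<^bsub>T\<^esub> g) = lift B \<phi> \<chi> (mono c u) \<otimes>\<^bsub>B\<^esub> lift B \<phi> \<chi> g"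
    if "c \<in> carrier A" "u \<in> carrier G" for c u
    using g by (induction g rule: T_induct) (use that in \<open>auto simp: T_distr B.r_distr mono_mult B.m_ac\<close>)
  show "lift B \<phi> \<chi> (f \<otimes>\<^bsub>T\<^esub> g) = lift B \<phi> \<chi> f \<otimes>\<^bsub>B\<^esub> lift B \<phi> \<chi> g"
    using f by (induction f rule: T_induct) (use g in \<open>auto simp: T_distr B.l_distr * simp del: lift_mono\<close>)
qed (auto simp: lift_closed lift_add)

end

end

lemma comm_group_algebraI:
  assumes "cring A" "comm_group G"
  shows "comm_group_algebra A G"
proof -
  interpret cring A by fact
  interpret G: comm_group G by fact
  show ?thesis by (intro comm_group_algebra.intro twisted.intro twisted_axioms.intro)
    (simp_all add: ring_hom_def cring_axioms G.comm_group_axioms G.group_axioms)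
qed

section \<open>Reduced words in the affine Weyl group\<close>

lemma affine_weyl_simps [simp]:
  "carrier affine_weyl = UNIV \<times> {1, -1}"
  "(a, v) \<otimes>\<^bsub>affine_weyl\<^esub> (b, w) = (a + v * b, v * w)"
  "\<one>\<^bsub>affine_weyl\<^esub> = (0, 1)"
  by (simp_all add: affine_weyl_def)

lemma group_affine_weyl: "group affine_weyl"
proof (rule groupI)
  fix u assume "u \<in> carrier affine_weyl"
  then show "\<exists>v\<in>carrier affine_weyl. v \<otimes>\<^bsub>affine_weyl\<^esub> u = \<one>\<^bsub>affine_weyl\<^esub>"
    by (intro bexI[of _ "(- snd u * fst u, snd u)"]) auto
qed (auto simp: algebra_simps)

text \<open>The signed length: \<open>\<bar>signed_length u\<bar>\<close> is the length of \<open>u\<close>, and the sign tells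
  with which of the two simple reflections the reduced word of \<open>u\<close> starts.\<close>

definition signed_length :: "int \<times> int \<Rightarrow> int" where
  "signed_length u = (if snd u = 1 then 2 * fst u else 2 * fst u - 1)"

abbreviation word_length where "word_length js \<equiv> signed_length (word_prod js)"

lemma word_prod_Cons: "word_prod (j # js) = simple_refl j \<otimes>\<^bsub>affine_weyl\<^esub> word_prod js"
  by (simp add: word_prod_def)

lemma word_prod_closed: "word_prod js \<in> UNIV \<times> {1, -1}"
proof (induction js)
  case (Cons j js)
  then show ?case by (cases j; cases "word_prod js") (auto simp: word_prod_Cons)
qed (simp add: word_prod_def)

lemma word_length_Nil: "word_length [] = 0"
  by (simp add: word_prod_def signed_length_def)

text \<open>Left multiplication by \<open>s_0\<close> and \<open>s_1\<close> acts on the signed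
  length as the point reflections n -> 1 - n and n -> -1 - n of the integers.\<close>

lemma word_length_Cons:
  "word_length (j # js) = (case j of Node0 \<Rightarrow> 1 | Node1 \<Rightarrow> -1) - word_length js"
  using word_prod_closed[of js]
  by (cases j; cases "word_prod js") (auto simp: word_prod_Cons signed_length_def)

lemma word_length_le: "\<bar>word_length js\<bar> \<le> int (length js)"
proof (induction js)
  case (Cons j js)
  then show ?case by (cases j) (auto simp: word_length_Cons)
qed (simp add: word_length_Nil)

text \<open>If the length bound is sharp for a word it is sharp for its tail, and the signed length
  has the sign contributed by the first letter. So this letter can be read off and removed.\<close>

lemma word_eq_of_length:
  assumes "\<bar>word_length js\<bar> = int (length js)" "\<bar>word_length ks\<bar> = int (length ks)"
    and "word_length js = word_length ks"
  shows "js = ks"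
  using assms
proof (induction js arbitrary: ks)
  case Nil
  then show ?case by (simp add: word_length_Nil)
next
  case (Cons j js)
  then obtain k ks' where ks: "ks = k # ks'" by (cases ks) (auto simp: word_length_Nil)
  have le: "\<bar>word_length js\<bar> \<le> int (length js)" "\<bar>word_length ks'\<bar> \<le> int (length ks')"
    by (rule word_length_le)+
  let ?s = "\<lambda>j. case j of Node0 \<Rightarrow> 1 | Node1 \<Rightarrow> (-1::int)"
  have P: "\<bar>?s j - word_length js\<bar> = 1 + int (length js)" "\<bar>?s k - word_length ks'\<bar> = 1 + int (length ks')"
    "?s j - word_length js = ?s k - word_length ks'"
    using Cons.prems unfolding ks word_length_Cons by simp_all
  have "?s i = 1 \<or> ?s i = -1" for i by (cases i) simp_all
  from this[of j] this[of k]
  have s: "?s j = ?s k" and "\<bar>word_length js\<bar> = int (length js)"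
    "\<bar>word_length ks'\<bar> = int (length ks')" "word_length js = word_length ks'"
    using P le by linarith+
  moreover have "j = k" using s by (cases j; cases k) simp_all
  ultimately have "js = ks'" "j = k" using Cons.IH by blast+
  then show ?case using Cons.IH ks by simp
qed

fun sigma_word :: "nat \<Rightarrow> affine_node list" where
  "sigma_word 0 = []"
| "sigma_word (Suc i) = Node1 # Node0 # sigma_word i"

lemma word_prod_sigma_word: "word_prod (sigma_word i) = sigma_even i"
proof -
  have "word_prod (sigma_word i) = (- int i, 1)"
    by (induction i) (simp_all add: word_prod_Cons, simp add: word_prod_def)
  moreover have "sigma_even i = (- int i, 1)"
  proof -
    interpret group affine_weyl by (rule group_affine_weyl)
    show ?thesis unfolding sigma_even_def by (induction i) simp_all
  qed
  ultimately show ?thesis by simp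
qed

text \<open>A reduced word of the same element is no longer than \<open>sigma_word i\<close> and has
  the same signed length, so it attains the length bound too and \<open>word_eq_of_length\<close>
  applies. This evaluates the \<open>THE\<close> in \<open>demYw\<close>.\<close>

lemma reduced_word_sigma:
  "(THE js. reduced_word js \<and> word_prod js = sigma_even i) = sigma_word i"
proof -
  have len: "\<bar>word_length (sigma_word i)\<bar> = int (length (sigma_word i))"
    "word_length (sigma_word i) \<le> 0"
    by (induction i) (simp_all add: word_length_Nil word_length_Cons)
  have "reduced_word (sigma_word i)"
    unfolding reduced_word_def using word_length_le len by (metis of_nat_le_iff)
  then have "reduced_word (sigma_word i) \<and> word_prod (sigma_word i) = sigma_even i"
    by (simp add: word_prod_sigma_word)
  moreover have "js = sigma_word i" if "reduced_word js" "word_prod js = sigma_even i" for js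
  proof (rule word_eq_of_length)
    have "length js \<le> length (sigma_word i)"
      using that word_prod_sigma_word[of i] unfolding reduced_word_def by simp
    then show "\<bar>word_length js\<bar> = int (length js)"
      using that word_prod_sigma_word[of i] len word_length_le[of js] by simp
  qed (use that word_prod_sigma_word[of i] len in simp_all)
  ultimately show ?thesis by (rule the_equality) blast+
qed

section \<open>Power series in infinitely many variables\<close>

lemma total_degree_eq_sum:
  assumes "finite K" "Poly_Mapping.keys m \<subseteq> K"
  shows "total_degree m = (\<Sum>v\<in>K. Poly_Mapping.lookup m v)"
  unfolding total_degree_def using assms by (intro sum.mono_neutral_left) (auto simp: in_keys_iff)

lemma total_degree_add: "total_degree (p + q) = total_degree p + total_degree q"
proof -
  let ?K = "Poly_Mapping.keys p \<union> Poly_Mapping.keys q"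
  have "total_degree r = (\<Sum>v\<in>?K. Poly_Mapping.lookup r v)" if "r \<in> {p, q, p + q}" for r
    using that Poly_Mapping.keys_add[of p q] by (intro total_degree_eq_sum) auto
  then show ?thesis by (simp add: lookup_add sum.distrib)
qed

lemma total_degree_0 [simp]: "total_degree 0 = 0"
  by (simp add: total_degree_def)

lemma total_degree_eq_0_iff: "total_degree m = 0 \<longleftrightarrow> m = 0"
proof
  assume "total_degree m = 0"
  then have "Poly_Mapping.lookup m v = 0" for v
    by (cases "v \<in> Poly_Mapping.keys m") (auto simp: total_degree_def in_keys_iff)
  then show "m = 0" by (intro poly_mapping_eqI) simp
qed simp

lemma total_degree_single [simp]: "total_degree (Poly_Mapping.single v n) = n"
  by (subst total_degree_eq_sum[of "{v}"]) auto

text \<open>Convolution is a finite sum even in infinitely many variables: a summand of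
  \<open>m\<close> is supported on the variables of \<open>m\<close>, and its exponents are bounded
  by the total degree.\<close>

lemma finite_splits: "finite {(p, q). p + q = (m :: 'v \<Rightarrow>\<^sub>0 nat)}"
proof -
  let ?A = "{p. \<exists>q. p + q = m}"
  let ?F = "{f. \<forall>v. (v \<in> Poly_Mapping.keys m \<longrightarrow> f v \<in> {..total_degree m}) \<and> (v \<notin> Poly_Mapping.keys m \<longrightarrow> f v = 0)}"
  have "finite ?F" by (rule finite_set_of_finite_funs) auto
  moreover have "Poly_Mapping.lookup ` ?A \<subseteq> ?F"
  proof
    fix f assume "f \<in> Poly_Mapping.lookup ` ?A"
    then obtain p q where f: "f = Poly_Mapping.lookup p" and m: "p + q = m" by auto
    have le: "f v \<le> Poly_Mapping.lookup m v" for v unfolding f m[symmetric] by (simp add: lookup_add)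
    have "Poly_Mapping.lookup m v \<le> total_degree m" if "v \<in> Poly_Mapping.keys m" for v
      unfolding total_degree_def using that by (intro member_le_sum) auto
    then have "f v \<le> total_degree m" if "v \<in> Poly_Mapping.keys m" for v
      using le[of v] that by (meson order_trans)
    moreover have "f v = 0" if "v \<notin> Poly_Mapping.keys m" for v
      using le[of v] that by (simp add: in_keys_iff)
    ultimately show "f \<in> ?F" by simp
  qed
  ultimately have "finite (Poly_Mapping.lookup ` ?A)" by (rule rev_finite_subset)
  moreover have "inj_on Poly_Mapping.lookup ?A" by (rule inj_onI) (metis poly_mapping_eqI)
  ultimately have "finite ?A" using finite_imageD by blast
  moreover have "{(p, q). p + q = m} \<subseteq> (\<lambda>p. (p, m - p)) ` ?A"
    by (auto simp: image_iff)
  ultimately show ?thesis using finite_surj by blast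
qed

abbreviation PS :: "(('v \<Rightarrow>\<^sub>0 nat) \<Rightarrow> 'r::comm_ring_1) ring" where
  "PS \<equiv> pser_ring"

abbreviation pcarrier :: "(('v \<Rightarrow>\<^sub>0 nat) \<Rightarrow> 'r::comm_ring_1) set" where
  "pcarrier \<equiv> carrier pser_ring"

lemma pser_carrier: "pcarrier = {f. \<forall>d. finite {m. total_degree m = d \<and> f m \<noteq> 0}}"
  by (simp add: pser_ring_def)

lemma pser_finite_le:
  assumes "f \<in> pcarrier"
  shows "finite {m. total_degree m \<le> d \<and> f m \<noteq> 0}"
proof -
  have "{m. total_degree m \<le> d \<and> f m \<noteq> 0} = (\<Union>e\<le>d. {m. total_degree m = e \<and> f m \<noteq> 0})" by auto
  then show ?thesis using assms by (auto simp: pser_carrier)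
qed

lemma pser_mult: "(f \<otimes>\<^bsub>PS\<^esub> g) m = (\<Sum>(p, q)\<in>{(p, q). p + q = m}. f p * g q)"
  by (simp add: pser_ring_def)

lemma pser_add: "(f \<oplus>\<^bsub>PS\<^esub> g) m = f m + g m"
  by (simp add: pser_ring_def)

lemma pser_zero: "\<zero>\<^bsub>PS\<^esub> m = 0"
  by (simp add: pser_ring_def)

definition pser_monom :: "'r::comm_ring_1 \<Rightarrow> ('v \<Rightarrow>\<^sub>0 nat) \<Rightarrow> ('v \<Rightarrow>\<^sub>0 nat) \<Rightarrow> 'r" where
  "pser_monom c k = (\<lambda>m. if m = k then c else 0)"

lemma pser_one: "\<one>\<^bsub>PS\<^esub> = pser_monom 1 0"
  by (simp add: pser_ring_def pser_monom_def)

lemma pser_var_monom: "pser_var v = pser_monom 1 (Poly_Mapping.single v 1)"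
  by (simp add: pser_var_def pser_monom_def)

lemma pser_monom_closed [simp]: "pser_monom c k \<in> pcarrier"
  by (auto simp: pser_carrier pser_monom_def)

lemma pser_var_closed [simp]: "pser_var v \<in> pcarrier"
  by (simp add: pser_var_monom)

lemma pser_one_closed: "\<one>\<^bsub>PS\<^esub> \<in> pcarrier"
  by (simp add: pser_one)

lemma pser_add_closed [simp]:
  assumes "f \<in> pcarrier" "g \<in> pcarrier"
  shows "f \<oplus>\<^bsub>PS\<^esub> g \<in> pcarrier"
proof -
  have "finite {m. total_degree m = d \<and> f m + g m \<noteq> 0}" for d
  proof (rule finite_subset)
    show "{m. total_degree m = d \<and> f m + g m \<noteq> 0}
      \<subseteq> {m. total_degree m = d \<and> f m \<noteq> 0} \<union> {m. total_degree m = d \<and> g m \<noteq> 0}" by auto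
  qed (use assms in \<open>auto simp: pser_carrier\<close>)
  then show ?thesis by (simp add: pser_carrier pser_add)
qed

lemma pser_mult_closed [simp]:
  assumes "f \<in> pcarrier" "g \<in> pcarrier"
  shows "f \<otimes>\<^bsub>PS\<^esub> g \<in> pcarrier"
proof -
  have "finite {m. total_degree m = d \<and> (f \<otimes>\<^bsub>PS\<^esub> g) m \<noteq> 0}" for d
  proof (rule finite_subset)
    \<comment> \<open>A factor of a monomial of degree \<open>d\<close> has degree at most
      \<open>d\<close>, and each series has only finitely many monomials up to that degree.\<close>
    let ?B = "\<lambda>f. {m. total_degree m \<le> d \<and> f m \<noteq> 0}"
    show "{m. total_degree m = d \<and> (f \<otimes>\<^bsub>PS\<^esub> g) m \<noteq> 0} \<subseteq> (\<lambda>(p, q). p + q) ` (?B f \<times> ?B g)"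
    proof
      fix m assume m: "m \<in> {m. total_degree m = d \<and> (f \<otimes>\<^bsub>PS\<^esub> g) m \<noteq> 0}"
      then have "(\<Sum>(p, q)\<in>{(p, q). p + q = m}. f p * g q) \<noteq> 0" by (simp add: pser_mult)
      then obtain z where "z \<in> {(p, q). p + q = m}" "(case z of (p, q) \<Rightarrow> f p * g q) \<noteq> 0"
        by (rule sum.not_neutral_contains_not_neutral)
      then obtain p q where pq: "p + q = m" "f p * g q \<noteq> 0" by auto
      then have "f p \<noteq> 0" "g q \<noteq> 0" by auto
      then have "(p, q) \<in> ?B f \<times> ?B g" using m pq(1) by (auto simp: total_degree_add)
      then show "m \<in> (\<lambda>(p, q). p + q) ` (?B f \<times> ?B g)" using pq(1) by force
    qed
  qed (use assms in \<open>auto intro!: pser_finite_le\<close>)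
  then show ?thesis by (simp add: pser_carrier)
qed

lemma pser_assoc:
  "f \<otimes>\<^bsub>PS\<^esub> g \<otimes>\<^bsub>PS\<^esub> h = f \<otimes>\<^bsub>PS\<^esub> (g \<otimes>\<^bsub>PS\<^esub> h)"
proof
  fix m :: "'a \<Rightarrow>\<^sub>0 nat"
  let ?S = "\<lambda>m :: 'a \<Rightarrow>\<^sub>0 nat. {(p, q). p + q = m}"
  have "(f \<otimes>\<^bsub>PS\<^esub> g \<otimes>\<^bsub>PS\<^esub> h) m = (\<Sum>z\<in>?S m. \<Sum>w\<in>?S (fst z). f (fst w) * g (snd w) * h (snd z))"
    by (simp add: pser_mult case_prod_beta sum_distrib_right)
  also have "\<dots> = (\<Sum>(z, w)\<in>Sigma (?S m) (\<lambda>z. ?S (fst z)). f (fst w) * g (snd w) * h (snd z))"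
    by (intro sum.Sigma) (auto simp: finite_splits)
  \<comment> \<open>Both double sums run over the triples with sum \<open>m\<close>, bracketed
    differently.\<close>
  also have "\<dots> = (\<Sum>(z, w)\<in>Sigma (?S m) (\<lambda>z. ?S (snd z)). f (fst z) * (g (fst w) * h (snd w)))"
    by (rule sum.reindex_bij_witness[of _ "\<lambda>(z, w). ((fst z + fst w, snd w), (fst z, fst w))"
          "\<lambda>(z, w). ((fst w, snd w + snd z), (snd w, snd z))"]) (auto simp: add.assoc mult.assoc)
  also have "\<dots> = (\<Sum>z\<in>?S m. \<Sum>w\<in>?S (snd z). f (fst z) * (g (fst w) * h (snd w)))"
    by (intro sum.Sigma[symmetric]) (auto simp: finite_splits)
  also have "\<dots> = (f \<otimes>\<^bsub>PS\<^esub> (g \<otimes>\<^bsub>PS\<^esub> h)) m"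
    by (simp add: pser_mult case_prod_beta sum_distrib_left)
  finally show "(f \<otimes>\<^bsub>PS\<^esub> g \<otimes>\<^bsub>PS\<^esub> h) m = (f \<otimes>\<^bsub>PS\<^esub> (g \<otimes>\<^bsub>PS\<^esub> h)) m" .
qed

lemma pser_comm: "f \<otimes>\<^bsub>PS\<^esub> g = g \<otimes>\<^bsub>PS\<^esub> f"
proof
  fix m
  show "(f \<otimes>\<^bsub>PS\<^esub> g) m = (g \<otimes>\<^bsub>PS\<^esub> f) m"
    unfolding pser_mult
    by (rule sum.reindex_bij_witness[of _ prod.swap prod.swap]) (auto simp: add.commute mult.commute)
qed

lemma pser_distr:
  "(f \<oplus>\<^bsub>PS\<^esub> g) \<otimes>\<^bsub>PS\<^esub> h = f \<otimes>\<^bsub>PS\<^esub> h \<oplus>\<^bsub>PS\<^esub> g \<otimes>\<^bsub>PS\<^esub> h"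
  by (rule ext) (simp add: pser_mult pser_add distrib_right sum.distrib case_prod_beta)

lemma pser_monom_mult:
  "(pser_monom c k \<otimes>\<^bsub>PS\<^esub> g) (k + m) = c * g m"
proof -
  have "(pser_monom c k \<otimes>\<^bsub>PS\<^esub> g) (k + m) = (\<Sum>(p, q)\<in>{(k, m)}. pser_monom c k p * g q)"
    unfolding pser_mult
    by (rule sum.mono_neutral_right) (auto simp: finite_splits pser_monom_def split: if_splits)
  then show ?thesis by (simp add: pser_monom_def)
qed

lemma pser_monom_mult_other:
  assumes "\<And>q. m \<noteq> k + q"
  shows "(pser_monom c k \<otimes>\<^bsub>PS\<^esub> g) m = 0"
  unfolding pser_mult by (rule sum.neutral) (use assms in \<open>auto simp: pser_monom_def\<close>)

lemma pser_monom_monom: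
  "pser_monom c k \<otimes>\<^bsub>PS\<^esub> pser_monom d l = pser_monom (c * d) (k + l)"
proof
  fix m
  show "(pser_monom c k \<otimes>\<^bsub>PS\<^esub> pser_monom d l) m = pser_monom (c * d) (k + l) m"
  proof (cases "\<exists>q. m = k + q")
    case True
    then show ?thesis by (auto simp: pser_monom_mult) (auto simp: pser_monom_def)
  next
    case False
    then have *: "(pser_monom c k \<otimes>\<^bsub>PS\<^esub> pser_monom d l) m = 0"
      by (intro pser_monom_mult_other) blast
    show ?thesis unfolding * using False by (auto simp: pser_monom_def)
  qed
qed

lemma pser_cring: "cring (pser_ring :: (('v \<Rightarrow>\<^sub>0 nat) \<Rightarrow> 'r::comm_ring_1) ring)" (is "cring ?P")
proof (rule cringI)
  show "abelian_group ?P"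
  proof (rule abelian_groupI)
    fix f :: "('v \<Rightarrow>\<^sub>0 nat) \<Rightarrow> 'r" assume f: "f \<in> pcarrier"
    have "(\<lambda>m. - f m) \<in> pcarrier" using f by (simp add: pser_carrier)
    moreover have "(\<lambda>m. - f m) \<oplus>\<^bsub>PS\<^esub> f = \<zero>\<^bsub>PS\<^esub>" by (rule ext) (simp add: pser_add pser_zero)
    ultimately show "\<exists>g\<in>pcarrier. g \<oplus>\<^bsub>PS\<^esub> f = \<zero>\<^bsub>PS\<^esub>" by blast
  next
    show "(\<zero>\<^bsub>PS\<^esub> :: ('v \<Rightarrow>\<^sub>0 nat) \<Rightarrow> 'r) \<in> pcarrier" by (simp add: pser_carrier pser_zero)
  qed (auto simp: pser_add pser_zero fun_eq_iff algebra_simps)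
  have one: "\<one>\<^bsub>PS\<^esub> \<otimes>\<^bsub>PS\<^esub> f = f" for f :: "('v \<Rightarrow>\<^sub>0 nat) \<Rightarrow> 'r"
  proof
    fix m
    show "(\<one>\<^bsub>PS\<^esub> \<otimes>\<^bsub>PS\<^esub> f) m = f m"
      using pser_monom_mult[of 1 0 f m] by (simp add: pser_one)
  qed
  show "comm_monoid ?P"
    by (rule comm_monoidI) (auto simp: one pser_assoc pser_one_closed intro: pser_comm)
qed (simp add: pser_distr)

interpretation P: cring pser_ring
  by (rule pser_cring)

lemma pser_uminus: "f \<in> pcarrier \<Longrightarrow> \<ominus>\<^bsub>PS\<^esub> f = (\<lambda>m. - f m)"
  by (rule P.minus_equality)
    (auto simp: pser_add pser_zero fun_eq_iff pser_carrier)

lemma pser_minus: "g \<in> pcarrier \<Longrightarrow> (f \<ominus>\<^bsub>PS\<^esub> g) m = f m - g m"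
  by (simp add: a_minus_def pser_add pser_uminus)

lemma pser_var_pow: "pser_var v [^]\<^bsub>PS\<^esub> n = pser_monom 1 (Poly_Mapping.single v n)"
  by (induction n) (auto simp: pser_one pser_var_monom pser_monom_monom single_add[symmetric])

text \<open>The quotient arises by shifting coefficients by one factor of the variable. The shift is
  injective and changes degrees by exactly one, so finiteness in each degree is kept.\<close>

lemma pser_var_mult_le:
  assumes f: "f \<in> pcarrier" and v: "\<And>m. f m \<noteq> 0 \<Longrightarrow> Poly_Mapping.lookup m v \<noteq> 0"
  shows "\<exists>g\<in>pcarrier. f = pser_var v \<otimes>\<^bsub>PS\<^esub> g"
proof
  let ?e = "Poly_Mapping.single v (1::nat)"
  let ?g = "\<lambda>m. f (?e + m)"
  have "finite {m. total_degree m = d \<and> ?g m \<noteq> 0}" for d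
  proof (rule finite_imageD)
    show "finite ((\<lambda>m. ?e + m) ` {m. total_degree m = d \<and> ?g m \<noteq> 0})"
      by (rule finite_subset[of _ "{m. total_degree m = Suc d \<and> f m \<noteq> 0}"])
        (use f in \<open>auto simp: pser_carrier total_degree_add\<close>)
  qed (auto simp: inj_on_def)
  then show "?g \<in> pcarrier" by (simp add: pser_carrier)
  show "f = pser_var v \<otimes>\<^bsub>PS\<^esub> ?g"
  proof
    fix m
    show "f m = (pser_var v \<otimes>\<^bsub>PS\<^esub> ?g) m"
    proof (cases "\<exists>q. m = ?e + q")
      case True
      then show ?thesis by (auto simp: pser_var_monom pser_monom_mult)
    next
      case False
      have "f m = 0"
      proof (rule ccontr)
        assume "f m \<noteq> 0"
        then have "Poly_Mapping.lookup m v \<noteq> 0" by (rule v)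
        then have "m = ?e + (m - ?e)"
          by (intro poly_mapping_eqI) (auto simp: lookup_add lookup_minus lookup_single when_def)
        then show False using False by blast
      qed
      then show ?thesis using False by (auto simp: pser_var_monom pser_monom_mult_other)
    qed
  qed
qed

text \<open>Continuity of multiplication in the topology given by the degree; it is what makes the
  closure of an ideal an ideal.\<close>

lemma pser_mult_agree:
  assumes "\<And>m. total_degree m < n \<Longrightarrow> g m = h m" "total_degree m < n"
  shows "(f \<otimes>\<^bsub>PS\<^esub> g) m = (f \<otimes>\<^bsub>PS\<^esub> h) m"
  unfolding pser_mult using assms by (intro sum.cong) (auto simp: total_degree_add)

lemma pser_closure_ideal:
  assumes I: "ideal I (pser_ring :: (('v \<Rightarrow>\<^sub>0 nat) \<Rightarrow> 'r::comm_ring_1) ring)"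
  shows "ideal (pser_closure I) pser_ring"
proof -
  interpret I: ideal I pser_ring by (rule I)
  have mult: "f \<otimes>\<^bsub>PS\<^esub> x \<in> pser_closure I" if "f \<in> pcarrier" "x \<in> pser_closure I" for f x
  proof -
    have "\<exists>g\<in>I. \<forall>m. total_degree m < n \<longrightarrow> (f \<otimes>\<^bsub>PS\<^esub> x) m = g m" for n
    proof -
      obtain g where "g \<in> I" "\<forall>m. total_degree m < n \<longrightarrow> x m = g m"
        using \<open>x \<in> pser_closure I\<close> by (auto simp: pser_closure_def)
      then show ?thesis using \<open>f \<in> pcarrier\<close>
        by (intro bexI[of _ "f \<otimes>\<^bsub>PS\<^esub> g"]) (auto intro: pser_mult_agree I.I_l_closed)
    qed
    then show ?thesis using that by (auto simp: pser_closure_def)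
  qed
  show ?thesis
  proof (rule idealI)
    show "subgroup (pser_closure I) (add_monoid pser_ring)"
    proof (rule P.add.subgroupI)
      show "pser_closure I \<subseteq> pcarrier" by (auto simp: pser_closure_def)
      show "pser_closure I \<noteq> {}" 
      proof -
        have "\<zero>\<^bsub>PS\<^esub> \<in> pser_closure I" using I.zero_closed by (auto simp: pser_closure_def)
        then show ?thesis by blast
      qed
      fix f assume f: "f \<in> pser_closure I"
      then have "\<ominus>\<^bsub>PS\<^esub> \<one>\<^bsub>PS\<^esub> \<otimes>\<^bsub>PS\<^esub> f \<in> pser_closure I" by (intro mult) auto
      moreover have "\<ominus>\<^bsub>PS\<^esub> \<one>\<^bsub>PS\<^esub> \<otimes>\<^bsub>PS\<^esub> f = \<ominus>\<^bsub>PS\<^esub> f"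
        using f by (simp add: P.l_minus pser_closure_def)
      ultimately show "\<ominus>\<^bsub>PS\<^esub> f \<in> pser_closure I" by simp
      fix g assume g: "g \<in> pser_closure I"
      have "\<exists>h\<in>I. \<forall>m. total_degree m < n \<longrightarrow> (f \<oplus>\<^bsub>PS\<^esub> g) m = h m" for n
      proof -
        obtain f' g' where "f' \<in> I" "\<forall>m. total_degree m < n \<longrightarrow> f m = f' m"
          "g' \<in> I" "\<forall>m. total_degree m < n \<longrightarrow> g m = g' m"
          using f g unfolding pser_closure_def by blast
        then show ?thesis
          by (intro bexI[of _ "f' \<oplus>\<^bsub>PS\<^esub> g'"]) (auto simp: pser_add I.a_closed)
      qed
      then show "f \<oplus>\<^bsub>PS\<^esub> g \<in> pser_closure I" using f g by (auto simp: pser_closure_def)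
    qed
    fix a x :: "('v \<Rightarrow>\<^sub>0 nat) \<Rightarrow> 'r"
    assume "a \<in> pser_closure I" "x \<in> pcarrier"
    then show "x \<otimes>\<^bsub>PS\<^esub> a \<in> pser_closure I" "a \<otimes>\<^bsub>PS\<^esub> x \<in> pser_closure I"
      using mult pser_comm[of a x] by auto
  qed (rule P.ring_axioms)
qed

text \<open>The closure is itself closed: below degree \<open>n\<close>, an approximation of an
  approximation is again an approximation.\<close>

lemma pser_closure_limit:
  assumes "f \<in> pcarrier" "\<And>n. \<exists>g\<in>pser_closure I. \<forall>m. total_degree m < n \<longrightarrow> f m = g m"
  shows "f \<in> pser_closure I"
proof -
  have "\<exists>g\<in>I. \<forall>m. total_degree m < n \<longrightarrow> f m = g m" for n
  proof -
    obtain g where "g \<in> pser_closure I" "\<forall>m. total_degree m < n \<longrightarrow> f m = g m" using assms(2) by blast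
    moreover from \<open>g \<in> pser_closure I\<close> obtain h where "h \<in> I" "\<forall>m. total_degree m < n \<longrightarrow> g m = h m"
      unfolding pser_closure_def by blast
    ultimately show ?thesis by auto
  qed
  then show ?thesis using assms(1) by (simp add: pser_closure_def)
qed

lemma pser_subst2_var:
  "pser_subst2 F (pser_var a) (pser_var b) m =
    (\<Sum>(i, j)\<in>{(i, j). i + j \<le> total_degree m}.
      F $ j $ i * (if m = Poly_Mapping.single a i + Poly_Mapping.single b j then 1 else 0))"
  unfolding pser_subst2_def pser_var_pow pser_monom_monom by (simp add: pser_monom_def)

lemma finite_le_pairs: "finite {(i, j). i + j \<le> (d::nat)}"
  by (rule finite_subset[of _ "{..d} \<times> {..d}"]) auto

lemma pser_subst2_var_closed [simp]: "pser_subst2 F (pser_var a) (pser_var b) \<in> pcarrier"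
proof -
  have "finite {m. total_degree m = d \<and> pser_subst2 F (pser_var a) (pser_var b) m \<noteq> 0}" for d
  proof (rule finite_subset)
    show "{m. total_degree m = d \<and> pser_subst2 F (pser_var a) (pser_var b) m \<noteq> 0}
      \<subseteq> (\<lambda>(i, j). Poly_Mapping.single a i + Poly_Mapping.single b j) ` {(i, j). i + j \<le> d}"
    proof
      fix m assume m: "m \<in> {m. total_degree m = d \<and> pser_subst2 F (pser_var a) (pser_var b) m \<noteq> 0}"
      then obtain z where "z \<in> {(i, j). i + j \<le> d}" "(case z of (i, j) \<Rightarrow>
        F $ j $ i * (if m = Poly_Mapping.single a i + Poly_Mapping.single b j then 1 else 0)) \<noteq> 0"
        by (auto simp: pser_subst2_var elim!: sum.not_neutral_contains_not_neutral)
      then show "m \<in> (\<lambda>(i, j). Poly_Mapping.single a i + Poly_Mapping.single b j) ` {(i, j). i + j \<le> d}"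
        by (force split: if_splits)
    qed
  qed (simp add: finite_le_pairs)
  then show ?thesis by (simp add: pser_carrier)
qed

section \<open>The formal group ring\<close>

text \<open>Compare the coefficients of the \<open>j\<close>-th power of the variable in F(0, x) = x
  and in F(x, 0) = x; terms with a positive power of 0 drop out.\<close>

lemma fgl_coeff_0:
  assumes "formal_group_law F"
  shows "F $ j $ 0 = (if j = 1 then 1 else 0)" "F $ 0 $ j = (if j = 1 then 1 else 0)"
proof -
  let ?x = "pser_var (0::nat) :: (nat \<Rightarrow>\<^sub>0 nat) \<Rightarrow> 'a"
  let ?m = "Poly_Mapping.single (0::nat) j"
  have x: "pser_subst2 F ?x \<zero>\<^bsub>PS\<^esub> = ?x" "pser_subst2 F \<zero>\<^bsub>PS\<^esub> ?x = ?x"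
    using assms by (auto simp: formal_group_law_def Let_def)
  have single: "Poly_Mapping.single (0::nat) i = Poly_Mapping.single 0 k \<longleftrightarrow> i = k" for i k :: nat
    by (metis lookup_single_eq)
  \<comment> \<open>The zeroth power of 0 is 1, which keeps exactly the terms that are pure in the
    other variable.\<close>
  have zero_pow: "\<zero>\<^bsub>PS\<^esub> [^]\<^bsub>PS\<^esub> i = (if i = 0 then \<one>\<^bsub>PS\<^esub> else (\<zero>\<^bsub>PS\<^esub> :: (nat \<Rightarrow>\<^sub>0 nat) \<Rightarrow> 'a))"
    for i :: nat by (simp add: P.nat_pow_zero)
  have monom: "pser_monom (1::'a) (Poly_Mapping.single (0::nat) k) ?m = (if k = j then 1 else 0)" for k
    by (auto simp: pser_monom_def single)
  have term1: "((\<zero>\<^bsub>PS\<^esub> [^]\<^bsub>PS\<^esub> i) \<otimes>\<^bsub>PS\<^esub> pser_monom (1::'a) (Poly_Mapping.single (0::nat) k)) ?m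
      = (if i = 0 \<and> k = j then 1 else 0)" for i k :: nat
    by (cases "i = 0") (simp_all add: zero_pow monom pser_zero)
  have term2: "(pser_monom (1::'a) (Poly_Mapping.single (0::nat) k) \<otimes>\<^bsub>PS\<^esub> (\<zero>\<^bsub>PS\<^esub> [^]\<^bsub>PS\<^esub> i)) ?m
      = (if k = j \<and> i = 0 then 1 else 0)" for i k :: nat
    by (cases "i = 0") (simp_all add: zero_pow monom pser_zero)
  have "pser_subst2 F \<zero>\<^bsub>PS\<^esub> ?x ?m = (\<Sum>(i, j)\<in>{(0, j)}. F $ j $ i)"
    unfolding pser_subst2_def pser_var_pow
    by (rule sum.mono_neutral_cong_right)
      (auto simp: finite_le_pairs term1 term2 split: if_splits)
  then show "F $ j $ 0 = (if j = 1 then 1 else 0)"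
    unfolding x by (auto simp: pser_var_def single)
  have "pser_subst2 F ?x \<zero>\<^bsub>PS\<^esub> ?m = (\<Sum>(i, j)\<in>{(j, 0)}. F $ j $ i)"
    unfolding pser_subst2_def pser_var_pow
    by (rule sum.mono_neutral_cong_right)
      (auto simp: finite_le_pairs term1 term2 split: if_splits)
  then show "F $ 0 $ j = (if j = 1 then 1 else 0)"
    unfolding x by (auto simp: pser_var_def single)
qed

locale fgl =
  fixes F :: "'r::comm_ring_1 fps fps"
  assumes fgl: "formal_group_law F"
begin

abbreviation J where "J \<equiv> fgr_ideal F"
abbreviation S where "S \<equiv> fgr F"
abbreviation P where "P \<equiv> (pser_ring :: ((int \<Rightarrow>\<^sub>0 nat) \<Rightarrow> 'r) ring)"
abbreviation \<pi> where "\<pi> f \<equiv> J +>\<^bsub>P\<^esub> f"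
abbreviation xv :: "int \<Rightarrow> (int \<Rightarrow>\<^sub>0 nat) \<Rightarrow> 'r" where "xv n \<equiv> pser_var n"
abbreviation FX where "FX a b \<equiv> pser_subst2 F (xv a) (xv b)"

lemma relations_closed: "fgr_relations F \<subseteq> carrier P"
  by (auto simp: fgr_relations_def)

lemma J_ideal: "ideal J P"
  unfolding fgr_ideal_def by (intro pser_closure_ideal P.genideal_ideal relations_closed)

sublocale J: ideal J P by (rule J_ideal)

sublocale S: cring S
  unfolding fgr_def by (rule J.quotient_is_cring) (rule pser_cring)

lemma pi_hom: "(\<lambda>f. \<pi> f) \<in> ring_hom P S"
  unfolding fgr_def by (rule J.rcos_ring_hom)

lemma pi_closed [simp]: "f \<in> carrier P \<Longrightarrow> \<pi> f \<in> carrier S"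
  by (rule ring_hom_closed[OF pi_hom])

lemma pi_add [simp]: "f \<in> carrier P \<Longrightarrow> g \<in> carrier P \<Longrightarrow> \<pi> (f \<oplus>\<^bsub>P\<^esub> g) = \<pi> f \<oplus>\<^bsub>S\<^esub> \<pi> g"
  by (rule ring_hom_add[OF pi_hom])

lemma pi_mult [simp]: "f \<in> carrier P \<Longrightarrow> g \<in> carrier P \<Longrightarrow> \<pi> (f \<otimes>\<^bsub>P\<^esub> g) = \<pi> f \<otimes>\<^bsub>S\<^esub> \<pi> g"
  by (rule ring_hom_mult[OF pi_hom])

lemma pi_zero [simp]: "\<pi> \<zero>\<^bsub>P\<^esub> = \<zero>\<^bsub>S\<^esub>"
  by (rule ring_hom_zero[OF pi_hom P.ring_axioms S.ring_axioms])

lemma pi_one [simp]: "\<pi> \<one>\<^bsub>P\<^esub> = \<one>\<^bsub>S\<^esub>"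
  by (rule ring_hom_one[OF pi_hom])

lemma pi_uminus [simp]: "f \<in> carrier P \<Longrightarrow> \<pi> (\<ominus>\<^bsub>P\<^esub> f) = \<ominus>\<^bsub>S\<^esub> \<pi> f"
  by (rule S.minus_equality[symmetric]) (simp_all add: P.l_neg flip: pi_add)

lemma pi_pow [simp]: "f \<in> carrier P \<Longrightarrow> \<pi> (f [^]\<^bsub>P\<^esub> (n::nat)) = \<pi> f [^]\<^bsub>S\<^esub> n"
  by (induction n) auto

lemma S_cases:
  assumes "c \<in> carrier S"
  obtains f where "f \<in> carrier P" "c = \<pi> f"
proof -
  have "c \<in> (\<Union>f\<in>carrier P. {\<pi> f})"
    using assms by (simp only: fgr_def FactRing_def partial_object.simps A_RCOSETS_def')
  then show ?thesis using that by blast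
qed

lemma S_zero: "\<zero>\<^bsub>S\<^esub> = J"
  unfolding fgr_def FactRing_def by (simp only: ring.simps)

lemma pi_eq_zero: "f \<in> J \<Longrightarrow> \<pi> f = \<zero>\<^bsub>S\<^esub>"
  unfolding S_zero by (rule J.a_rcos_const)

lemma pi_eqI:
  assumes "f \<in> carrier P" "g \<in> carrier P" "f \<ominus>\<^bsub>P\<^esub> g \<in> J"
  shows "\<pi> f = \<pi> g"
proof -
  have "\<pi> f \<ominus>\<^bsub>S\<^esub> \<pi> g = \<zero>\<^bsub>S\<^esub>"
    using pi_eq_zero[OF assms(3)] assms by (simp add: a_minus_def)
  then show ?thesis using assms by simp
qed

lemma pi_eqD:
  assumes f: "f \<in> carrier P" "g \<in> carrier P" and eq: "\<pi> f = \<pi> g"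
  shows "f \<ominus>\<^bsub>P\<^esub> g \<in> J"
proof -
  have "\<pi> (f \<ominus>\<^bsub>P\<^esub> g) = \<zero>\<^bsub>S\<^esub>"
    using f eq by (simp add: a_minus_def S.r_neg)
  then have "\<pi> (f \<ominus>\<^bsub>P\<^esub> g) = J" by (simp only: S_zero)
  moreover have "f \<ominus>\<^bsub>P\<^esub> g \<in> \<pi> (f \<ominus>\<^bsub>P\<^esub> g)" using f by (intro J.a_rcos_self) simp
  ultimately show ?thesis by simp
qed

lemma X_zero: "xv 0 \<in> J" and F_relation: "xv (a + b) \<ominus>\<^bsub>P\<^esub> FX a b \<in> J"
proof -
  have "fgr_relations F \<subseteq> J"
    unfolding fgr_ideal_def using P.genideal_self[OF relations_closed] relations_closed
    by (auto simp: pser_closure_def)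
  then show "xv 0 \<in> J" "xv (a + b) \<ominus>\<^bsub>P\<^esub> FX a b \<in> J" unfolding fgr_relations_def by blast+
qed

lemma pi_F: "\<pi> (xv (a + b)) = \<pi> (FX a b)"
  by (rule pi_eqI) (auto simp: F_relation)

lemma fgr_x_pi: "fgr_x F n = \<pi> (xv n)"
  by (simp add: fgr_x_def)

section \<open>Divisibility by powers of \<open>x\<close> in the formal group ring\<close>

abbreviation x where "x \<equiv> fgr_x F 1"
abbreviation y where "y \<equiv> fgr_x F (-1)"

lemma x_closed [simp]: "fgr_x F n \<in> carrier S"
  by (simp add: fgr_x_pi)

text \<open>Modulo the first variable, F(x_1, x_b) becomes F(0, x_b) = x_b.\<close>

lemma FX_split: "\<exists>g\<in>carrier P. FX 1 b = xv b \<oplus>\<^bsub>P\<^esub> xv 1 \<otimes>\<^bsub>P\<^esub> g"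
proof -
  have "Poly_Mapping.lookup m 1 \<noteq> 0" if "(FX 1 b \<ominus>\<^bsub>P\<^esub> xv b) m \<noteq> 0" for m
  proof
    assume m: "Poly_Mapping.lookup m 1 = 0"
    let ?K = "{(i, j). i + j \<le> total_degree m}"
    \<comment> \<open>For \<open>b = 1\<close> both exponents belong to the same variable; vanishing
      of their sum still gives \<open>i = 0\<close>.\<close>
    have i0: "i = 0" if "m = Poly_Mapping.single 1 i + Poly_Mapping.single b j" for i j
      using m by (simp add: that lookup_add lookup_single when_def)
    have summand: "F $ j $ i * (if m = Poly_Mapping.single 1 i + Poly_Mapping.single b j then 1 else 0)
        = (if (i, j) = (0, 1) \<and> m = Poly_Mapping.single b 1 then 1 else 0)" for i j
    proof (cases "m = Poly_Mapping.single 1 i + Poly_Mapping.single b j")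
      case True
      then have "i = 0" by (rule i0)
      then show ?thesis using True by (auto simp: fgl_coeff_0(1)[OF fgl])
    qed auto
    have "FX 1 b m = (\<Sum>z\<in>?K. if z = (0, 1) then xv b m else 0)"
      unfolding pser_subst2_var by (intro sum.cong) (auto simp: summand pser_var_def split: if_splits)
    also have "\<dots> = (if (0, 1) \<in> ?K then xv b m else 0)"
      by (rule sum.delta[OF finite_le_pairs])
    also have "\<dots> = xv b m" by (auto simp: pser_var_def)
    finally show False using that by (simp add: pser_minus)
  qed
  then obtain g where g: "g \<in> carrier P" "FX 1 b \<ominus>\<^bsub>P\<^esub> xv b = xv 1 \<otimes>\<^bsub>P\<^esub> g"
    using pser_var_mult_le[of "FX 1 b \<ominus>\<^bsub>P\<^esub> xv b" 1] by auto
  have "FX 1 b = xv b \<oplus>\<^bsub>P\<^esub> (FX 1 b \<ominus>\<^bsub>P\<^esub> xv b)"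
    by (rule ext) (simp add: pser_add pser_minus)
  then show ?thesis using g by metis
qed

text \<open>Divisibility is meant in the quotient \<open>S\<close>: distinct variables do not divide
  each other among power series, and only the formal group relations make every
  \<open>fgr_x F n\<close> a multiple of \<open>x\<close>.\<close>

definition divx where "divx k c \<longleftrightarrow> (\<exists>h\<in>carrier S. c = x [^]\<^bsub>S\<^esub> (k::nat) \<otimes>\<^bsub>S\<^esub> h)"

lemma divx_add:
  assumes "divx k c" "divx k d" shows "divx k (c \<oplus>\<^bsub>S\<^esub> d)"
proof -
  obtain g h where "g \<in> carrier S" "h \<in> carrier S" "c = x [^]\<^bsub>S\<^esub> k \<otimes>\<^bsub>S\<^esub> g" "d = x [^]\<^bsub>S\<^esub> k \<otimes>\<^bsub>S\<^esub> h"
    using assms unfolding divx_def by blast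
  then show ?thesis unfolding divx_def by (intro bexI[of _ "g \<oplus>\<^bsub>S\<^esub> h"]) (auto simp: S.r_distr)
qed

lemma divx_mult:
  assumes "divx k c" "divx l d" shows "divx (k + l) (c \<otimes>\<^bsub>S\<^esub> d)"
proof -
  obtain g h where "g \<in> carrier S" "h \<in> carrier S" "c = x [^]\<^bsub>S\<^esub> k \<otimes>\<^bsub>S\<^esub> g" "d = x [^]\<^bsub>S\<^esub> l \<otimes>\<^bsub>S\<^esub> h"
    using assms unfolding divx_def by blast
  then show ?thesis unfolding divx_def
    by (intro bexI[of _ "g \<otimes>\<^bsub>S\<^esub> h"]) (auto simp: S.m_ac S.nat_pow_mult[symmetric])
qed

lemma divx_0: "c \<in> carrier S \<Longrightarrow> divx 0 c"
  by (auto simp: divx_def)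

lemma divx_zero: "divx k \<zero>\<^bsub>S\<^esub>"
  by (auto simp: divx_def intro!: bexI[of _ "\<zero>\<^bsub>S\<^esub>"])

lemma divx_x: "c \<in> carrier S \<Longrightarrow> divx 1 (x \<otimes>\<^bsub>S\<^esub> c)"
  by (auto simp: divx_def)

lemma divx_uminus: "divx k c \<Longrightarrow> divx k (\<ominus>\<^bsub>S\<^esub> c)"
  unfolding divx_def by (auto simp: S.r_minus[symmetric])

text \<open>Adding one root changes the variable by a multiple of \<open>x\<close>
  (\<open>FX_split\<close>), and \<open>xv 0\<close> vanishes in \<open>S\<close>. Walking from 0 in
  both directions reaches every \<open>n\<close>.\<close>

lemma divx_pi_X: "divx 1 (\<pi> (xv n))"
proof -
  have step: "\<exists>c. divx 1 c \<and> c \<in> carrier S \<and> \<pi> (xv (1 + n)) = \<pi> (xv n) \<oplus>\<^bsub>S\<^esub> c" for n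
  proof -
    obtain g where g: "g \<in> carrier P" "FX 1 n = xv n \<oplus>\<^bsub>P\<^esub> xv 1 \<otimes>\<^bsub>P\<^esub> g" using FX_split by blast
    then have "\<pi> (xv (1 + n)) = \<pi> (xv n) \<oplus>\<^bsub>S\<^esub> x \<otimes>\<^bsub>S\<^esub> \<pi> g" unfolding pi_F by (simp add: fgr_x_pi)
    then show ?thesis using g by (intro exI[of _ "x \<otimes>\<^bsub>S\<^esub> \<pi> g"]) (auto simp: divx_x[simplified])
  qed
  show ?thesis
  proof (induction n rule: int_induct[where k = 0])
    case base
    show ?case by (simp add: pi_eq_zero X_zero divx_zero)
  next
    case (step1 i)
    then show ?case using step[of i] divx_add by (auto simp: add.commute)
  next
    case (step2 i)
    obtain c where c: "divx 1 c" "c \<in> carrier S" "\<pi> (xv i) = \<pi> (xv (i - 1)) \<oplus>\<^bsub>S\<^esub> c"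
      using step[of "i - 1"] by auto
    have e: "\<pi> (xv (i - 1)) = \<pi> (xv i) \<oplus>\<^bsub>S\<^esub> \<ominus>\<^bsub>S\<^esub> c"
      unfolding c(3) using c(2) by (simp add: S.a_assoc S.r_neg)
    show ?case unfolding e by (intro divx_add divx_uminus step2 c)
  qed
qed

text \<open>Each variable of the monomial, counted with multiplicity, contributes one factor
  \<open>x\<close>.\<close>

lemma divx_pi_monom: "divx (total_degree k) (\<pi> (pser_monom c k))"
proof (induction "total_degree k" arbitrary: k)
  case 0
  then show ?case by (simp add: divx_0)
next
  case (Suc d)
  then have "k \<noteq> 0" by auto
  then obtain v where "Poly_Mapping.lookup k v \<noteq> 0" by (metis poly_mapping_eqI lookup_zero)
  then have k: "k = Poly_Mapping.single v 1 + (k - Poly_Mapping.single v 1)"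
    by (intro poly_mapping_eqI) (auto simp: lookup_add lookup_minus lookup_single when_def)
  let ?k = "k - Poly_Mapping.single v 1"
  have deg: "total_degree k = 1 + total_degree ?k"
    by (subst k) (simp add: total_degree_add)
  have "pser_monom c k = xv v \<otimes>\<^bsub>P\<^esub> pser_monom c ?k"
    by (subst k) (simp add: pser_var_monom pser_monom_monom)
  then have e: "\<pi> (pser_monom c k) = \<pi> (xv v) \<otimes>\<^bsub>S\<^esub> \<pi> (pser_monom c ?k)" by simp
  have "d = total_degree ?k" using Suc deg by simp
  then have "divx (total_degree ?k) (\<pi> (pser_monom c ?k))" by (rule Suc)
  then show ?case unfolding deg e by (rule divx_mult[OF divx_pi_X])
qed

text \<open>By the definition of the carrier a homogeneous series is a finite sum of monomials.
  Membership in the carrier is part of the induction because additivity of \<open>\<pi>\<close>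
  requires it.\<close>

lemma divx_pi_homogeneous:
  assumes "f \<in> carrier P" "\<And>m. f m \<noteq> 0 \<Longrightarrow> total_degree m = d"
  shows "divx d (\<pi> f)"
proof -
  have "\<forall>f. {m. f m \<noteq> 0} \<subseteq> U \<longrightarrow> divx d (\<pi> f) \<and> f \<in> carrier P" if "finite U" "\<forall>m\<in>U. total_degree m = d" for U
    using that
  proof (induction U rule: finite_induct)
    case empty
    have "f = \<zero>\<^bsub>P\<^esub>" if "{m. f m \<noteq> 0} \<subseteq> {}" for f using that by (auto simp: pser_zero fun_eq_iff)
    moreover have "divx d (\<pi> \<zero>\<^bsub>P\<^esub>) \<and> \<zero>\<^bsub>P\<^esub> \<in> carrier P" by (simp add: divx_zero)
    ultimately show ?case by metis
  next
    case (insert k U)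
    show ?case
    proof (intro allI impI)
      fix f :: "(int \<Rightarrow>\<^sub>0 nat) \<Rightarrow> 'r" assume f: "{m. f m \<noteq> 0} \<subseteq> insert k U"
      let ?g = "\<lambda>m. if m = k then 0 else f m"
      have "{m. ?g m \<noteq> 0} \<subseteq> U" using f by auto
      moreover have "\<forall>m\<in>U. total_degree m = d" using insert.prems by simp
      ultimately have "divx d (\<pi> ?g) \<and> ?g \<in> carrier P"
        by (intro insert.IH[THEN spec, THEN mp]) auto
      then have g: "divx d (\<pi> ?g)" "?g \<in> carrier P" by blast+
      have "f = pser_monom (f k) k \<oplus>\<^bsub>P\<^esub> ?g"
        by (rule ext) (simp add: pser_add pser_monom_def)
      moreover have "divx d (\<pi> (pser_monom (f k) k \<oplus>\<^bsub>P\<^esub> ?g))"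
        using g insert.prems divx_pi_monom[of k "f k"] divx_add by simp
      moreover have "pser_monom (f k) k \<oplus>\<^bsub>P\<^esub> ?g \<in> carrier P" using g by simp
      ultimately show "divx d (\<pi> f) \<and> f \<in> carrier P" by simp
    qed
  qed
  moreover have "finite {m. f m \<noteq> 0}"
    using assms by (auto simp: pser_carrier elim!: rev_finite_subset)
  ultimately show ?thesis using assms(2) by blast
qed

text \<open>Modulo \<open>J\<close> each homogeneous component of degree \<open>d\<close> is \<open>x\<^sub>1\<^sup>d\<close> times a series; as \<open>J\<close> is closed,
  these congruences can be summed over all \<open>d\<close>.\<close>

lemma divx_pi_order:
  assumes f: "f \<in> carrier P" and order: "\<And>m. total_degree m < k \<Longrightarrow> f m = 0"
  shows "divx k (\<pi> f)"
proof -
  let ?f = "\<lambda>d m. if total_degree m = d then f m else 0"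
  have fd: "?f d \<in> carrier P" for d
    using f by (auto simp: pser_carrier elim!: rev_finite_subset)
  have "\<exists>h. h \<in> carrier P \<and> \<pi> (?f d) = \<pi> (xv 1 [^]\<^bsub>P\<^esub> d \<otimes>\<^bsub>P\<^esub> h)" for d
  proof -
    have "divx d (\<pi> (?f d))" by (rule divx_pi_homogeneous[OF fd]) (simp split: if_splits)
    then obtain c where "c \<in> carrier S" "\<pi> (?f d) = x [^]\<^bsub>S\<^esub> d \<otimes>\<^bsub>S\<^esub> c" by (auto simp: divx_def)
    moreover obtain h where "h \<in> carrier P" "c = \<pi> h" using S_cases calculation by blast
    ultimately show ?thesis by (auto simp: fgr_x_pi)
  qed
  then have "\<exists>h. \<forall>d. h d \<in> carrier P \<and> \<pi> (?f d) = \<pi> (xv 1 [^]\<^bsub>P\<^esub> d \<otimes>\<^bsub>P\<^esub> h d)"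
    by (intro choice allI)
  then obtain h where h_all: "\<forall>d. h d \<in> carrier P \<and> \<pi> (?f d) = \<pi> (xv 1 [^]\<^bsub>P\<^esub> d \<otimes>\<^bsub>P\<^esub> h d)" ..
  then have h: "h d \<in> carrier P" "\<pi> (?f d) = \<pi> (xv 1 [^]\<^bsub>P\<^esub> d \<otimes>\<^bsub>P\<^esub> h d)" for d
    by (rule allE, blast)+
  \<comment> \<open>Modulo \<open>J\<close> the component of degree \<open>k + d\<close> of
    \<open>f\<close> is \<open>x^(k + d)\<close> times \<open>h (k + d)\<close>. The factor
    \<open>x^k\<close> is split off, and what remains has order at least \<open>d\<close>.\<close>
  let ?t = "\<lambda>d. xv 1 [^]\<^bsub>P\<^esub> d \<otimes>\<^bsub>P\<^esub> h (k + d)"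
  have t0: "?t d m = 0" if "total_degree m < d" for d m
    unfolding pser_var_pow by (rule pser_monom_mult_other) (use that in \<open>auto simp: total_degree_add\<close>)
  \<comment> \<open>The infinite sum of the \<open>?t d\<close>, cut off at the degree of the
    coefficient because later summands do not contribute to it.\<close>
  let ?H = "\<lambda>m. \<Sum>d\<le>total_degree m. ?t d m"
  define Hn where "Hn n = (\<lambda>m. \<Sum>d<n. ?t d m)" for n
  \<comment> \<open>The truncation bound is \<open>k + n\<close> because \<open>x^k\<close> times
    the first \<open>n\<close> summands of \<open>?H\<close> accounts for the components of
    \<open>f\<close> of degrees \<open>k\<close> to \<open>k + n - 1\<close>.\<close>
  define fn where "fn n = (\<lambda>m. if total_degree m < k + n then f m else 0)" for n
  have H: "?H \<in> carrier P"
  proof -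
    have "finite {m. total_degree m = e \<and> ?H m \<noteq> 0}" for e
    proof (rule finite_subset)
      show "{m. total_degree m = e \<and> ?H m \<noteq> 0} \<subseteq> (\<Union>d\<le>e. {m. total_degree m = e \<and> ?t d m \<noteq> 0})"
        by (auto elim!: sum.not_neutral_contains_not_neutral)
      have "?t d \<in> carrier P" for d using h by simp
      then show "finite (\<Union>d\<le>e. {m. total_degree m = e \<and> ?t d m \<noteq> 0})"
        unfolding pser_carrier by blast
    qed
    then show ?thesis by (simp add: pser_carrier)
  qed
  have H_agree: "?H m = Hn n m" if "total_degree m < n" for m n
    unfolding Hn_def by (rule sum.mono_neutral_left) (use that t0 in auto)
  have partial: "Hn n \<in> carrier P \<and> fn n \<in> carrier P \<and> \<pi> (fn n) = \<pi> (xv 1 [^]\<^bsub>P\<^esub> k \<otimes>\<^bsub>P\<^esub> Hn n)" for n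
  proof (induction n)
    case 0
    have "Hn 0 = \<zero>\<^bsub>P\<^esub>" "fn 0 = \<zero>\<^bsub>P\<^esub>" using order by (auto simp: Hn_def fn_def pser_zero fun_eq_iff)
    then show ?case by simp
  next
    case (Suc n)
    have Hs: "Hn (Suc n) = Hn n \<oplus>\<^bsub>P\<^esub> ?t n" by (rule ext) (simp add: Hn_def pser_add)
    have fs: "fn (Suc n) = fn n \<oplus>\<^bsub>P\<^esub> ?f (k + n)" by (rule ext) (auto simp: fn_def pser_add)
    have "xv 1 [^]\<^bsub>P\<^esub> k \<otimes>\<^bsub>P\<^esub> ?t n = xv 1 [^]\<^bsub>P\<^esub> (k + n) \<otimes>\<^bsub>P\<^esub> h (k + n)"
      using h by (simp add: P.nat_pow_mult[symmetric] P.m_assoc)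
    then have t: "\<pi> (?f (k + n)) = \<pi> (xv 1 [^]\<^bsub>P\<^esub> k \<otimes>\<^bsub>P\<^esub> ?t n)" using h(2) by simp
    have c: "?t n \<in> carrier P" "xv 1 [^]\<^bsub>P\<^esub> k \<in> carrier P" using h(1) by simp_all
    have "\<pi> (fn n \<oplus>\<^bsub>P\<^esub> ?f (k + n))
        = \<pi> (xv 1 [^]\<^bsub>P\<^esub> k \<otimes>\<^bsub>P\<^esub> Hn n) \<oplus>\<^bsub>S\<^esub> \<pi> (xv 1 [^]\<^bsub>P\<^esub> k \<otimes>\<^bsub>P\<^esub> ?t n)"
      unfolding t[symmetric] using Suc fd by simp
    also have "\<dots> = \<pi> (xv 1 [^]\<^bsub>P\<^esub> k \<otimes>\<^bsub>P\<^esub> (Hn n \<oplus>\<^bsub>P\<^esub> ?t n))"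
      using Suc c by (simp add: P.r_distr del: pi_mult)
    finally show ?case unfolding Hs fs using Suc c fd by blast
  qed
  \<comment> \<open>The congruence is known for all truncations. Below degree \<open>n\<close> the
    truncated and the full difference agree, so closedness of \<open>J\<close> gives the full
    congruence.\<close>
  have "f \<ominus>\<^bsub>P\<^esub> xv 1 [^]\<^bsub>P\<^esub> k \<otimes>\<^bsub>P\<^esub> ?H \<in> J"
    unfolding fgr_ideal_def
  proof (rule pser_closure_limit)
    show "f \<ominus>\<^bsub>P\<^esub> xv 1 [^]\<^bsub>P\<^esub> k \<otimes>\<^bsub>P\<^esub> ?H \<in> carrier P" using f H by simp
    fix n
    have "fn n \<ominus>\<^bsub>P\<^esub> xv 1 [^]\<^bsub>P\<^esub> k \<otimes>\<^bsub>P\<^esub> Hn n \<in> J"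
      using partial[of n] by (intro pi_eqD) (auto simp del: pi_mult)
    moreover have "(f \<ominus>\<^bsub>P\<^esub> xv 1 [^]\<^bsub>P\<^esub> k \<otimes>\<^bsub>P\<^esub> ?H) m = (fn n \<ominus>\<^bsub>P\<^esub> xv 1 [^]\<^bsub>P\<^esub> k \<otimes>\<^bsub>P\<^esub> Hn n) m"
      if "total_degree m < n" for m
    proof -
      have "(xv 1 [^]\<^bsub>P\<^esub> k \<otimes>\<^bsub>P\<^esub> ?H) m = (xv 1 [^]\<^bsub>P\<^esub> k \<otimes>\<^bsub>P\<^esub> Hn n) m"
        by (rule pser_mult_agree[OF H_agree that])
      moreover have "f m = fn n m" using that by (simp add: fn_def)
      ultimately show ?thesis using partial[of n] H by (simp add: pser_minus)
    qed
    ultimately show "\<exists>g\<in>pser_closure (Idl\<^bsub>P\<^esub> (fgr_relations F)). \<forall>m. total_degree m < n \<longrightarrow>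
        (f \<ominus>\<^bsub>P\<^esub> xv 1 [^]\<^bsub>P\<^esub> k \<otimes>\<^bsub>P\<^esub> ?H) m = g m"
      unfolding fgr_ideal_def[symmetric] by blast
  qed
  then have "\<pi> f = \<pi> (xv 1 [^]\<^bsub>P\<^esub> k \<otimes>\<^bsub>P\<^esub> ?H)" using f H by (intro pi_eqI) auto
  also have "\<dots> = x [^]\<^bsub>S\<^esub> k \<otimes>\<^bsub>S\<^esub> \<pi> ?H" using H by (simp add: fgr_x_pi)
  finally show ?thesis unfolding divx_def by (rule bexI) (rule pi_closed[OF H])
qed


lemma y_divides: "\<exists>u\<in>carrier S. y = x \<otimes>\<^bsub>S\<^esub> u"
  using divx_pi_X[of "-1"] by (simp add: divx_def fgr_x_pi)

text \<open>In \<open>S\<close> one has 0 = F(x, y), and this series begins with x + y, so the sum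
  is represented by a series of order at least two. This is the source of the integrality of
  \<open>kappa F\<close>.\<close>

lemma x_plus_y_divides: "\<exists>h\<in>carrier S. x \<oplus>\<^bsub>S\<^esub> y = x \<otimes>\<^bsub>S\<^esub> x \<otimes>\<^bsub>S\<^esub> h"
proof -
  let ?f = "xv 1 \<oplus>\<^bsub>P\<^esub> xv (-1) \<ominus>\<^bsub>P\<^esub> FX 1 (-1)"
  \<comment> \<open>Keeps the linear monomials of \<open>x\<close> and \<open>y\<close> apart when
    the coefficients of degree one are computed.\<close>
  have single_inj: "Poly_Mapping.single (1::int) i = Poly_Mapping.single (-1) j \<longleftrightarrow> i = 0 \<and> j = 0" for i j :: nat
  proof
    assume e: "Poly_Mapping.single (1::int) i = Poly_Mapping.single (-1) j"
    from arg_cong[OF e, of "\<lambda>p. Poly_Mapping.lookup p 1"] arg_cong[OF e, of "\<lambda>p. Poly_Mapping.lookup p (-1)"]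
    show "i = 0 \<and> j = 0" by (simp add: lookup_single when_def)
  qed simp
  have "\<pi> (FX 1 (-1)) = \<zero>\<^bsub>S\<^esub>"
    using pi_F[of 1 "-1"] X_zero by (simp add: pi_eq_zero)
  then have "\<pi> ?f = x \<oplus>\<^bsub>S\<^esub> y" by (simp add: a_minus_def fgr_x_pi)
  moreover have "?f m = 0" if "total_degree m < 2" for m
  proof -
    have f_apply: "?f m = xv 1 m + xv (-1) m - FX 1 (-1) m" by (simp add: pser_minus pser_add)
    have "total_degree m = 0 \<or> total_degree m = 1" using that by linarith
    then consider "m = 0" | "total_degree m = 1" unfolding total_degree_eq_0_iff by blast
    then show ?thesis
    proof cases
      case 1
      have pairs: "{(i, j). i + j \<le> (0::nat)} = {(0, 0)}" by auto
      have xv_0: "(xv a :: (int \<Rightarrow>\<^sub>0 nat) \<Rightarrow> 'r) 0 = 0" for a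
        by (simp add: pser_var_def) (metis total_degree_0 total_degree_single nat.distinct(1))
      have "FX 1 (-1) 0 = F $ 0 $ 0"
        unfolding pser_subst2_var total_degree_0 pairs by simp
      then show ?thesis
        unfolding f_apply using 1 xv_0 by (simp add: fgl_coeff_0[OF fgl])
    next
      case 2
      have pairs: "{(i, j). i + j \<le> (1::nat)} = {(0, 0), (0, 1), (1, 0)}" by auto
      have "FX 1 (-1) m = xv 1 m + xv (-1) m"
        unfolding pser_subst2_var 2 pairs using 2
        by (auto simp: fgl_coeff_0[OF fgl] pser_var_def single_inj)
      then show ?thesis by (simp add: f_apply)
    qed
  qed
  ultimately have "divx 2 (x \<oplus>\<^bsub>S\<^esub> y)" using divx_pi_order[of ?f 2] by simp
  then show ?thesis by (auto simp: divx_def numeral_2_eq_2 S.m_assoc)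
qed

section \<open>The Weyl group action on the formal group ring\<close>

abbreviation neg where "neg w \<equiv> Poly_Mapping.map_key (\<lambda>n::int. w * n) :: (int \<Rightarrow>\<^sub>0 nat) \<Rightarrow> _"

context
  fixes w :: int
  assumes w: "w \<in> {1, -1}"
begin

lemma w_sq [simp]: "w * (w * n) = n"
  using w by auto

lemma lookup_neg [simp]: "Poly_Mapping.lookup (neg w m) n = Poly_Mapping.lookup m (w * n)"
  using w by (subst map_key.rep_eq) (auto simp: inj_def)

lemma neg_neg [simp]: "neg w (neg w m) = m"
  by (rule poly_mapping_eqI) simp

lemma neg_add: "neg w (p + q) = neg w p + neg w q"
  by (rule poly_mapping_eqI) (simp add: lookup_add)

lemma neg_eq_iff: "neg w p = q \<longleftrightarrow> p = neg w q"
  by (metis neg_neg)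

lemma neg_single: "neg w (Poly_Mapping.single a i) = Poly_Mapping.single (w * a) i"
  by (rule poly_mapping_eqI) (use w in \<open>auto simp: lookup_single when_def\<close>)

lemma total_degree_neg [simp]: "total_degree (neg w m) = total_degree m"
  unfolding total_degree_def
  by (rule sum.reindex_bij_witness[of _ "\<lambda>n. w * n" "\<lambda>n. w * n"]) (auto simp: in_keys_iff)

lemma weyl_weyl [simp]: "weyl_pser w (weyl_pser w f) = f"
  by (rule ext) (simp add: weyl_pser_def)

lemma weyl_pser_closed [simp]:
  assumes "f \<in> carrier P" shows "weyl_pser w f \<in> carrier P"
proof -
  have "finite {m. total_degree m = d \<and> f (neg w m) \<noteq> 0}" for d
  proof (rule finite_surj[of "{m. total_degree m = d \<and> f m \<noteq> 0}" _ "neg w"])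
    show "{m. total_degree m = d \<and> f (neg w m) \<noteq> 0} \<subseteq> neg w ` {m. total_degree m = d \<and> f m \<noteq> 0}"
      by (auto intro!: image_eqI[of _ "neg w" "neg w _"])
  qed (use assms in \<open>auto simp: pser_carrier\<close>)
  then show ?thesis by (simp add: pser_carrier weyl_pser_def)
qed

lemma weyl_pser_mult: "weyl_pser w (f \<otimes>\<^bsub>P\<^esub> g) = weyl_pser w f \<otimes>\<^bsub>P\<^esub> weyl_pser w g"
proof
  fix m
  show "weyl_pser w (f \<otimes>\<^bsub>P\<^esub> g) m = (weyl_pser w f \<otimes>\<^bsub>P\<^esub> weyl_pser w g) m"
    unfolding weyl_pser_def pser_mult
    by (rule sum.reindex_bij_witness[of _ "map_prod (neg w) (neg w)" "map_prod (neg w) (neg w)"])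
      (auto simp: neg_add[symmetric] neg_eq_iff)
qed

lemma weyl_pser_add: "weyl_pser w (f \<oplus>\<^bsub>P\<^esub> g) = weyl_pser w f \<oplus>\<^bsub>P\<^esub> weyl_pser w g"
  by (rule ext) (simp add: weyl_pser_def pser_add)

lemma weyl_pser_minus:
  "g \<in> carrier P \<Longrightarrow> weyl_pser w (f \<ominus>\<^bsub>P\<^esub> g) = weyl_pser w f \<ominus>\<^bsub>P\<^esub> weyl_pser w g"
  by (rule ext) (simp add: pser_minus, simp add: weyl_pser_def pser_minus)

lemma weyl_pser_monom: "weyl_pser w (pser_monom c k) = pser_monom c (neg w k)"
  by (rule ext) (simp add: weyl_pser_def pser_monom_def neg_eq_iff)

lemma weyl_pser_one: "weyl_pser w \<one>\<^bsub>P\<^esub> = \<one>\<^bsub>P\<^esub>"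
proof -
  have "neg w 0 = 0" by (rule poly_mapping_eqI) simp
  then show ?thesis by (simp add: pser_one weyl_pser_monom)
qed

lemma weyl_pser_var: "weyl_pser w (xv n) = xv (w * n)"
  by (simp add: pser_var_monom weyl_pser_monom neg_single)

lemma weyl_pser_hom: "weyl_pser w \<in> ring_hom P P"
  by (rule ring_hom_memI) (simp_all add: weyl_pser_mult weyl_pser_add weyl_pser_one)

lemma weyl_pser_FX: "weyl_pser w (FX a b) = FX (w * a) (w * b)"
  by (rule ext) (simp add: weyl_pser_def pser_subst2_var neg_eq_iff neg_add neg_single)

text \<open>The relations are mapped to relations, so the preimage of the generated ideal is an
  ideal containing them. As the action preserves degrees, stability passes to the closure.\<close>

lemma weyl_pser_J:
  assumes "f \<in> J" shows "weyl_pser w f \<in> J"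
proof -
  let ?I = "Idl\<^bsub>P\<^esub> (fgr_relations F)"
  let ?K = "{f \<in> carrier P. weyl_pser w f \<in> ?I}"
  interpret W: ring_hom_ring P P "weyl_pser w"
    by (rule ring_hom_ringI2[OF P.ring_axioms P.ring_axioms weyl_pser_hom])
  interpret I: ideal ?I P by (rule P.genideal_ideal[OF relations_closed])
  have rel: "fgr_relations F \<subseteq> ?I" by (rule P.genideal_self[OF relations_closed])
  have "ideal ?K P"
  proof (rule idealI)
    show "subgroup ?K (add_monoid P)"
      by (rule P.add.subgroupI) (auto simp: weyl_pser_add I.a_closed intro!: exI[of _ "\<zero>\<^bsub>P\<^esub>"] I.a_inv_closed)
  qed (auto simp: P.ring_axioms weyl_pser_mult I.I_l_closed I.I_r_closed)
  moreover have "fgr_relations F \<subseteq> ?K"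
  proof
    fix r assume r: "r \<in> fgr_relations F"
    have "weyl_pser w r \<in> fgr_relations F"
    proof (cases "r = xv 0")
      case True
      then have "weyl_pser w r = xv 0" by (simp add: weyl_pser_var)
      then show ?thesis unfolding fgr_relations_def by blast
    next
      case False
      then obtain a b where "r = xv (a + b) \<ominus>\<^bsub>P\<^esub> FX a b" using r unfolding fgr_relations_def by blast
      then have "weyl_pser w r = xv (w * a + w * b) \<ominus>\<^bsub>P\<^esub> FX (w * a) (w * b)"
        by (simp add: weyl_pser_minus weyl_pser_var weyl_pser_FX distrib_left)
      then show ?thesis unfolding fgr_relations_def by blast
    qed
    then show "r \<in> ?K" using rel r relations_closed by blast
  qed
  ultimately have "?I \<subseteq> ?K" by (rule P.genideal_minimal)
  then have K: "weyl_pser w g \<in> ?I" if "g \<in> ?I" for g using that by blast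
  have "\<exists>g\<in>?I. \<forall>m. total_degree m < n \<longrightarrow> weyl_pser w f m = g m" for n
  proof -
    obtain g where "g \<in> ?I" "\<forall>m. total_degree m < n \<longrightarrow> f m = g m"
      using assms unfolding fgr_ideal_def pser_closure_def by blast
    then show ?thesis
      by (intro bexI[of _ "weyl_pser w g"] K) (simp_all add: weyl_pser_def)
  qed
  then show ?thesis
    using assms unfolding fgr_ideal_def pser_closure_def by simp
qed

text \<open>The image of a coset is a full coset because \<open>weyl_pser w\<close>, an involution,
  maps \<open>J\<close> onto itself.\<close>

lemma weyl_fgr_pi:
  assumes f: "f \<in> carrier P"
  shows "weyl_fgr w (\<pi> f) = \<pi> (weyl_pser w f)"
proof -
  have "weyl_pser w ` (\<Union>h\<in>J. {h \<oplus>\<^bsub>P\<^esub> f}) = (\<Union>h\<in>weyl_pser w ` J. {h \<oplus>\<^bsub>P\<^esub> weyl_pser w f})"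
    unfolding image_UN by (simp add: weyl_pser_add)
  moreover have "weyl_pser w ` J = J"
  proof
    show "weyl_pser w ` J \<subseteq> J" using weyl_pser_J by blast
    show "J \<subseteq> weyl_pser w ` J"
    proof
      fix f assume "f \<in> J"
      then show "f \<in> weyl_pser w ` J" by (intro image_eqI[of _ _ "weyl_pser w f"]) (simp_all add: weyl_pser_J)
    qed
  qed
  ultimately show ?thesis unfolding weyl_fgr_def a_r_coset_def' by simp
qed

lemma weyl_fgr_hom: "weyl_fgr w \<in> ring_hom S S"
proof (rule ring_hom_memI)
  fix c d assume c: "c \<in> carrier S" "d \<in> carrier S"
  then obtain f g where f: "f \<in> carrier P" "c = \<pi> f" and g: "g \<in> carrier P" "d = \<pi> g"
    by (elim S_cases)
  have "weyl_fgr w (\<pi> (f \<otimes>\<^bsub>P\<^esub> g)) = \<pi> (weyl_pser w f \<otimes>\<^bsub>P\<^esub> weyl_pser w g)"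
    using f g by (subst weyl_fgr_pi) (simp_all only: weyl_pser_mult pser_mult_closed)
  then show "weyl_fgr w (c \<otimes>\<^bsub>S\<^esub> d) = weyl_fgr w c \<otimes>\<^bsub>S\<^esub> weyl_fgr w d"
    using f g by (simp add: weyl_fgr_pi)
  have "weyl_fgr w (\<pi> (f \<oplus>\<^bsub>P\<^esub> g)) = \<pi> (weyl_pser w f \<oplus>\<^bsub>P\<^esub> weyl_pser w g)"
    using f g by (subst weyl_fgr_pi) (simp_all only: weyl_pser_add pser_add_closed)
  then show "weyl_fgr w (c \<oplus>\<^bsub>S\<^esub> d) = weyl_fgr w c \<oplus>\<^bsub>S\<^esub> weyl_fgr w d"
    using f g by (simp add: weyl_fgr_pi)
next
  show "weyl_fgr w \<one>\<^bsub>S\<^esub> = \<one>\<^bsub>S\<^esub>"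
    unfolding pi_one[symmetric] by (subst weyl_fgr_pi) (simp_all only: weyl_pser_one P.one_closed)
qed (auto elim!: S_cases simp: weyl_fgr_pi)

lemma weyl_fgr_weyl_fgr: "c \<in> carrier S \<Longrightarrow> weyl_fgr w (weyl_fgr w c) = c"
  by (erule S_cases) (simp add: weyl_fgr_pi)

lemma weyl_fgr_x: "weyl_fgr w (fgr_x F n) = fgr_x F (w * n)"
  by (simp add: fgr_x_pi weyl_fgr_pi weyl_pser_var)

end

lemma weyl_fgr_1: "c \<in> carrier S \<Longrightarrow> weyl_fgr 1 c = c"
proof -
  have "weyl_pser 1 f = f" for f :: "(int \<Rightarrow>\<^sub>0 nat) \<Rightarrow> 'r"
  proof
    fix m
    have "neg 1 m = m" by (rule poly_mapping_eqI) (simp only: lookup_neg insertI1, simp)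
    then show "weyl_pser 1 f m = f m" by (simp add: weyl_pser_def)
  qed
  then show ?thesis by (simp add: weyl_fgr_def)
qed

text \<open>A series and its reflection have the same constant term, and a series without constant
  term is divisible by \<open>x\<close> in \<open>S\<close>.\<close>

lemma demazure_divides:
  assumes "c \<in> carrier S"
  shows "\<exists>d\<in>carrier S. c \<ominus>\<^bsub>S\<^esub> weyl_fgr (-1) c = x \<otimes>\<^bsub>S\<^esub> d"
proof -
  obtain f where f: "f \<in> carrier P" "c = \<pi> f" using assms by (rule S_cases)
  let ?g = "f \<ominus>\<^bsub>P\<^esub> weyl_pser (-1) f"
  have "?g m = 0" if "total_degree m < 1" for m
  proof -
    have m: "m = 0" using that total_degree_eq_0_iff[of m] by simp
    have "neg (-1) 0 = 0" by (rule poly_mapping_eqI) simp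
    moreover have "?g m = f m - weyl_pser (-1) f m" using f by (simp add: pser_minus)
    ultimately show ?thesis unfolding m weyl_pser_def by simp
  qed
  then have "divx 1 (\<pi> ?g)" using f by (intro divx_pi_order) auto
  then show ?thesis using f by (simp add: divx_def weyl_fgr_pi a_minus_def)
qed

end

section \<open>The localized formal group ring and the Peterson subalgebra\<close>

locale fgl_regular = fgl F for F :: "'r::comm_ring_1 fps fps" +
  assumes regular_x: "regular_elt (fgr F) (fgr_x F 1)"
    and regular_y: "regular_elt (fgr F) (fgr_x F (-1))"
begin

abbreviation M where "M \<equiv> fgr_denoms F"
abbreviation K where "K \<equiv> fgrQ F"
abbreviation emb where "emb \<equiv> fgrQ_of F"

lemma submonoid_M: "submonoid M S"
  unfolding fgr_denoms_def by (rule submonoid_generated_submonoid) (auto simp: S.monoid_axioms)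

lemma multiplicative_M: "multiplicative_set S M"
  by (intro multiplicative_set.intro multiplicative_set_axioms.intro submonoid_M S.cring_axioms)

interpretation Q: multiplicative_set S M
  rewrites "localization S M = K"
  by (rule multiplicative_M) (simp add: fgrQ_def)

lemma K_cring: "cring K"
  by (rule Q.cring_L)

sublocale K: cring K
  by (rule K_cring)

lemma x_in_M: "x \<in> M" "y \<in> M"
  unfolding fgr_denoms_def by (rule subsetD[OF submonoid_generated_incl], simp)+

text \<open>Products of the two regular generators stay regular; this is what embeds
  \<open>S\<close> into \<open>fgrQ F\<close>.\<close>

lemma M_regular:
  assumes "s \<in> M" shows "regular_elt S s"
proof -
  have "M \<subseteq> {s. regular_elt S s}"
    unfolding fgr_denoms_def
    by (rule submonoid_generated_minimal[OF S.submonoid_regular]) (simp add: regular_x regular_y)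
  then show ?thesis using assms by (rule subsetD[THEN CollectD])
qed

lemma emb_hom: "emb \<in> ring_hom S K"
  by (rule Q.frac_hom)

lemma emb_closed [simp]: "c \<in> carrier S \<Longrightarrow> emb c \<in> carrier K"
  by (rule ring_hom_closed[OF emb_hom])

lemma emb_mult: "c \<in> carrier S \<Longrightarrow> d \<in> carrier S \<Longrightarrow> emb (c \<otimes>\<^bsub>S\<^esub> d) = emb c \<otimes>\<^bsub>K\<^esub> emb d"
  by (rule ring_hom_mult[OF emb_hom])

lemma emb_add: "c \<in> carrier S \<Longrightarrow> d \<in> carrier S \<Longrightarrow> emb (c \<oplus>\<^bsub>S\<^esub> d) = emb c \<oplus>\<^bsub>K\<^esub> emb d"
  by (rule ring_hom_add[OF emb_hom])

lemma emb_one: "emb \<one>\<^bsub>S\<^esub> = \<one>\<^bsub>K\<^esub>"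
  by (rule ring_hom_one[OF emb_hom])

lemma emb_zero: "emb \<zero>\<^bsub>S\<^esub> = \<zero>\<^bsub>K\<^esub>"
  by (rule ring_hom_zero[OF emb_hom S.ring_axioms K.ring_axioms])

lemma emb_uminus: "c \<in> carrier S \<Longrightarrow> emb (\<ominus>\<^bsub>S\<^esub> c) = \<ominus>\<^bsub>K\<^esub> emb c"
  by (rule Q.frac_uminus[symmetric]) auto

lemma emb_inject: "c \<in> carrier S \<Longrightarrow> d \<in> carrier S \<Longrightarrow> emb c = emb d \<Longrightarrow> c = d"
  by (rule Q.frac_inject[OF M_regular])

lemma inv_x_closed [simp]: "inv_x F 1 \<in> carrier K" "inv_x F (-1) \<in> carrier K"
  unfolding inv_x_def using x_in_M by auto

lemma inv_x_mult: "emb x \<otimes>\<^bsub>K\<^esub> inv_x F 1 = \<one>\<^bsub>K\<^esub>" "emb y \<otimes>\<^bsub>K\<^esub> inv_x F (-1) = \<one>\<^bsub>K\<^esub>"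
  unfolding inv_x_def using x_in_M by (simp_all add: Q.frac_inverse)

lemma frac_y_x:
  assumes "u \<in> carrier S" "y = x \<otimes>\<^bsub>S\<^esub> u"
  shows "emb u = fgrQ_frac F y x"
  by (rule Q.frac_eq) (use assms x_in_M in auto)

context
  fixes w :: int
  assumes w: "w \<in> {1, -1}"
begin

lemma weyl_fgr_closed: "c \<in> carrier S \<Longrightarrow> weyl_fgr w c \<in> carrier S"
  by (rule ring_hom_closed[OF weyl_fgr_hom[OF w]])

text \<open>The nontrivial \<open>w\<close> exchanges the two generators of \<open>M\<close>.
  Stability of \<open>M\<close> under an involution already means that \<open>M\<close> is mapped
  onto itself.\<close>

lemma weyl_fgr_M: "weyl_fgr w ` M = M"
proof -
  have "submonoid {s \<in> M. weyl_fgr w s \<in> M} S"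
  proof
    show "{s \<in> M. weyl_fgr w s \<in> M} \<subseteq> carrier S" using Q.M_closed by blast
    show "\<one>\<^bsub>S\<^esub> \<in> {s \<in> M. weyl_fgr w s \<in> M}" using ring_hom_one[OF weyl_fgr_hom[OF w]] by simp
    fix s t assume "s \<in> {s \<in> M. weyl_fgr w s \<in> M}" "t \<in> {s \<in> M. weyl_fgr w s \<in> M}"
    then show "s \<otimes>\<^bsub>S\<^esub> t \<in> {s \<in> M. weyl_fgr w s \<in> M}"
      by (simp add: ring_hom_mult[OF weyl_fgr_hom[OF w]])
  qed
  moreover have "{x, y} \<subseteq> {s \<in> M. weyl_fgr w s \<in> M}"
    using w x_in_M by (auto simp: weyl_fgr_x)
  ultimately have "M \<subseteq> {s \<in> M. weyl_fgr w s \<in> M}"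
    unfolding fgr_denoms_def by (rule submonoid_generated_minimal)
  then have *: "weyl_fgr w s \<in> M" if "s \<in> M" for s using that by blast
  show ?thesis
  proof
    show "weyl_fgr w ` M \<subseteq> M" using * by blast
    show "M \<subseteq> weyl_fgr w ` M"
    proof
      fix s assume "s \<in> M"
      then show "s \<in> weyl_fgr w ` M"
        using * weyl_fgr_weyl_fgr[OF w, of s] by (intro image_eqI[of _ _ "weyl_fgr w s"]) auto
    qed
  qed
qed

lemma weyl_fgrQ_frac:
  assumes "c \<in> carrier S" "s \<in> M"
  shows "weyl_fgrQ w (fgrQ_frac F c s) = fgrQ_frac F (weyl_fgr w c) (weyl_fgr w s)"
  unfolding weyl_fgrQ_def
proof (rule Q.map_prod_frac[OF weyl_fgr_hom[OF w] _ weyl_fgr_M assms])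
  show "bij_betw (weyl_fgr w) (carrier S) (carrier S)"
    by (rule bij_betw_byWitness[of _ "weyl_fgr w"]) (auto simp: weyl_fgr_weyl_fgr[OF w] weyl_fgr_closed)
qed

lemma weyl_fgr_in_M: "s \<in> M \<Longrightarrow> weyl_fgr w s \<in> M"
  using weyl_fgr_M by blast

lemma weyl_fgrQ_hom: "weyl_fgrQ w \<in> ring_hom K K"
proof (rule ring_hom_memI)
  note h = ring_hom_mult[OF weyl_fgr_hom[OF w]] ring_hom_add[OF weyl_fgr_hom[OF w]]
    ring_hom_one[OF weyl_fgr_hom[OF w]]
  show "weyl_fgrQ w \<one>\<^bsub>K\<^esub> = \<one>\<^bsub>K\<^esub>"
    by (simp add: Q.one_L weyl_fgrQ_frac h)
  fix p q assume "p \<in> carrier K"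
  then obtain c s where p: "c \<in> carrier S" "s \<in> M" "p = fgrQ_frac F c s" by (rule Q.L_cases)
  then show "weyl_fgrQ w p \<in> carrier K" by (simp add: weyl_fgrQ_frac weyl_fgr_closed weyl_fgr_in_M)
  assume "q \<in> carrier K"
  then obtain d t where q: "d \<in> carrier S" "t \<in> M" "q = fgrQ_frac F d t" by (rule Q.L_cases)
  show "weyl_fgrQ w (p \<otimes>\<^bsub>K\<^esub> q) = weyl_fgrQ w p \<otimes>\<^bsub>K\<^esub> weyl_fgrQ w q"
    using p q by (simp add: Q.frac_mult weyl_fgrQ_frac weyl_fgr_closed weyl_fgr_in_M h)
  show "weyl_fgrQ w (p \<oplus>\<^bsub>K\<^esub> q) = weyl_fgrQ w p \<oplus>\<^bsub>K\<^esub> weyl_fgrQ w q"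
    using p q by (simp add: Q.frac_add weyl_fgrQ_frac weyl_fgr_closed weyl_fgr_in_M h)
qed

lemma weyl_fgrQ_weyl_fgrQ: "c \<in> carrier K \<Longrightarrow> weyl_fgrQ w (weyl_fgrQ w c) = c"
  by (erule Q.L_cases)
    (simp add: weyl_fgrQ_frac weyl_fgr_closed weyl_fgr_in_M weyl_fgr_weyl_fgr[OF w])

lemma weyl_fgrQ_of: "c \<in> carrier S \<Longrightarrow> weyl_fgrQ w (emb c) = emb (weyl_fgr w c)"
  by (simp add: weyl_fgrQ_frac ring_hom_one[OF weyl_fgr_hom[OF w]])

lemma weyl_fgrQ_inv_x: "n \<in> {1, -1} \<Longrightarrow> weyl_fgrQ w (inv_x F n) = inv_x F (w * n)"
  unfolding inv_x_def using x_in_M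
  by (auto simp: weyl_fgrQ_frac ring_hom_one[OF weyl_fgr_hom[OF w]] weyl_fgr_x[OF w])

end

lemma weyl_fgrQ_1: "c \<in> carrier K \<Longrightarrow> weyl_fgrQ 1 c = c"
  by (erule Q.L_cases) (simp add: weyl_fgrQ_frac weyl_fgr_1)

end

section \<open>The twisted group ring \<open>QWa F\<close> and its action on
  \<open>QQv F\<close>\<close>

context fgl_regular
begin

abbreviation QW where "QW \<equiv> QWa F"
abbreviation V where "V \<equiv> QQv F"
abbreviation E where "E \<equiv> etaWa F"
abbreviation e where "e \<equiv> eta K integer_group"

text \<open>Translations act trivially, so the action law only involves the finite parts, where it
  says that the reflection is an involution.\<close>

lemma twisted_QW: "twisted K affine_weyl (\<lambda>u. weyl_fgrQ (snd u))"
proof (intro twisted.intro twisted_axioms.intro K_cring group_affine_weyl)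
  fix u v c
  assume u: "u \<in> carrier affine_weyl"
  then show "weyl_fgrQ (snd u) \<in> ring_hom K K" by (intro weyl_fgrQ_hom) auto
  assume v: "v \<in> carrier affine_weyl" and c: "c \<in> carrier K"
  have neg: "weyl_fgrQ (-1) c \<in> carrier K" by (rule ring_hom_closed[OF weyl_fgrQ_hom c]) simp
  obtain a b a' b' where "u = (a, b)" "v = (a', b')" "b \<in> {1, -1}" "b' \<in> {1, -1}"
    using u v by auto
  then show "weyl_fgrQ (snd (u \<otimes>\<^bsub>affine_weyl\<^esub> v)) c = weyl_fgrQ (snd u) (weyl_fgrQ (snd v) c)"
    using c neg by (auto simp: weyl_fgrQ_1 weyl_fgrQ_weyl_fgrQ)
qed (simp add: weyl_fgrQ_1)

lemma comm_group_algebra_V: "comm_group_algebra K integer_group"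
  by (intro comm_group_algebraI K_cring abelian_integer_group)

sublocale QW: ring QW
  unfolding QWa_def by (rule twisted.ring_T[OF twisted_QW])

sublocale V: cring V
  unfolding QQv_def by (rule comm_group_algebra.cring_T[OF comm_group_algebra_V])

lemmas twisted_V = comm_group_algebra.axioms(1)[OF comm_group_algebra_V]

lemma carrier_QW: "f \<in> carrier QW \<longleftrightarrow>
    f \<in> (UNIV \<times> {1, -1}) \<rightarrow>\<^sub>E carrier K \<and> finite {u \<in> UNIV \<times> {1, -1}. f u \<noteq> \<zero>\<^bsub>K\<^esub>}"
  unfolding QWa_def twisted.carrier_T[OF twisted_QW] by simp

lemma carrier_V: "f \<in> carrier V \<longleftrightarrow> f \<in> UNIV \<rightarrow> carrier K \<and> finite {n. f n \<noteq> \<zero>\<^bsub>K\<^esub>}"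
  unfolding QQv_def twisted.carrier_T[OF twisted_V] by (simp add: PiE_def)

lemma e_closed [simp]: "c \<in> carrier K \<Longrightarrow> e c n \<in> carrier V"
  unfolding QQv_def by (rule twisted.mono_closed[OF twisted_V])

lemma e_mult: "c \<in> carrier K \<Longrightarrow> d \<in> carrier K \<Longrightarrow> e c m \<otimes>\<^bsub>V\<^esub> e d n = e (c \<otimes>\<^bsub>K\<^esub> d) (m + n)"
  using twisted.mono_mult[OF twisted_V, of c m d n] by (simp add: QQv_def)

lemma e_add: "c \<in> carrier K \<Longrightarrow> d \<in> carrier K \<Longrightarrow> e c n \<oplus>\<^bsub>V\<^esub> e d n = e (c \<oplus>\<^bsub>K\<^esub> d) n"
  unfolding QQv_def by (rule twisted.mono_add[OF twisted_V])

lemma e_one: "\<one>\<^bsub>V\<^esub> = e \<one>\<^bsub>K\<^esub> 0"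
  using twisted.T_one_eq[OF twisted_V] by (simp add: QQv_def)

lemma V_add: "(f \<oplus>\<^bsub>V\<^esub> g) n = f n \<oplus>\<^bsub>K\<^esub> g n"
  using twisted.T_add[OF twisted_V, of n f g] by (simp add: QQv_def)

lemma V_zero: "\<zero>\<^bsub>V\<^esub> n = \<zero>\<^bsub>K\<^esub>"
  using twisted.T_zero[OF twisted_V, of n] by (simp add: QQv_def)

lemma e_apply: "e c m n = (if n = m then c else \<zero>\<^bsub>K\<^esub>)"
  by (simp add: eta_def)

lemma V_induct [consumes 1, case_names zero add]:
  assumes "f \<in> carrier V" "Pr \<zero>\<^bsub>V\<^esub>"
    and "\<And>c n f. c \<in> carrier K \<Longrightarrow> f \<in> carrier V \<Longrightarrow> Pr f \<Longrightarrow> Pr (e c n \<oplus>\<^bsub>V\<^esub> f)"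
  shows "Pr f"
  by (rule twisted.T_induct[OF twisted_V, folded QQv_def, of f Pr]) (use assms in auto)

lemma E_closed [simp]: "c \<in> carrier K \<Longrightarrow> E c u \<in> carrier QW"
  unfolding QWa_def by (rule twisted.mono_closed[OF twisted_QW])

lemma E_mult:
  assumes "c \<in> carrier K" "d \<in> carrier K" "v \<in> {1, -1}" "w \<in> {1, -1}"
  shows "E c (m, v) \<otimes>\<^bsub>QW\<^esub> E d (n, w) = E (c \<otimes>\<^bsub>K\<^esub> weyl_fgrQ v d) (m + v * n, v * w)"
  using twisted.mono_mult[OF twisted_QW, of c "(m, v)" d "(n, w)"] assms by (simp add: QWa_def)

lemma E_one: "\<one>\<^bsub>QW\<^esub> = E \<one>\<^bsub>K\<^esub> (0, 1)"
  using twisted.T_one_eq[OF twisted_QW] by (simp add: QWa_def)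

lemma QW_add: "w \<in> {1, -1} \<Longrightarrow> (f \<oplus>\<^bsub>QW\<^esub> g) (n, w) = f (n, w) \<oplus>\<^bsub>K\<^esub> g (n, w)"
  using twisted.T_add[OF twisted_QW, of "(n, w)" f g] by (simp add: QWa_def)

lemma QW_zero: "w \<in> {1, -1} \<Longrightarrow> \<zero>\<^bsub>QW\<^esub> (n, w) = \<zero>\<^bsub>K\<^esub>"
  using twisted.T_zero[OF twisted_QW, of "(n, w)"] by (simp add: QWa_def)

lemma E_apply:
  "w \<in> {1, -1} \<Longrightarrow> E c (m, v) (n, w) = (if n = m \<and> w = v then c else \<zero>\<^bsub>K\<^esub>)"
  by (simp add: eta_def)

lemma QW_eqI:
  assumes "f \<in> carrier QW" "g \<in> carrier QW" "\<And>n w. w \<in> {1, -1} \<Longrightarrow> f (n, w) = g (n, w)"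
  shows "f = g"
proof (rule twisted.T_eqI[OF twisted_QW])
  fix u assume "u \<in> carrier affine_weyl"
  then show "f u = g u" by (cases u) (simp add: assms(3))
qed (use assms in \<open>simp_all add: QWa_def\<close>)

lemma QW_induct [consumes 1, case_names zero add]:
  assumes "f \<in> carrier QW" "Pr \<zero>\<^bsub>QW\<^esub>"
    and "\<And>c n w f. c \<in> carrier K \<Longrightarrow> w \<in> {1, -1} \<Longrightarrow> f \<in> carrier QW \<Longrightarrow> Pr f
      \<Longrightarrow> Pr (E c (n, w) \<oplus>\<^bsub>QW\<^esub> f)"
  shows "Pr f"
proof (rule twisted.T_induct[OF twisted_QW, folded QWa_def, of f Pr])
  fix c u f assume "c \<in> carrier K" "u \<in> carrier affine_weyl" "f \<in> carrier QW" "Pr f"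
  then show "Pr (E c u \<oplus>\<^bsub>QW\<^esub> f)" using assms(3) by (cases u) simp
qed (use assms in auto)

abbreviation pr where "pr \<equiv> peterson_pr F"
abbreviation io where "io \<equiv> iota F"

lemma QW_coeff: "f \<in> carrier QW \<Longrightarrow> w \<in> {1, -1} \<Longrightarrow> f (n, w) \<in> carrier K"
  by (auto simp: carrier_QW)

lemma V_coeff: "f \<in> carrier V \<Longrightarrow> f n \<in> carrier K"
  by (auto simp: carrier_V)

lemma pr_apply: "f \<in> carrier QW \<Longrightarrow> pr f n = f (n, 1) \<oplus>\<^bsub>K\<^esub> f (n, -1)"
  unfolding peterson_pr_def by (subst K.finsum_insert) (auto simp: QW_coeff)

lemma pr_closed [simp]:
  assumes "f \<in> carrier QW" shows "pr f \<in> carrier V"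
proof -
  have "finite (fst ` {u \<in> UNIV \<times> {1, -1}. f u \<noteq> \<zero>\<^bsub>K\<^esub>})" using assms unfolding carrier_QW by blast
  moreover have "{n. pr f n \<noteq> \<zero>\<^bsub>K\<^esub>} \<subseteq> fst ` {u \<in> UNIV \<times> {1, -1}. f u \<noteq> \<zero>\<^bsub>K\<^esub>}"
  proof
    fix n assume "n \<in> {n. pr f n \<noteq> \<zero>\<^bsub>K\<^esub>}"
    then have "f (n, 1) \<noteq> \<zero>\<^bsub>K\<^esub> \<or> f (n, -1) \<noteq> \<zero>\<^bsub>K\<^esub>" using assms by (auto simp: pr_apply)
    then obtain w where "w \<in> {1, -1}" "f (n, w) \<noteq> \<zero>\<^bsub>K\<^esub>" by blast
    then show "n \<in> fst ` {u \<in> UNIV \<times> {1, -1}. f u \<noteq> \<zero>\<^bsub>K\<^esub>}"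
      by (intro image_eqI[of _ _ "(n, w)"]) simp_all
  qed
  ultimately have "finite {n. pr f n \<noteq> \<zero>\<^bsub>K\<^esub>}" by (rule rev_finite_subset)
  moreover have "pr f n \<in> carrier K" for n using assms by (simp add: pr_apply QW_coeff)
  ultimately show ?thesis by (simp add: carrier_V)
qed

lemma pr_add: "f \<in> carrier QW \<Longrightarrow> g \<in> carrier QW \<Longrightarrow> pr (f \<oplus>\<^bsub>QW\<^esub> g) = pr f \<oplus>\<^bsub>V\<^esub> pr g"
  by (rule ext) (simp add: pr_apply V_add QW_add QW_coeff K.a_ac)

lemma pr_zero: "pr \<zero>\<^bsub>QW\<^esub> = \<zero>\<^bsub>V\<^esub>"
  by (rule ext) (simp add: pr_apply V_zero QW_zero)

lemma pr_E: "c \<in> carrier K \<Longrightarrow> w \<in> {1, -1} \<Longrightarrow> pr (E c (n, w)) = e c n"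
  by (rule ext) (auto simp: pr_apply E_apply e_apply)

lemma iota_apply: "w \<in> {1, -1} \<Longrightarrow> io g (n, w) = (if w = 1 then g n else \<zero>\<^bsub>K\<^esub>)"
  by (simp add: iota_def)

lemma iota_closed [simp]:
  assumes "g \<in> carrier V" shows "io g \<in> carrier QW"
proof -
  have "{u \<in> UNIV \<times> {1, -1}. io g u \<noteq> \<zero>\<^bsub>K\<^esub>} \<subseteq> (\<lambda>n. (n, 1)) ` {n. g n \<noteq> \<zero>\<^bsub>K\<^esub>}"
    by (auto simp: iota_apply split: if_splits)
  then have "finite {u \<in> UNIV \<times> {1, -1}. io g u \<noteq> \<zero>\<^bsub>K\<^esub>}"
    by (rule finite_subset) (use assms in \<open>simp add: carrier_V\<close>)
  moreover have "io g \<in> (UNIV \<times> {1, -1}) \<rightarrow>\<^sub>E carrier K"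
    using V_coeff[OF assms] unfolding iota_def by (auto simp del: insert_iff)
  ultimately show ?thesis unfolding carrier_QW by blast
qed

lemma iota_add: "f \<in> carrier V \<Longrightarrow> g \<in> carrier V \<Longrightarrow> io (f \<oplus>\<^bsub>V\<^esub> g) = io f \<oplus>\<^bsub>QW\<^esub> io g"
  by (rule QW_eqI) (auto simp: iota_apply QW_add V_add)

lemma iota_zero: "io \<zero>\<^bsub>V\<^esub> = \<zero>\<^bsub>QW\<^esub>"
  by (rule QW_eqI) (auto simp: iota_apply QW_zero V_zero)

lemma iota_e: "c \<in> carrier K \<Longrightarrow> io (e c n) = E c (n, 1)"
  by (rule QW_eqI) (auto simp: iota_apply E_apply e_apply)

lemma iota_one: "io \<one>\<^bsub>V\<^esub> = \<one>\<^bsub>QW\<^esub>"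
  by (simp add: e_one E_one iota_e)

lemma pr_iota: "f \<in> carrier V \<Longrightarrow> pr (io f) = f"
  by (rule ext) (simp add: pr_apply iota_apply V_coeff)

lemma iota_inject: "f \<in> carrier V \<Longrightarrow> g \<in> carrier V \<Longrightarrow> io f = io g \<longleftrightarrow> f = g"
  by (metis pr_iota)

lemma iota_e_mult:
  assumes c: "c \<in> carrier K" and g: "g \<in> carrier V"
  shows "io (e c n \<otimes>\<^bsub>V\<^esub> g) = E c (n, 1) \<otimes>\<^bsub>QW\<^esub> io g"
  using g
proof (induction g rule: V_induct)
  case zero
  show ?case using c by (simp add: iota_zero)
next
  case (add d m f)
  have "E c (n, 1) \<otimes>\<^bsub>QW\<^esub> E d (m, 1) = E (c \<otimes>\<^bsub>K\<^esub> d) (n + m, 1)"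
    using c add by (simp add: E_mult weyl_fgrQ_1)
  then show ?case using add c
    by (simp add: V.r_distr QW.r_distr iota_add iota_e e_mult)
qed

lemma iota_mult:
  assumes f: "f \<in> carrier V" and g: "g \<in> carrier V"
  shows "io (f \<otimes>\<^bsub>V\<^esub> g) = io f \<otimes>\<^bsub>QW\<^esub> io g"
  using f
proof (induction f rule: V_induct)
  case zero
  show ?case using g by (simp add: iota_zero)
next
  case (add d m f)
  then show ?case using g
    by (simp add: V.l_distr QW.l_distr iota_add iota_e iota_e_mult)
qed

text \<open>The kernel of \<open>pr\<close> is the left ideal generated by the \<open>\<eta>\<^sub>w - 1\<close>, so that \<open>QWa F\<close> acts on
  \<open>QQv F\<close>.\<close>

lemma pr_absorb:
  assumes z: "z \<in> carrier QW" and f: "f \<in> carrier QW"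
  shows "pr (z \<otimes>\<^bsub>QW\<^esub> io (pr f)) = pr (z \<otimes>\<^bsub>QW\<^esub> f)"
proof -
  have E: "pr (E c (m, v) \<otimes>\<^bsub>QW\<^esub> io (pr f)) = pr (E c (m, v) \<otimes>\<^bsub>QW\<^esub> f)"
    if c: "c \<in> carrier K" "v \<in> {1, -1}" for c m v
    using f
  proof (induction f rule: QW_induct)
    case zero
    show ?case using c by (simp add: pr_zero iota_zero)
  next
    case (add d n w f)
    have d: "weyl_fgrQ v d \<in> carrier K"
      using weyl_fgrQ_hom[OF c(2)] add(1) by (rule ring_hom_closed)
    have vw: "v * w \<in> {1, -1}" using add(2) c(2) by auto
    \<comment> \<open>Replacing \<open>w\<close> by 1 on the right changes only the finite part of
      the product, which \<open>pr\<close> forgets.\<close>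
    have "pr (E c (m, v) \<otimes>\<^bsub>QW\<^esub> E d (n, 1)) = pr (E c (m, v) \<otimes>\<^bsub>QW\<^esub> E d (n, w))"
      unfolding E_mult[OF c(1) add(1) c(2) add(2)] E_mult[OF c(1) add(1) c(2) insertI1]
      using pr_E[of "c \<otimes>\<^bsub>K\<^esub> weyl_fgrQ v d"] vw c d by simp
    then show ?case using add c
      by (simp add: QW.r_distr pr_add pr_E iota_add iota_e del: insert_iff)
  qed
  show ?thesis using z
  proof (induction z rule: QW_induct)
    case zero
    show ?case using f by (simp add: pr_zero)
  next
    case (add d n w z)
    then show ?case using f E by (simp add: QW.l_distr pr_add del: insert_iff)
  qed
qed

definition act where "act z f = pr (z \<otimes>\<^bsub>QW\<^esub> io f)"

lemma act_closed [simp]: "z \<in> carrier QW \<Longrightarrow> f \<in> carrier V \<Longrightarrow> act z f \<in> carrier V"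
  by (simp add: act_def)

text \<open>This is where \<open>pr_absorb\<close> is needed: applying \<open>pr\<close> and
  \<open>iota\<close> between the two factors loses nothing that the outer \<open>pr\<close> could
  see.\<close>

lemma act_mult:
  "z \<in> carrier QW \<Longrightarrow> z' \<in> carrier QW \<Longrightarrow> f \<in> carrier V \<Longrightarrow> act (z \<otimes>\<^bsub>QW\<^esub> z') f = act z (act z' f)"
  by (simp add: act_def pr_absorb QW.m_assoc)

lemma act_add_left:
  "z \<in> carrier QW \<Longrightarrow> z' \<in> carrier QW \<Longrightarrow> f \<in> carrier V \<Longrightarrow> act (z \<oplus>\<^bsub>QW\<^esub> z') f = act z f \<oplus>\<^bsub>V\<^esub> act z' f"
  by (simp add: act_def pr_add QW.l_distr)

lemma act_add_right:
  "z \<in> carrier QW \<Longrightarrow> f \<in> carrier V \<Longrightarrow> g \<in> carrier V \<Longrightarrow> act z (f \<oplus>\<^bsub>V\<^esub> g) = act z f \<oplus>\<^bsub>V\<^esub> act z g"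
  by (simp add: act_def pr_add QW.r_distr iota_add)

lemma act_one: "f \<in> carrier V \<Longrightarrow> act \<one>\<^bsub>QW\<^esub> f = f"
  by (simp add: act_def pr_iota)

lemma act_zero_left: "f \<in> carrier V \<Longrightarrow> act \<zero>\<^bsub>QW\<^esub> f = \<zero>\<^bsub>V\<^esub>"
  by (simp add: act_def pr_zero)

lemma act_zero_right: "z \<in> carrier QW \<Longrightarrow> act z \<zero>\<^bsub>V\<^esub> = \<zero>\<^bsub>V\<^esub>"
  by (simp add: act_def pr_zero iota_zero)

lemma act_uminus_left:
  "z \<in> carrier QW \<Longrightarrow> f \<in> carrier V \<Longrightarrow> act (\<ominus>\<^bsub>QW\<^esub> z) f = \<ominus>\<^bsub>V\<^esub> act z f"
  by (rule V.minus_equality[symmetric])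
    (simp_all add: act_add_left[symmetric] QW.l_neg act_zero_left)

lemma act_minus_left:
  "z \<in> carrier QW \<Longrightarrow> z' \<in> carrier QW \<Longrightarrow> f \<in> carrier V \<Longrightarrow> act (z \<ominus>\<^bsub>QW\<^esub> z') f = act z f \<ominus>\<^bsub>V\<^esub> act z' f"
  by (simp add: a_minus_def act_add_left act_uminus_left)

lemma act_to_one: "z \<in> carrier QW \<Longrightarrow> act z \<one>\<^bsub>V\<^esub> = pr z"
  by (simp add: act_def iota_one)

lemma act_E_translation:
  "c \<in> carrier K \<Longrightarrow> f \<in> carrier V \<Longrightarrow> act (E c (n, 1)) f = e c n \<otimes>\<^bsub>V\<^esub> f"
  by (simp add: act_def iota_e_mult[symmetric] pr_iota)

text \<open>The action of \<open>s_1\<close>: it reflects coefficients and inverts translations.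
  Together with multiplications it describes the whole action (\<open>act_E_translation\<close>,
  \<open>act_E_reflection\<close>).\<close>

definition \<tau> where "\<tau> = act (E \<one>\<^bsub>K\<^esub> (0, -1))"

lemma act_E_reflection:
  assumes "c \<in> carrier K" "f \<in> carrier V"
  shows "act (E c (n, -1)) f = e c n \<otimes>\<^bsub>V\<^esub> \<tau> f"
proof -
  have "E c (n, -1) = E c (n, 1) \<otimes>\<^bsub>QW\<^esub> E \<one>\<^bsub>K\<^esub> (0, -1)"
    using assms by (simp add: E_mult weyl_fgrQ_1)
  then show ?thesis using assms by (simp add: act_mult act_E_translation \<tau>_def)
qed

lemma weyl_neg_closed [simp]: "c \<in> carrier K \<Longrightarrow> weyl_fgrQ (-1) c \<in> carrier K"
  by (rule ring_hom_closed[OF weyl_fgrQ_hom]) simp_all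

lemma tau_closed [simp]: "f \<in> carrier V \<Longrightarrow> \<tau> f \<in> carrier V"
  by (simp add: \<tau>_def)

lemma tau_add: "f \<in> carrier V \<Longrightarrow> g \<in> carrier V \<Longrightarrow> \<tau> (f \<oplus>\<^bsub>V\<^esub> g) = \<tau> f \<oplus>\<^bsub>V\<^esub> \<tau> g"
  by (simp add: \<tau>_def act_add_right)

lemma tau_zero: "\<tau> \<zero>\<^bsub>V\<^esub> = \<zero>\<^bsub>V\<^esub>"
  by (simp add: \<tau>_def act_zero_right)

lemma tau_e: "c \<in> carrier K \<Longrightarrow> \<tau> (e c n) = e (weyl_fgrQ (-1) c) (- n)"
  by (simp add: \<tau>_def act_def iota_e E_mult pr_E)

text \<open>True on single terms, where coefficients undergo a ring homomorphism and exponents a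
  change of sign; additivity in both factors does the rest.\<close>

lemma tau_mult:
  assumes f: "f \<in> carrier V" and g: "g \<in> carrier V"
  shows "\<tau> (f \<otimes>\<^bsub>V\<^esub> g) = \<tau> f \<otimes>\<^bsub>V\<^esub> \<tau> g"
proof -
  have E: "\<tau> (e c m \<otimes>\<^bsub>V\<^esub> g) = \<tau> (e c m) \<otimes>\<^bsub>V\<^esub> \<tau> g" if c: "c \<in> carrier K" for c m
    using g
  proof (induction g rule: V_induct)
    case zero
    show ?case using c by (simp add: tau_zero)
  next
    case (add d n g)
    have "\<tau> (e c m \<otimes>\<^bsub>V\<^esub> e d n) = \<tau> (e c m) \<otimes>\<^bsub>V\<^esub> \<tau> (e d n)"
      using c add ring_hom_mult[OF weyl_fgrQ_hom, of "-1" c d] by (simp add: e_mult tau_e)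
    then show ?case using c add by (simp add: V.r_distr tau_add)
  qed
  show ?thesis using f
  proof (induction f rule: V_induct)
    case zero
    show ?case using g by (simp add: tau_zero)
  next
    case (add d n f)
    then show ?case using g E by (simp add: V.l_distr tau_add)
  qed
qed

end

section \<open>Generators of the Peterson subalgebra\<close>

context fgl_regular
begin

abbreviation V_mult (infixl "\<cdot>" 70) where "f \<cdot> g \<equiv> f \<otimes>\<^bsub>V\<^esub> g"

text \<open>Reflecting \<open>y = x u\<close> gives \<open>x = y v\<close> with \<open>v\<close> the
  reflection of \<open>u\<close>. Then \<open>x (u v - 1) = 0\<close>, and \<open>x\<close> is
  regular. The inverse serves for fractions with denominator \<open>y\<close> and for negative
  powers of the evaluation point.\<close>

lemma unit_exists: "\<exists>u\<in>carrier S. \<exists>v\<in>carrier S. y = x \<otimes>\<^bsub>S\<^esub> u \<and> x = y \<otimes>\<^bsub>S\<^esub> v \<and> u \<otimes>\<^bsub>S\<^esub> v = \<one>\<^bsub>S\<^esub>"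
proof -
  obtain u where u: "u \<in> carrier S" "y = x \<otimes>\<^bsub>S\<^esub> u" using y_divides by (elim bexE)
  let ?v = "weyl_fgr (-1) u"
  have v: "?v \<in> carrier S" by (rule weyl_fgr_closed) (simp_all add: u)
  have "weyl_fgr (-1) y = weyl_fgr (-1) x \<otimes>\<^bsub>S\<^esub> ?v"
    unfolding u(2) by (rule ring_hom_mult[OF weyl_fgr_hom]) (simp_all add: u)
  then have x: "x = y \<otimes>\<^bsub>S\<^esub> ?v" by (simp add: weyl_fgr_x)
  have "x \<otimes>\<^bsub>S\<^esub> (u \<otimes>\<^bsub>S\<^esub> ?v \<ominus>\<^bsub>S\<^esub> \<one>\<^bsub>S\<^esub>) = x \<otimes>\<^bsub>S\<^esub> u \<otimes>\<^bsub>S\<^esub> ?v \<ominus>\<^bsub>S\<^esub> x"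
    using x_closed[of 1] u(1) v by algebra
  also have "\<dots> = \<zero>\<^bsub>S\<^esub>" unfolding u(2)[symmetric] x[symmetric] by (simp add: a_minus_def S.r_neg)
  finally have "u \<otimes>\<^bsub>S\<^esub> ?v \<ominus>\<^bsub>S\<^esub> \<one>\<^bsub>S\<^esub> = \<zero>\<^bsub>S\<^esub>"
    using regular_x u(1) v unfolding regular_elt_def by simp
  then have "u \<otimes>\<^bsub>S\<^esub> ?v = \<one>\<^bsub>S\<^esub>" using u v by simp
  then show ?thesis using u v x by blast
qed

text \<open>The fraction y/x as an element of \<open>S\<close>, unique because \<open>x\<close> is
  regular; \<open>v\<close> below is its inverse, and -u will be \<mu>.\<close>

definition u where "u = (SOME u. u \<in> carrier S \<and> (\<exists>v\<in>carrier S. y = x \<otimes>\<^bsub>S\<^esub> u \<and> x = y \<otimes>\<^bsub>S\<^esub> v \<and> u \<otimes>\<^bsub>S\<^esub> v = \<one>\<^bsub>S\<^esub>))"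

lemma u_props: "u \<in> carrier S" "\<exists>v\<in>carrier S. y = x \<otimes>\<^bsub>S\<^esub> u \<and> x = y \<otimes>\<^bsub>S\<^esub> v \<and> u \<otimes>\<^bsub>S\<^esub> v = \<one>\<^bsub>S\<^esub>"
  using someI_ex[OF unit_exists[unfolded Bex_def]] unfolding u_def Bex_def by simp_all

definition v where "v = (SOME v. v \<in> carrier S \<and> (y = x \<otimes>\<^bsub>S\<^esub> u \<and> x = y \<otimes>\<^bsub>S\<^esub> v \<and> u \<otimes>\<^bsub>S\<^esub> v = \<one>\<^bsub>S\<^esub>))"

lemma v_props: "v \<in> carrier S" "y = x \<otimes>\<^bsub>S\<^esub> u" "x = y \<otimes>\<^bsub>S\<^esub> v" "u \<otimes>\<^bsub>S\<^esub> v = \<one>\<^bsub>S\<^esub>"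
  using someI_ex[OF u_props(2)[unfolded Bex_def], folded v_def] by - (elim conjE, assumption)+

lemmas [simp] = u_props(1) v_props(1)

abbreviation iX where "iX \<equiv> inv_x F 1"
abbreviation iY where "iY \<equiv> inv_x F (-1)"

lemma emb_u_iY: "emb u \<otimes>\<^bsub>K\<^esub> iY = iX"
proof -
  have "emb y = emb x \<otimes>\<^bsub>K\<^esub> emb u" by (subst v_props(2)) (simp add: emb_mult)
  then have "emb u \<otimes>\<^bsub>K\<^esub> iY = (emb x \<otimes>\<^bsub>K\<^esub> iX) \<otimes>\<^bsub>K\<^esub> (emb u \<otimes>\<^bsub>K\<^esub> iY)" by (simp add: inv_x_mult)
  also have "\<dots> = iX \<otimes>\<^bsub>K\<^esub> (emb x \<otimes>\<^bsub>K\<^esub> emb u \<otimes>\<^bsub>K\<^esub> iY)"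
    by (simp add: K.m_ac)
  also have "\<dots> = iX" unfolding \<open>emb y = emb x \<otimes>\<^bsub>K\<^esub> emb u\<close>[symmetric] inv_x_mult by simp
  finally show ?thesis .
qed

lemma emb_y_iX: "emb y \<otimes>\<^bsub>K\<^esub> iX = emb u"
proof -
  have "emb y \<otimes>\<^bsub>K\<^esub> iX = emb u \<otimes>\<^bsub>K\<^esub> (emb y \<otimes>\<^bsub>K\<^esub> iY)"
    unfolding emb_u_iY[symmetric] by (simp add: K.m_ac)
  then show ?thesis by (simp add: inv_x_mult)
qed

text \<open>1/x + 1/y = (x + y)/(x y), where the numerator is x^2 h and x/y is \<open>v\<close>; so
  the sum equals h v.\<close>

lemma kappa_in_S: "\<exists>k\<in>carrier S. kappa F = emb k"
proof -
  obtain h where h: "h \<in> carrier S" "x \<oplus>\<^bsub>S\<^esub> y = x \<otimes>\<^bsub>S\<^esub> x \<otimes>\<^bsub>S\<^esub> h" using x_plus_y_divides by (elim bexE)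
  have embx: "emb x = emb y \<otimes>\<^bsub>K\<^esub> emb v" by (subst v_props(3)) (simp add: emb_mult)
  have "kappa F = (emb y \<otimes>\<^bsub>K\<^esub> iY) \<otimes>\<^bsub>K\<^esub> iX \<oplus>\<^bsub>K\<^esub> (emb x \<otimes>\<^bsub>K\<^esub> iX) \<otimes>\<^bsub>K\<^esub> iY"
    unfolding inv_x_mult kappa_def by simp
  also have "\<dots> = (emb x \<oplus>\<^bsub>K\<^esub> emb y) \<otimes>\<^bsub>K\<^esub> iX \<otimes>\<^bsub>K\<^esub> iY"
    using emb_closed[OF x_closed[of 1]] emb_closed[OF x_closed[of "-1"]] inv_x_closed by algebra
  also have "emb x \<oplus>\<^bsub>K\<^esub> emb y = emb x \<otimes>\<^bsub>K\<^esub> emb x \<otimes>\<^bsub>K\<^esub> emb h"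
    unfolding emb_add[symmetric, OF x_closed x_closed] h(2) using h(1) by (simp add: emb_mult)
  also have "emb x \<otimes>\<^bsub>K\<^esub> emb x \<otimes>\<^bsub>K\<^esub> emb h \<otimes>\<^bsub>K\<^esub> iX \<otimes>\<^bsub>K\<^esub> iY
      = (emb x \<otimes>\<^bsub>K\<^esub> iX) \<otimes>\<^bsub>K\<^esub> emb h \<otimes>\<^bsub>K\<^esub> emb x \<otimes>\<^bsub>K\<^esub> iY"
    using h(1) by (simp add: K.m_ac)
  also have "\<dots> = emb h \<otimes>\<^bsub>K\<^esub> (emb y \<otimes>\<^bsub>K\<^esub> emb v) \<otimes>\<^bsub>K\<^esub> iY"
    unfolding inv_x_mult embx[symmetric] using h(1) by simp
  also have "\<dots> = emb h \<otimes>\<^bsub>K\<^esub> emb v \<otimes>\<^bsub>K\<^esub> (emb y \<otimes>\<^bsub>K\<^esub> iY)"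
    using h(1) by (simp add: K.m_ac)
  also have "\<dots> = emb (h \<otimes>\<^bsub>S\<^esub> v)" unfolding inv_x_mult using h(1) by (simp add: emb_mult)
  finally show ?thesis using h(1) by (intro bexI[of _ "h \<otimes>\<^bsub>S\<^esub> v"]) simp_all
qed

text \<open>Both come from divisibility by \<open>x\<close>; for the denominator \<open>y\<close>,
  use x/y = v.\<close>

lemma demazure_K:
  assumes "c \<in> carrier S"
  shows "\<exists>d\<in>carrier S. iX \<otimes>\<^bsub>K\<^esub> emb (c \<ominus>\<^bsub>S\<^esub> weyl_fgr (-1) c) = emb d"
    and "\<exists>d\<in>carrier S. iY \<otimes>\<^bsub>K\<^esub> emb (c \<ominus>\<^bsub>S\<^esub> weyl_fgr (-1) c) = emb d"
proof -
  obtain d where d: "d \<in> carrier S" "c \<ominus>\<^bsub>S\<^esub> weyl_fgr (-1) c = x \<otimes>\<^bsub>S\<^esub> d"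
    using demazure_divides[OF assms] by (elim bexE)
  have "iX \<otimes>\<^bsub>K\<^esub> (emb x \<otimes>\<^bsub>K\<^esub> emb d) = (emb x \<otimes>\<^bsub>K\<^esub> iX) \<otimes>\<^bsub>K\<^esub> emb d" using d by (simp add: K.m_ac)
  then show "\<exists>d\<in>carrier S. iX \<otimes>\<^bsub>K\<^esub> emb (c \<ominus>\<^bsub>S\<^esub> weyl_fgr (-1) c) = emb d"
    unfolding d(2) using d(1) by (intro bexI[of _ d]) (simp_all add: emb_mult inv_x_mult)
  have "emb x = emb y \<otimes>\<^bsub>K\<^esub> emb v" by (subst v_props(3)) (simp add: emb_mult)
  then have "iY \<otimes>\<^bsub>K\<^esub> (emb x \<otimes>\<^bsub>K\<^esub> emb d) = (emb y \<otimes>\<^bsub>K\<^esub> iY) \<otimes>\<^bsub>K\<^esub> (emb v \<otimes>\<^bsub>K\<^esub> emb d)"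
    using d by (simp add: K.m_ac)
  then show "\<exists>d\<in>carrier S. iY \<otimes>\<^bsub>K\<^esub> emb (c \<ominus>\<^bsub>S\<^esub> weyl_fgr (-1) c) = emb d"
    unfolding d(2) using d(1) by (intro bexI[of _ "v \<otimes>\<^bsub>S\<^esub> d"]) (simp_all add: emb_mult inv_x_mult)
qed

section \<open>The elements \<open>b\<close> and \<open>\<Theta>\<close> of
  \<open>QQv F\<close>\<close>

definition C where "C c = e (emb c) 0"
definition VX where "VX = e iX 0"
definition VY where "VY = e iY 0"
definition q where "q = e \<one>\<^bsub>K\<^esub> 1"
definition p where "p = e \<one>\<^bsub>K\<^esub> (-1)"
definition b where "b = VX \<oplus>\<^bsub>V\<^esub> q \<cdot> VY"
definition \<Theta> where "\<Theta> = p \<cdot> b \<cdot> b"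
definition k where "k = (SOME k. k \<in> carrier S \<and> kappa F = emb k)"

lemma k_props: "k \<in> carrier S" "kappa F = emb k"
  using someI_ex[OF kappa_in_S[unfolded Bex_def]] unfolding k_def by simp_all

lemma C_closed [simp]: "c \<in> carrier S \<Longrightarrow> C c \<in> carrier V"
  by (simp add: C_def)

lemma V_gens_closed [simp]: "VX \<in> carrier V" "VY \<in> carrier V" "q \<in> carrier V" "p \<in> carrier V"
  by (simp_all add: VX_def VY_def q_def p_def)

lemma b_closed [simp]: "b \<in> carrier V"
  by (simp add: b_def)

lemma Theta_closed [simp]: "\<Theta> \<in> carrier V"
  by (simp add: \<Theta>_def)

lemma C_hom: "C \<in> ring_hom S V"
  unfolding C_def by (rule ring_hom_memI) (simp_all add: e_mult e_add e_one emb_mult emb_add emb_one)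

lemma C_mult: "c \<in> carrier S \<Longrightarrow> d \<in> carrier S \<Longrightarrow> C (c \<otimes>\<^bsub>S\<^esub> d) = C c \<cdot> C d"
  by (rule ring_hom_mult[OF C_hom])

lemma C_one: "C \<one>\<^bsub>S\<^esub> = \<one>\<^bsub>V\<^esub>"
  by (rule ring_hom_one[OF C_hom])

lemma C_uminus: "c \<in> carrier S \<Longrightarrow> C (\<ominus>\<^bsub>S\<^esub> c) = \<ominus>\<^bsub>V\<^esub> C c"
  by (rule V.minus_equality[symmetric])
    (simp_all add: ring_hom_add[OF C_hom, symmetric] S.l_neg ring_hom_zero[OF C_hom S.ring_axioms V.ring_axioms])

lemma C_minus: "c \<in> carrier S \<Longrightarrow> d \<in> carrier S \<Longrightarrow> C (c \<ominus>\<^bsub>S\<^esub> d) = C c \<ominus>\<^bsub>V\<^esub> C d"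
  by (simp add: a_minus_def ring_hom_add[OF C_hom] C_uminus)

lemma qp: "q \<cdot> p = \<one>\<^bsub>V\<^esub>"
  by (simp add: q_def p_def e_mult e_one)

lemma Ck: "C k = VX \<oplus>\<^bsub>V\<^esub> VY"
  by (simp add: C_def VX_def VY_def e_add k_props(2)[symmetric] kappa_def)

lemma Cy_VX: "C y \<cdot> VX = C u"
  by (simp add: C_def VX_def e_mult emb_y_iX)

lemma Cy_VY: "C y \<cdot> VY = \<one>\<^bsub>V\<^esub>"
  by (simp add: C_def VY_def e_mult inv_x_mult e_one)

lemma tau_gens: "\<tau> VX = VY" "\<tau> VY = VX" "\<tau> q = p"
  using ring_hom_one[OF weyl_fgrQ_hom, of "-1"]
  by (simp_all add: VX_def VY_def q_def p_def tau_e weyl_fgrQ_inv_x)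

lemma tau_p: "\<tau> p = q"
  using ring_hom_one[OF weyl_fgrQ_hom, of "-1"] by (simp add: q_def p_def tau_e)

lemma tau_C: "c \<in> carrier S \<Longrightarrow> \<tau> (C c) = C (weyl_fgr (-1) c)"
  by (simp add: C_def tau_e weyl_fgrQ_of)

lemma pb: "p \<cdot> b = VY \<oplus>\<^bsub>V\<^esub> p \<cdot> VX"
proof -
  have "p \<cdot> b = p \<cdot> VX \<oplus>\<^bsub>V\<^esub> (q \<cdot> p) \<cdot> VY"
    unfolding b_def using V_gens_closed by algebra
  then show ?thesis unfolding qp by (simp add: V.a_comm)
qed

lemma tau_b: "\<tau> b = p \<cdot> b"
  unfolding pb unfolding b_def by (simp add: tau_add tau_mult tau_gens)

text \<open>\<open>p\<close> becomes \<open>q\<close> and each of the two factors \<open>b\<close>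
  yields one \<open>p\<close>; as \<open>q \<cdot> p\<close> is one, the product is unchanged. Hence
  powers of \<open>\<Theta>\<close> can be pulled out of the operators \<open>X_0\<close> and
  \<open>X_1\<close>.\<close>

lemma tau_Theta: "\<tau> \<Theta> = \<Theta>"
proof -
  have "\<tau> \<Theta> = q \<cdot> (p \<cdot> b) \<cdot> (p \<cdot> b)"
    unfolding \<Theta>_def by (simp add: tau_mult tau_p tau_b)
  also have "\<dots> = (q \<cdot> p) \<cdot> (p \<cdot> b \<cdot> b)" using V_gens_closed b_closed by algebra
  finally show ?thesis unfolding qp \<Theta>_def by simp
qed

lemma tau_one: "\<tau> \<one>\<^bsub>V\<^esub> = \<one>\<^bsub>V\<^esub>"
  using tau_C[of "\<one>\<^bsub>S\<^esub>"] ring_hom_one[OF weyl_fgr_hom, of "-1"] by (simp add: C_one)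

lemma tau_Theta_pow: "\<tau> (\<Theta> [^]\<^bsub>V\<^esub> (i::nat)) = \<Theta> [^]\<^bsub>V\<^esub> i"
  by (induction i) (simp_all add: tau_one tau_mult tau_Theta)

lemma q_Theta: "q \<cdot> \<Theta> = b \<cdot> b"
proof -
  have "q \<cdot> \<Theta> = (q \<cdot> p) \<cdot> (b \<cdot> b)" unfolding \<Theta>_def by (simp add: V.m_assoc)
  then show ?thesis unfolding qp by simp
qed

lemma b_square: "b \<cdot> b = C y \<cdot> \<Theta> \<cdot> b \<oplus>\<^bsub>V\<^esub> C (\<ominus>\<^bsub>S\<^esub> u) \<cdot> \<Theta>"
proof -
  have Cy: "C y \<in> carrier V" and Cu: "C u \<in> carrier V" by simp_all
  have "C y \<cdot> b = C y \<cdot> VX \<oplus>\<^bsub>V\<^esub> q \<cdot> (C y \<cdot> VY)"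
    unfolding b_def using V_gens_closed Cy by algebra
  then have *: "C y \<cdot> b = C u \<oplus>\<^bsub>V\<^esub> q" unfolding Cy_VX Cy_VY by simp
  have "C y \<cdot> \<Theta> \<cdot> b \<oplus>\<^bsub>V\<^esub> C (\<ominus>\<^bsub>S\<^esub> u) \<cdot> \<Theta> = (C y \<cdot> b \<ominus>\<^bsub>V\<^esub> C u) \<cdot> \<Theta>"
    unfolding C_uminus[OF u_props(1)] using Cy Cu b_closed Theta_closed by algebra
  also have "\<dots> = q \<cdot> \<Theta>"
    unfolding * using Cu V_gens_closed Theta_closed by algebra
  finally show ?thesis unfolding q_Theta ..
qed

section \<open>The operators \<open>demX\<close> and \<open>demY\<close> on
  \<open>QQv F\<close>\<close>

lemma demX_closed [simp]: "demX F j \<in> carrier QW"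
  unfolding demX_def by (cases j) simp_all

lemma demY_closed [simp]: "demY F j \<in> carrier QW"
  unfolding demY_def using k_props by simp

lemma act_C: "c \<in> carrier S \<Longrightarrow> f \<in> carrier V \<Longrightarrow> act (E (emb c) (0, 1)) f = C c \<cdot> f"
  by (simp add: act_E_translation C_def)

lemma act_X1: "f \<in> carrier V \<Longrightarrow> act (demX F Node1) f = VX \<cdot> (f \<ominus>\<^bsub>V\<^esub> \<tau> f)"
  unfolding demX_def
  by (simp add: act_mult act_minus_left act_one act_E_translation act_E_reflection VX_def e_one[symmetric])

text \<open>\<open>s_0\<close> is the translation by the simple coroot followed on the right by
  \<open>s_1\<close>, whence the factor \<open>q\<close>.\<close>

lemma act_X0: "f \<in> carrier V \<Longrightarrow> act (demX F Node0) f = VY \<cdot> (f \<ominus>\<^bsub>V\<^esub> q \<cdot> \<tau> f)"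
  unfolding demX_def
  by (simp add: act_mult act_minus_left act_one act_E_translation act_E_reflection VY_def q_def)

lemma act_Y: "f \<in> carrier V \<Longrightarrow> act (demY F j) f = (VX \<oplus>\<^bsub>V\<^esub> VY) \<cdot> f \<ominus>\<^bsub>V\<^esub> act (demX F j) f"
  unfolding demY_def k_props(2) using k_props(1)
  by (simp add: act_minus_left act_C Ck)

lemma Theta_eq: "\<Theta> = (VY \<oplus>\<^bsub>V\<^esub> p \<cdot> VX) \<cdot> b"
  unfolding \<Theta>_def pb ..

text \<open>With \<open>t\<close> fixed by \<open>\<tau>\<close> only the value at 1 matters: 1/x +
  1/y - (1 - q)/y = 1/x + q/y = b.\<close>

lemma act_Y0_Theta: "act (demY F Node0) (\<Theta> [^]\<^bsub>V\<^esub> (i::nat)) = \<Theta> [^]\<^bsub>V\<^esub> i \<cdot> b"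
proof -
  define t where "t = \<Theta> [^]\<^bsub>V\<^esub> i"
  have t: "t \<in> carrier V" "\<tau> t = t" by (simp_all add: t_def tau_Theta_pow)
  have "act (demY F Node0) t = (VX \<oplus>\<^bsub>V\<^esub> VY) \<cdot> t \<ominus>\<^bsub>V\<^esub> VY \<cdot> (t \<ominus>\<^bsub>V\<^esub> q \<cdot> t)"
    by (simp add: act_Y act_X0 t)
  also have "\<dots> = t \<cdot> (VX \<oplus>\<^bsub>V\<^esub> q \<cdot> VY)" using t(1) V_gens_closed by algebra
  finally show ?thesis unfolding b_def t_def .
qed

text \<open>(1/x + 1/y) b - (b - p b)/x = (1/y + p/x) b, and the bracket is
  \<open>p \<cdot> b\<close>.\<close>

lemma act_Y1_Theta: "act (demY F Node1) (\<Theta> [^]\<^bsub>V\<^esub> (i::nat) \<cdot> b) = \<Theta> [^]\<^bsub>V\<^esub> Suc i"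
proof -
  define t where "t = \<Theta> [^]\<^bsub>V\<^esub> i"
  have t: "t \<in> carrier V" "\<tau> t = t" by (simp_all add: t_def tau_Theta_pow)
  have "act (demY F Node1) (t \<cdot> b)
      = (VX \<oplus>\<^bsub>V\<^esub> VY) \<cdot> (t \<cdot> b) \<ominus>\<^bsub>V\<^esub> VX \<cdot> (t \<cdot> b \<ominus>\<^bsub>V\<^esub> t \<cdot> (p \<cdot> b))"
    by (simp add: act_Y act_X1 tau_mult tau_b t)
  also have "\<dots> = t \<cdot> ((VY \<oplus>\<^bsub>V\<^esub> p \<cdot> VX) \<cdot> b)" using t(1) V_gens_closed b_closed by algebra
  finally show ?thesis unfolding Theta_eq[symmetric] t_def by simp
qed

text \<open>The candidate for the image of \<open>DWa F\<close> under \<open>pr\<close>: the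
  \<open>S\<close>-span of the powers of \<open>\<Theta>\<close> and of their multiples by
  \<open>b\<close>. The inductive form turns each stability statement into one case per kind of
  generator; negatives come from the coefficients.\<close>

inductive_set Pet where
  zero: "\<zero>\<^bsub>V\<^esub> \<in> Pet"
| power: "c \<in> carrier S \<Longrightarrow> C c \<cdot> \<Theta> [^]\<^bsub>V\<^esub> (i::nat) \<in> Pet"
| power_b: "c \<in> carrier S \<Longrightarrow> C c \<cdot> \<Theta> [^]\<^bsub>V\<^esub> (i::nat) \<cdot> b \<in> Pet"
| add: "f \<in> Pet \<Longrightarrow> g \<in> Pet \<Longrightarrow> f \<oplus>\<^bsub>V\<^esub> g \<in> Pet"

lemma Pet_closed: "f \<in> Pet \<Longrightarrow> f \<in> carrier V"
  by (induction rule: Pet.induct) simp_all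

lemma Pet_C:
  assumes c: "c \<in> carrier S" and f: "f \<in> Pet"
  shows "C c \<cdot> f \<in> Pet"
  using f
proof (induction rule: Pet.induct)
  case zero
  show ?case using c by (simp add: Pet.zero)
next
  case (power d i)
  have "C c \<cdot> (C d \<cdot> \<Theta> [^]\<^bsub>V\<^esub> i) = C (c \<otimes>\<^bsub>S\<^esub> d) \<cdot> \<Theta> [^]\<^bsub>V\<^esub> i"
    using c power by (simp add: C_mult V.m_assoc)
  then show ?case using c power Pet.power[of "c \<otimes>\<^bsub>S\<^esub> d" i] by simp
next
  case (power_b d i)
  have "C c \<cdot> (C d \<cdot> \<Theta> [^]\<^bsub>V\<^esub> i \<cdot> b) = C (c \<otimes>\<^bsub>S\<^esub> d) \<cdot> \<Theta> [^]\<^bsub>V\<^esub> i \<cdot> b"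
    using c power_b by (simp add: C_mult V.m_assoc)
  then show ?case using c power_b Pet.power_b[of "c \<otimes>\<^bsub>S\<^esub> d" i] by simp
next
  case (add f g)
  then show ?case using c Pet_closed Pet.add by (simp add: V.r_distr)
qed

lemma Pet_Theta:
  assumes f: "f \<in> Pet"
  shows "\<Theta> \<cdot> f \<in> Pet"
  using f
proof (induction rule: Pet.induct)
  case zero
  show ?case by (simp add: Pet.zero)
next
  case (power d i)
  have "\<Theta> \<cdot> (C d \<cdot> \<Theta> [^]\<^bsub>V\<^esub> i) = C d \<cdot> \<Theta> [^]\<^bsub>V\<^esub> Suc i"
    using power by (simp add: V.m_ac)
  then show ?case using power Pet.power[of d "Suc i"] by simp
next
  case (power_b d i)
  have "\<Theta> \<cdot> (C d \<cdot> \<Theta> [^]\<^bsub>V\<^esub> i \<cdot> b) = C d \<cdot> \<Theta> [^]\<^bsub>V\<^esub> Suc i \<cdot> b"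
    using power_b by (simp add: V.m_ac)
  then show ?case using power_b Pet.power_b[of d "Suc i"] by simp
next
  case (add f g)
  then show ?case using Pet_closed Pet.add by (simp add: V.r_distr)
qed

text \<open>Only \<open>b \<cdot> b\<close> leaves the shape of the generators, and
  \<open>b_square\<close> brings it back.\<close>

lemma Pet_b:
  assumes f: "f \<in> Pet"
  shows "b \<cdot> f \<in> Pet"
  using f
proof (induction rule: Pet.induct)
  case zero
  show ?case by (simp add: Pet.zero)
next
  case (power d i)
  have "b \<cdot> (C d \<cdot> \<Theta> [^]\<^bsub>V\<^esub> i) = C d \<cdot> \<Theta> [^]\<^bsub>V\<^esub> i \<cdot> b"
    using power by (simp add: V.m_ac)
  then show ?case using power Pet.power_b[of d i] by simp
next
  case (power_b d i)
  define t where "t = C d \<cdot> \<Theta> [^]\<^bsub>V\<^esub> i"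
  have t: "t \<in> carrier V" "t \<in> Pet" "t \<cdot> b \<in> Pet"
    using power_b Pet.power[of d i] Pet.power_b[of d i] by (simp_all add: t_def)
  have cl: "C y \<in> carrier V" "C (\<ominus>\<^bsub>S\<^esub> u) \<in> carrier V" by simp_all
  have "b \<cdot> (t \<cdot> b) = (b \<cdot> b) \<cdot> t" using t by (simp add: V.m_ac)
  also have "\<dots> = C y \<cdot> (\<Theta> \<cdot> (t \<cdot> b)) \<oplus>\<^bsub>V\<^esub> C (\<ominus>\<^bsub>S\<^esub> u) \<cdot> (\<Theta> \<cdot> t)"
    unfolding b_square using t(1) cl b_closed Theta_closed by algebra
  also have "\<dots> \<in> Pet" by (intro Pet.add Pet_C Pet_Theta t x_closed S.a_inv_closed u_props(1))
  finally show ?case unfolding t_def .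
next
  case (add f g)
  then show ?case using Pet_closed Pet.add by (simp add: V.r_distr)
qed

lemma Pet_Theta_pow: "f \<in> Pet \<Longrightarrow> \<Theta> [^]\<^bsub>V\<^esub> (i::nat) \<cdot> f \<in> Pet"
proof (induction i)
  case (Suc i)
  have "\<Theta> [^]\<^bsub>V\<^esub> Suc i \<cdot> f = \<Theta> \<cdot> (\<Theta> [^]\<^bsub>V\<^esub> i \<cdot> f)"
    using Pet_closed[OF Suc(2)] by (simp add: V.m_ac)
  then show ?case using Pet_Theta Suc by simp
qed (simp add: Pet_closed)

lemma Pet_mult:
  assumes f: "f \<in> Pet" and g: "g \<in> Pet"
  shows "f \<cdot> g \<in> Pet"
  using f
proof (induction rule: Pet.induct)
  case zero
  show ?case using Pet_closed[OF g] by (simp add: Pet.zero)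
next
  case (power d i)
  then show ?case using Pet_C[OF power Pet_Theta_pow[OF g]] Pet_closed[OF g] by (simp add: V.m_assoc)
next
  case (power_b d i)
  then show ?case using Pet_C[OF power_b Pet_Theta_pow[OF Pet_b[OF g]]] Pet_closed[OF g] by (simp add: V.m_assoc)
next
  case (add f g')
  then show ?case using Pet_closed[OF g] Pet_closed Pet.add by (simp add: V.l_distr)
qed

lemma Pet_gens: "C c \<in> Pet" if "c \<in> carrier S" for c
  using Pet.power[OF that, of 0] that by simp

lemma Pet_one: "\<one>\<^bsub>V\<^esub> \<in> Pet"
  using Pet_gens[of "\<one>\<^bsub>S\<^esub>"] by (simp add: C_one)

lemma b_in_Pet: "b \<in> Pet"
  using Pet_b[OF Pet_one] by simp

lemma Theta_in_Pet: "\<Theta> \<in> Pet"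
  using Pet_Theta[OF Pet_one] by simp

lemma Pet_uminus: "f \<in> Pet \<Longrightarrow> \<ominus>\<^bsub>V\<^esub> f \<in> Pet"
  using Pet_C[of "\<ominus>\<^bsub>S\<^esub> \<one>\<^bsub>S\<^esub>" f] Pet_closed by (simp add: C_uminus C_one V.l_minus)

lemma Pet_minus: "f \<in> Pet \<Longrightarrow> g \<in> Pet \<Longrightarrow> f \<ominus>\<^bsub>V\<^esub> g \<in> Pet"
  by (simp add: a_minus_def Pet.add Pet_uminus)

lemma demazure_V:
  assumes "c \<in> carrier S"
  shows "VX \<cdot> (C c \<ominus>\<^bsub>V\<^esub> C (weyl_fgr (-1) c)) \<in> Pet"
    and "VY \<cdot> (C c \<ominus>\<^bsub>V\<^esub> C (weyl_fgr (-1) c)) \<in> Pet"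
proof -
  have w: "weyl_fgr (-1) c \<in> carrier S" using assms by (intro weyl_fgr_closed) simp_all
  obtain d d' where d: "d \<in> carrier S" "iX \<otimes>\<^bsub>K\<^esub> emb (c \<ominus>\<^bsub>S\<^esub> weyl_fgr (-1) c) = emb d"
    and d': "d' \<in> carrier S" "iY \<otimes>\<^bsub>K\<^esub> emb (c \<ominus>\<^bsub>S\<^esub> weyl_fgr (-1) c) = emb d'"
    using demazure_K[OF assms] by (elim bexE)
  have "VX \<cdot> (C c \<ominus>\<^bsub>V\<^esub> C (weyl_fgr (-1) c)) = C d"
    unfolding C_minus[OF assms w, symmetric] using assms w d by (simp add: C_def VX_def e_mult)
  then show "VX \<cdot> (C c \<ominus>\<^bsub>V\<^esub> C (weyl_fgr (-1) c)) \<in> Pet" using Pet_gens d by simp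
  have "VY \<cdot> (C c \<ominus>\<^bsub>V\<^esub> C (weyl_fgr (-1) c)) = C d'"
    unfolding C_minus[OF assms w, symmetric] using assms w d' by (simp add: C_def VY_def e_mult)
  then show "VY \<cdot> (C c \<ominus>\<^bsub>V\<^esub> C (weyl_fgr (-1) c)) \<in> Pet" using Pet_gens d' by simp
qed

text \<open>A twisted Leibniz rule: X(d f) is the divided difference of \<open>d\<close> times
  \<open>f\<close> plus the reflected \<open>d'\<close> times X(f). The first term lies in the span
  by \<open>demazure_V\<close>; powers of \<open>\<Theta>\<close> pass through, so only X(1) and
  X(b) have to be known.\<close>

lemma Pet_act_X:
  assumes "f \<in> Pet"
  shows "act (demX F j) f \<in> Pet"
  using assms
proof (induction rule: Pet.induct)
  case zero
  show ?case by (simp add: act_zero_right Pet.zero)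
next
  case (add f g)
  then show ?case by (simp add: act_add_right Pet_closed Pet.add)
next
  case (power c i)
  define t d d' where "t = \<Theta> [^]\<^bsub>V\<^esub> i" and "d = C c" and "d' = C (weyl_fgr (-1) c)"
  have w: "weyl_fgr (-1) c \<in> carrier S" using power by (intro weyl_fgr_closed) simp_all
  have t: "t \<in> carrier V" "d \<in> carrier V" "d' \<in> carrier V" "\<tau> (d \<cdot> t) = d' \<cdot> t"
    using power w by (simp_all add: t_def d_def d'_def tau_mult tau_Theta_pow tau_C)
  have tM: "t \<in> Pet" unfolding t_def using Pet_Theta_pow[OF Pet_one, of i] by simp
  have d: "VX \<cdot> (d \<ominus>\<^bsub>V\<^esub> d') \<in> Pet" "VY \<cdot> (d \<ominus>\<^bsub>V\<^esub> d') \<in> Pet"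
    unfolding d_def d'_def using power by (intro demazure_V; assumption)+
  have d'M: "d' \<in> Pet" unfolding d'_def using w by (rule Pet_gens)
  show ?case
  proof (cases j)
    case Node1
    have "act (demX F j) (d \<cdot> t) = VX \<cdot> (d \<cdot> t \<ominus>\<^bsub>V\<^esub> d' \<cdot> t)"
      using t by (simp add: Node1 act_X1)
    also have "\<dots> = VX \<cdot> (d \<ominus>\<^bsub>V\<^esub> d') \<cdot> t"
      using t(1-3) V_gens_closed by algebra
    also have "\<dots> \<in> Pet" by (intro Pet_mult d tM)
    finally show ?thesis unfolding t_def d_def .
  next
    case Node0
    have "act (demX F j) (d \<cdot> t) = VY \<cdot> (d \<cdot> t \<ominus>\<^bsub>V\<^esub> q \<cdot> (d' \<cdot> t))"
      using t by (simp add: Node0 act_X0)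
    \<comment> \<open>The second summand contains \<open>X_0\<close> of 1, that is (1 - q)/y,
      rewritten as kappa - b.\<close>
    also have "\<dots> = VY \<cdot> (d \<ominus>\<^bsub>V\<^esub> d') \<cdot> t
        \<oplus>\<^bsub>V\<^esub> ((VX \<oplus>\<^bsub>V\<^esub> VY) \<ominus>\<^bsub>V\<^esub> (VX \<oplus>\<^bsub>V\<^esub> q \<cdot> VY)) \<cdot> d' \<cdot> t"
      using t(1-3) V_gens_closed by algebra
    also have "\<dots> \<in> Pet"
      unfolding b_def[symmetric] Ck[symmetric]
      by (intro Pet.add Pet_mult Pet_minus d tM d'M Pet_gens k_props b_in_Pet)
    finally show ?thesis unfolding t_def d_def .
  qed
next
  case (power_b c i)
  define t d d' where "t = \<Theta> [^]\<^bsub>V\<^esub> i" and "d = C c" and "d' = C (weyl_fgr (-1) c)"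
  have w: "weyl_fgr (-1) c \<in> carrier S" using power_b by (intro weyl_fgr_closed) simp_all
  have t: "t \<in> carrier V" "d \<in> carrier V" "d' \<in> carrier V"
    "\<tau> (d \<cdot> t \<cdot> b) = d' \<cdot> t \<cdot> (p \<cdot> b)"
    using power_b w by (simp_all add: t_def d_def d'_def tau_mult tau_Theta_pow tau_C tau_b)
  have tM: "t \<in> Pet" unfolding t_def using Pet_Theta_pow[OF Pet_one, of i] by simp
  have d: "VX \<cdot> (d \<ominus>\<^bsub>V\<^esub> d') \<in> Pet" "VY \<cdot> (d \<ominus>\<^bsub>V\<^esub> d') \<in> Pet"
    unfolding d_def d'_def using power_b by (intro demazure_V; assumption)+
  have d'M: "d' \<in> Pet" unfolding d'_def using w by (rule Pet_gens)
  show ?case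
  proof (cases j)
    case Node1
    have "act (demX F j) (d \<cdot> t \<cdot> b)
        = VX \<cdot> (d \<cdot> t \<cdot> b \<ominus>\<^bsub>V\<^esub> d' \<cdot> t \<cdot> (p \<cdot> b))"
      using t by (simp add: Node1 act_X1)
    \<comment> \<open>Here \<open>X_1\<close> of \<open>b\<close>, that is (b - p b)/x, is rewritten
      as kappa b - \<Theta>.\<close>
    also have "\<dots> = VX \<cdot> (d \<ominus>\<^bsub>V\<^esub> d') \<cdot> t \<cdot> b
        \<oplus>\<^bsub>V\<^esub> d' \<cdot> t \<cdot> ((VX \<oplus>\<^bsub>V\<^esub> VY) \<cdot> b \<ominus>\<^bsub>V\<^esub> (VY \<oplus>\<^bsub>V\<^esub> p \<cdot> VX) \<cdot> b)"
      using t(1-3) V_gens_closed b_closed by algebra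
    also have "\<dots> \<in> Pet"
      unfolding Theta_eq[symmetric] Ck[symmetric]
      by (intro Pet.add Pet_mult Pet_minus d tM d'M Pet_gens k_props b_in_Pet Theta_in_Pet)
    finally show ?thesis unfolding t_def d_def .
  next
    case Node0
    have "act (demX F j) (d \<cdot> t \<cdot> b)
        = VY \<cdot> (d \<cdot> t \<cdot> b \<ominus>\<^bsub>V\<^esub> q \<cdot> (d' \<cdot> t \<cdot> (p \<cdot> b)))"
      using t by (simp add: Node0 act_X0)
    \<comment> \<open>\<open>q\<close> times the reflection of \<open>b\<close> is \<open>b\<close>
      itself, so \<open>X_0\<close> kills \<open>b\<close> and only the divided difference of
      \<open>d\<close> remains.\<close>
    also have "\<dots> = VY \<cdot> (d \<cdot> t \<cdot> b \<ominus>\<^bsub>V\<^esub> (q \<cdot> p) \<cdot> (d' \<cdot> t \<cdot> b))"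
      using t(1-3) V_gens_closed b_closed by algebra
    also have "\<dots> = VY \<cdot> (d \<ominus>\<^bsub>V\<^esub> d') \<cdot> t \<cdot> b"
      unfolding qp using t(1-3) V_gens_closed b_closed by algebra
    also have "\<dots> \<in> Pet" by (intro Pet_mult d tM b_in_Pet)
    finally show ?thesis unfolding t_def d_def .
  qed
qed

text \<open>Stability passes from the generators to the generated ring because \<open>act\<close> is
  a ring action; applied to 1 it confines the values of \<open>pr\<close>.\<close>

lemma DWa_act:
  assumes "z \<in> DWa F"
  shows "z \<in> carrier QW \<and> (\<forall>f\<in>Pet. act z f \<in> Pet)"
  using assms unfolding DWa_def
proof (induction rule: generate_ring.induct)
  case one
  show ?case by (simp add: act_one Pet_closed)
next
  case (incl h)
  then consider c where "c \<in> carrier S" "h = E (emb c) (0, 1)" | j where "h = demX F j" by auto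
  then show ?case
    by cases (simp_all add: act_C Pet_C Pet_closed Pet_act_X)
next
  case (a_inv h)
  then show ?case by (simp add: act_uminus_left Pet_closed Pet_uminus)
next
  case (eng_add h h')
  then show ?case by (simp add: act_add_left Pet_closed Pet.add)
next
  case (eng_mult h h')
  then show ?case by (simp add: act_mult Pet_closed)
qed

lemma DWa_ring_ops:
  "\<one>\<^bsub>QW\<^esub> \<in> DWa F" "z \<in> DWa F \<Longrightarrow> \<ominus>\<^bsub>QW\<^esub> z \<in> DWa F"
  "z \<in> DWa F \<Longrightarrow> z' \<in> DWa F \<Longrightarrow> z \<oplus>\<^bsub>QW\<^esub> z' \<in> DWa F"
  "z \<in> DWa F \<Longrightarrow> z' \<in> DWa F \<Longrightarrow> z \<otimes>\<^bsub>QW\<^esub> z' \<in> DWa F"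
  unfolding DWa_def by (rule generate_ring.intros; assumption)+

lemma DWa_gens: "c \<in> carrier S \<Longrightarrow> E (emb c) (0, 1) \<in> DWa F" "demX F j \<in> DWa F"
  unfolding DWa_def by (rule generate_ring.incl, force, rule generate_ring.incl, cases j, simp_all)

lemma demY_DWa: "demY F j \<in> DWa F"
  unfolding demY_def a_minus_def k_props(2) affine_weyl_simps
  by (intro DWa_ring_ops DWa_gens k_props)

section \<open>Products along the words \<open>sigma_word\<close>, and the image of
  \<open>pr\<close>\<close>

abbreviation Yprod where "Yprod i \<equiv> foldr (monoid.mult QW) (map (demY F) (sigma_word i)) \<one>\<^bsub>QW\<^esub>"

lemma Yprod_DWa: "Yprod i \<in> DWa F"
  by (induction i) (simp_all add: DWa_ring_ops demY_DWa)

lemma Yprod_closed: "Yprod i \<in> carrier QW"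
  by (induction i) simp_all

lemma act_Yprod: "act (Yprod i) \<one>\<^bsub>V\<^esub> = \<Theta> [^]\<^bsub>V\<^esub> i"
proof (induction i)
  case 0
  show ?case by (simp add: act_one)
next
  case (Suc i)
  have "act (Yprod (Suc i)) \<one>\<^bsub>V\<^esub> = act (demY F Node1) (act (demY F Node0) (act (Yprod i) \<one>\<^bsub>V\<^esub>))"
    using Yprod_closed[of i] by (simp add: act_mult)
  then show ?case unfolding Suc act_Y0_Theta act_Y1_Theta .
qed

lemma frakY_sigma: "frakY F (sigma_even i) = \<Theta> [^]\<^bsub>V\<^esub> i"
  unfolding frakY_def demYw_def reduced_word_sigma act_Yprod[symmetric]
  by (rule act_to_one[symmetric]) (rule Yprod_closed)

text \<open>One inclusion evaluates the action at 1. For the other, \<open>c\<close> times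
  \<open>Yprod i\<close> has image c \<Theta>^i, and one more factor \<open>demY F Node0\<close>
  after \<open>c\<close> produces the multiples by \<open>b\<close>.\<close>

lemma pr_DWa: "pr ` DWa F = Pet"
proof
  show "pr ` DWa F \<subseteq> Pet"
  proof
    fix f assume "f \<in> pr ` DWa F"
    then obtain z where z: "z \<in> DWa F" "f = pr z" by (elim imageE)
    have "act z \<one>\<^bsub>V\<^esub> \<in> Pet" using DWa_act[OF z(1)] Pet_one by simp
    then show "f \<in> Pet" using DWa_act[OF z(1)] z(2) by (simp add: act_to_one)
  qed
  have clos: "z \<in> carrier QW" if "z \<in> DWa F" for z using DWa_act[OF that] by simp
  show "Pet \<subseteq> pr ` DWa F"
  proof
    fix f assume "f \<in> Pet"
    then show "f \<in> pr ` DWa F"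
    proof (induction rule: Pet.induct)
      case zero
      have "\<one>\<^bsub>QW\<^esub> \<oplus>\<^bsub>QW\<^esub> \<ominus>\<^bsub>QW\<^esub> \<one>\<^bsub>QW\<^esub> \<in> DWa F"
        by (intro DWa_ring_ops)
      then have "\<zero>\<^bsub>QW\<^esub> \<in> DWa F" by (simp add: QW.r_neg)
      then show ?case by (rule image_eqI[rotated]) (simp add: pr_zero)
    next
      case (power c i)
      have z: "E (emb c) (0, 1) \<otimes>\<^bsub>QW\<^esub> Yprod i \<in> DWa F"
        using power by (intro DWa_ring_ops DWa_gens Yprod_DWa)
      have "pr (E (emb c) (0, 1) \<otimes>\<^bsub>QW\<^esub> Yprod i) = C c \<cdot> \<Theta> [^]\<^bsub>V\<^esub> i"
        using power Yprod_closed[of i] by (simp add: act_to_one[symmetric] act_mult act_Yprod act_C)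
      then show ?case using z by (metis imageI)
    next
      case (power_b c i)
      have z: "E (emb c) (0, 1) \<otimes>\<^bsub>QW\<^esub> (demY F Node0 \<otimes>\<^bsub>QW\<^esub> Yprod i) \<in> DWa F"
        using power_b by (intro DWa_ring_ops DWa_gens Yprod_DWa demY_DWa)
      have "pr (E (emb c) (0, 1) \<otimes>\<^bsub>QW\<^esub> (demY F Node0 \<otimes>\<^bsub>QW\<^esub> Yprod i))
          = C c \<cdot> (\<Theta> [^]\<^bsub>V\<^esub> i \<cdot> b)"
        using power_b Yprod_closed[of i]
        by (simp add: act_to_one[symmetric] act_mult act_Yprod act_C act_Y0_Theta)
      also have "\<dots> = C c \<cdot> \<Theta> [^]\<^bsub>V\<^esub> i \<cdot> b" using power_b by (simp add: V.m_assoc)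
      finally show ?case using z by (metis imageI)
    next
      case (add f g)
      then obtain z z' where z: "z \<in> DWa F" "f = pr z" "z' \<in> DWa F" "g = pr z'" by (elim imageE)
      have "z \<oplus>\<^bsub>QW\<^esub> z' \<in> DWa F" using z by (intro DWa_ring_ops)
      moreover have "pr (z \<oplus>\<^bsub>QW\<^esub> z') = f \<oplus>\<^bsub>V\<^esub> g" using z clos by (simp add: pr_add)
      ultimately show ?case by (metis imageI)
    qed
  qed
qed

section \<open>The Peterson subalgebra as a commutative ring\<close>

abbreviation D where "D \<equiv> peterson F"

lemma peterson_eq: "D = QW\<lparr>carrier := io ` Pet\<rparr>"
  unfolding peterson_def pr_DWa ..

lemma D_simps [simp]:
  "f \<otimes>\<^bsub>D\<^esub> g = f \<otimes>\<^bsub>QW\<^esub> g" "f \<oplus>\<^bsub>D\<^esub> g = f \<oplus>\<^bsub>QW\<^esub> g" "\<one>\<^bsub>D\<^esub> = \<one>\<^bsub>QW\<^esub>" "\<zero>\<^bsub>D\<^esub> = \<zero>\<^bsub>QW\<^esub>"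
  "carrier D = io ` Pet"
  by (simp_all add: peterson_eq)

lemma subring_iota_Pet: "subring (io ` Pet) QW"
proof (rule QW.subringI)
  show "io ` Pet \<subseteq> carrier QW" using Pet_closed by auto
  show "\<one>\<^bsub>QW\<^esub> \<in> io ` Pet" using Pet_one iota_one by (metis imageI)
  fix f assume "f \<in> io ` Pet"
  then obtain f' where f: "f' \<in> Pet" "f = io f'" by (elim imageE)
  have "\<ominus>\<^bsub>QW\<^esub> f = io (\<ominus>\<^bsub>V\<^esub> f')"
    unfolding f(2) using Pet_closed[OF f(1)]
    by (intro QW.minus_equality) (simp_all add: iota_add[symmetric] V.l_neg iota_zero)
  then show "\<ominus>\<^bsub>QW\<^esub> f \<in> io ` Pet" using Pet_uminus[OF f(1)] by simp
  fix g assume "g \<in> io ` Pet"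
  then obtain g' where g: "g' \<in> Pet" "g = io g'" by (elim imageE)
  show "f \<otimes>\<^bsub>QW\<^esub> g \<in> io ` Pet"
    using f g Pet_mult[OF f(1) g(1)] Pet_closed by (simp add: iota_mult[symmetric])
  show "f \<oplus>\<^bsub>QW\<^esub> g \<in> io ` Pet"
    using f g Pet.add[OF f(1) g(1)] Pet_closed by (simp add: iota_add[symmetric])
qed

lemma D_cring: "cring D"
proof -
  have "f \<otimes>\<^bsub>QW\<^esub> g = g \<otimes>\<^bsub>QW\<^esub> f" if fg: "f \<in> io ` Pet" "g \<in> io ` Pet" for f g
  proof -
    obtain f' g' where *: "f' \<in> Pet" "f = io f'" "g' \<in> Pet" "g = io g'" using fg by (elim imageE)
    then have cl: "f' \<in> carrier V" "g' \<in> carrier V" by (simp_all add: Pet_closed)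
    show ?thesis unfolding *(2,4) iota_mult[OF cl, symmetric] iota_mult[OF cl(2,1), symmetric]
      using V.m_comm[OF cl] by simp
  qed
  then have "subcring (io ` Pet) QW" by (intro QW.subcringI[OF subring_iota_Pet])
  moreover have "io ` Pet \<subseteq> carrier QW" using Pet_closed by auto
  ultimately show ?thesis unfolding peterson_eq using QW.subcring_iff by blast
qed

sublocale D: cring D
  by (rule D_cring)

end

section \<open>Linear independence of the generators\<close>

text \<open>Integer powers of an element \<open>t\<close> with a prescribed inverse
  \<open>t'\<close>, which is known explicitly in both uses: for -u with inverse -v, and for
  \<Theta> in the localization.\<close>

definition zpow :: "('a, 'm) monoid_scheme \<Rightarrow> 'a \<Rightarrow> 'a \<Rightarrow> int \<Rightarrow> 'a" where
  "zpow G t t' n = (if 0 \<le> n then t [^]\<^bsub>G\<^esub> nat n else t' [^]\<^bsub>G\<^esub> nat (- n))"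

context comm_monoid
begin

context
  fixes t t'
  assumes t: "t \<in> carrier G" "t' \<in> carrier G" "t \<otimes> t' = \<one>"
  notes pow_nat [simp del]
begin

lemma zpow_closed: "zpow G t t' n \<in> carrier G"
  using t by (simp add: zpow_def)

lemma zpow_Suc: "zpow G t t' (n + 1) = zpow G t t' n \<otimes> t"
proof (cases "0 \<le> n")
  case True
  then show ?thesis by (simp add: zpow_def nat_add_distrib)
next
  case False
  define k where "k = nat (- n) - 1"
  have k: "nat (- n) = Suc k" "n + 1 = - int k" using False by (auto simp: k_def)
  have "t' [^] k \<otimes> t' \<otimes> t = t' [^] k" using t by (simp add: m_assoc m_comm[of t' t])
  then show ?thesis using False k(1) unfolding k(2) by (cases k) (simp_all add: zpow_def nat_add_distrib)
qed

lemma zpow_pred: "zpow G t t' (n - 1) = zpow G t t' n \<otimes> t'"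
proof -
  have "zpow G t t' n = zpow G t t' (n - 1) \<otimes> t" using zpow_Suc[of "n - 1"] by simp
  then show ?thesis using t zpow_closed[of "n - 1"] by (simp add: m_assoc)
qed

lemma zpow_add: "zpow G t t' (m + n) = zpow G t t' m \<otimes> zpow G t t' n"
proof (induction n rule: int_induct[where k = 0])
  case base
  show ?case using zpow_closed[of m] by (simp add: zpow_def)
next
  case (step1 i)
  have "zpow G t t' (m + (i + 1)) = zpow G t t' (m + i) \<otimes> t" using zpow_Suc[of "m + i"] by (simp add: add.assoc)
  then show ?case using step1 t zpow_closed by (simp add: zpow_Suc m_assoc)
next
  case (step2 i)
  have "zpow G t t' (m + (i - 1)) = zpow G t t' (m + i) \<otimes> t'" using zpow_pred[of "m + i"] by (simp add: algebra_simps)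
  then show ?case using step2 t zpow_closed by (simp add: zpow_pred m_assoc)
qed

end

end

context fgl_regular
begin

lemma e_mult_apply:
  "c \<in> carrier K \<Longrightarrow> f \<in> carrier V \<Longrightarrow> (e c m \<cdot> f) n = c \<otimes>\<^bsub>K\<^esub> f (n - m)"
  using twisted.mono_mult_apply[OF twisted_V, of c m f n] by (simp add: QQv_def)

text \<open>At the lowest exponent in the support of \<open>f\<close> the term q/y of
  \<open>b\<close> contributes nothing, so the product has there the coefficient of \<open>f\<close>
  times the unit 1/x. The argument tolerates zero divisors.\<close>

lemma b_regular:
  assumes f: "f \<in> carrier V" and bf: "b \<cdot> f = \<zero>\<^bsub>V\<^esub>"
  shows "f = \<zero>\<^bsub>V\<^esub>"
proof (rule ccontr)
  assume nz: "f \<noteq> \<zero>\<^bsub>V\<^esub>"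
  let ?A = "{n. f n \<noteq> \<zero>\<^bsub>K\<^esub>}"
  have fin: "finite ?A" using f by (simp add: carrier_V)
  have "?A \<noteq> {}"
  proof
    assume "?A = {}"
    then have "f = \<zero>\<^bsub>V\<^esub>" by (intro ext) (simp add: V_zero)
    then show False using nz by contradiction
  qed
  then have Min: "Min ?A \<in> ?A" using fin Min_in by blast
  define m where "m = Min ?A"
  have "m - 1 \<notin> ?A"
  proof
    assume "m - 1 \<in> ?A"
    then have "m \<le> m - 1" unfolding m_def using fin by (intro Min_le)
    then show False by simp
  qed
  then have m1: "f (m - 1) = \<zero>\<^bsub>K\<^esub>" by simp
  have qY: "q \<cdot> VY = e iY 1" by (simp add: q_def VY_def e_mult)
  have "(b \<cdot> f) m = (VX \<cdot> f) m \<oplus>\<^bsub>K\<^esub> (e iY 1 \<cdot> f) m"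
    unfolding b_def qY using f by (simp add: V.l_distr V_add)
  also have "\<dots> = iX \<otimes>\<^bsub>K\<^esub> f m"
    using f V_coeff[OF f] m1 by (simp add: VX_def e_mult_apply)
  finally have "iX \<otimes>\<^bsub>K\<^esub> f m = \<zero>\<^bsub>K\<^esub>" unfolding bf V_zero by simp
  then have "emb x \<otimes>\<^bsub>K\<^esub> iX \<otimes>\<^bsub>K\<^esub> f m = \<zero>\<^bsub>K\<^esub>" using V_coeff[OF f] by (simp add: K.m_assoc)
  then have "f m = \<zero>\<^bsub>K\<^esub>" using V_coeff[OF f] by (simp add: inv_x_mult)
  then show False using Min unfolding m_def by simp
qed

lemma Theta_regular:
  assumes f: "f \<in> carrier V" and z: "\<Theta> \<cdot> f = \<zero>\<^bsub>V\<^esub>"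
  shows "f = \<zero>\<^bsub>V\<^esub>"
proof -
  \<comment> \<open>\<open>\<Theta>\<close> and the square of \<open>b\<close> differ by the unit
    \<open>q\<close>, so \<open>b\<close> can be cancelled twice.\<close>
  have "b \<cdot> (b \<cdot> f) = q \<cdot> (\<Theta> \<cdot> f)"
    using f q_Theta by (simp add: V.m_assoc[symmetric])
  then have "b \<cdot> (b \<cdot> f) = \<zero>\<^bsub>V\<^esub>" by (simp add: z)
  then show ?thesis using f by (intro b_regular[OF f] b_regular[of "b \<cdot> f"]) simp_all
qed

text \<open>Evaluation at the root \<open>-x\<^sub>-\<^sub>1/x\<^sub>1\<close> of \<open>b\<close>, as a polynomial in \<open>\<eta>\<close> of the simple coroot.\<close>

lemma eval_exists:
  "\<exists>ev. ev \<in> ring_hom V K \<and> (\<forall>c\<in>carrier S. ev (C c) = emb c) \<and> ev b = \<zero>\<^bsub>K\<^esub>"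
proof -
  let ?m = "\<ominus>\<^bsub>K\<^esub> emb u" and ?m' = "\<ominus>\<^bsub>K\<^esub> emb v"
  have uv: "emb u \<otimes>\<^bsub>K\<^esub> emb v = \<one>\<^bsub>K\<^esub>"
    using emb_mult[of u v] v_props(4) by (simp add: emb_one)
  have t: "?m \<in> carrier K" "?m' \<in> carrier K" "?m \<otimes>\<^bsub>K\<^esub> ?m' = \<one>\<^bsub>K\<^esub>"
    using uv by (simp_all add: K.l_minus K.r_minus)
  let ?ev = "comm_group_algebra.lift K integer_group K (\<lambda>c. c) (zpow K ?m ?m')"
  have id: "(\<lambda>c. c) \<in> ring_hom K K" by (rule ring_hom_memI) simp_all
  have z: "zpow K ?m ?m' n \<in> carrier K" "zpow K ?m ?m' (m + n) = zpow K ?m ?m' m \<otimes>\<^bsub>K\<^esub> zpow K ?m ?m' n"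
    "zpow K ?m ?m' 0 = \<one>\<^bsub>K\<^esub>" for m n
    using K.zpow_closed[OF t] K.zpow_add[OF t] by (simp_all add: zpow_def)
  have hom: "?ev \<in> ring_hom V K"
    unfolding QQv_def
    by (rule comm_group_algebra.lift_hom[OF comm_group_algebra_V K_cring id]) (simp_all add: z)
  have e: "?ev (e c n) = c \<otimes>\<^bsub>K\<^esub> zpow K ?m ?m' n" if "c \<in> carrier K" for c n
    by (rule comm_group_algebra.lift_mono[OF comm_group_algebra_V K_cring id]) (simp_all add: z that)
  have "?ev (C c) = emb c" if "c \<in> carrier S" for c
    using that by (simp add: C_def e z)
  moreover have "?ev b = \<zero>\<^bsub>K\<^esub>"
  proof -
    have qY: "q \<cdot> VY = e iY 1" by (simp add: q_def VY_def e_mult)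
    \<comment> \<open>The value is 1/x - u/y, which vanishes because u/y = 1/x.\<close>
    have "?ev b = iX \<oplus>\<^bsub>K\<^esub> iY \<otimes>\<^bsub>K\<^esub> ?m"
      unfolding b_def qY VX_def ring_hom_add[OF hom e_closed[OF inv_x_closed(1)] e_closed[OF inv_x_closed(2)]]
      by (simp add: e z) (simp add: zpow_def)
    also have "iY \<otimes>\<^bsub>K\<^esub> ?m = \<ominus>\<^bsub>K\<^esub> (emb u \<otimes>\<^bsub>K\<^esub> iY)"
      using t by (simp add: K.r_minus K.m_comm)
    finally show ?thesis unfolding emb_u_iY by (simp add: K.r_neg)
  qed
  ultimately show ?thesis using hom by blast
qed

text \<open>The evaluation annihilates \<open>b\<close> and \<open>\<Theta>\<close>, which isolates
  \<open>c\<close>. As \<open>\<Theta>\<close> is a multiple of \<open>b\<close>, one factor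
  \<open>b\<close> can then be cancelled; a second evaluation isolates \<open>d\<close>, and
  regularity of \<open>\<Theta>\<close> settles \<open>g\<close>.\<close>

lemma independent_step:
  assumes c: "c \<in> carrier S" and d: "d \<in> carrier S" and g: "g \<in> carrier V"
    and z: "C c \<oplus>\<^bsub>V\<^esub> C d \<cdot> b \<oplus>\<^bsub>V\<^esub> \<Theta> \<cdot> g = \<zero>\<^bsub>V\<^esub>"
  shows "c = \<zero>\<^bsub>S\<^esub>" "d = \<zero>\<^bsub>S\<^esub>" "g = \<zero>\<^bsub>V\<^esub>"
proof -
  obtain ev where hom: "ev \<in> ring_hom V K" and evC: "\<forall>c\<in>carrier S. ev (C c) = emb c" and evb: "ev b = \<zero>\<^bsub>K\<^esub>"
    using eval_exists by (elim exE conjE)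
  note h = ring_hom_add[OF hom] ring_hom_mult[OF hom] ring_hom_closed[OF hom]
    ring_hom_zero[OF hom V.ring_axioms K.ring_axioms]
  have "ev (C c \<oplus>\<^bsub>V\<^esub> C d \<cdot> b \<oplus>\<^bsub>V\<^esub> \<Theta> \<cdot> g) = emb c"
    using c d g evC by (simp add: h evb \<Theta>_def)
  then have "emb c = emb \<zero>\<^bsub>S\<^esub>" unfolding z h by (simp add: emb_zero)
  then show c0: "c = \<zero>\<^bsub>S\<^esub>" using c by (intro emb_inject) simp_all
  have C0: "C \<zero>\<^bsub>S\<^esub> = \<zero>\<^bsub>V\<^esub>" by (rule ring_hom_zero[OF C_hom S.ring_axioms V.ring_axioms])
  have Cd: "C d \<in> carrier V" using d by simp
  have "b \<cdot> (C d \<oplus>\<^bsub>V\<^esub> p \<cdot> b \<cdot> g) = C d \<cdot> b \<oplus>\<^bsub>V\<^esub> \<Theta> \<cdot> g"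
    unfolding \<Theta>_def using Cd g V_gens_closed b_closed by algebra
  also have "\<dots> = \<zero>\<^bsub>V\<^esub>" using z Cd g unfolding c0 C0 by simp
  finally have z2: "C d \<oplus>\<^bsub>V\<^esub> p \<cdot> b \<cdot> g = \<zero>\<^bsub>V\<^esub>"
    using Cd g by (intro b_regular[of "C d \<oplus>\<^bsub>V\<^esub> p \<cdot> b \<cdot> g"]) simp_all
  have "ev (C d \<oplus>\<^bsub>V\<^esub> p \<cdot> b \<cdot> g) = emb d"
    using d g evC by (simp add: h evb)
  then have "emb d = emb \<zero>\<^bsub>S\<^esub>" unfolding z2 h by (simp add: emb_zero)
  then show d0: "d = \<zero>\<^bsub>S\<^esub>" using d by (intro emb_inject) simp_all
  show "g = \<zero>\<^bsub>V\<^esub>"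
    by (rule Theta_regular[OF g]) (use z g in \<open>simp add: c0 d0 C0\<close>)
qed

definition lincomb where
  "lincomb c d n = (\<Oplus>\<^bsub>V\<^esub>i\<in>{..n::nat}. (C (c i) \<oplus>\<^bsub>V\<^esub> C (d i) \<cdot> b) \<cdot> \<Theta> [^]\<^bsub>V\<^esub> i)"

text \<open>Separate the summand of exponent 0 and factor one \<open>\<Theta>\<close> out of the
  rest; \<open>independent_step\<close> returns the same kind of equation with shifted
  coefficients.\<close>

lemma independent:
  assumes "c \<in> UNIV \<rightarrow> carrier S" "d \<in> UNIV \<rightarrow> carrier S" "lincomb c d n = \<zero>\<^bsub>V\<^esub>" "i \<le> n"
  shows "c i = \<zero>\<^bsub>S\<^esub> \<and> d i = \<zero>\<^bsub>S\<^esub>"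
  using assms
proof (induction n arbitrary: c d i)
  case 0
  then have cd: "c 0 \<in> carrier S" "d 0 \<in> carrier S" by auto
  then have "C (c 0) \<oplus>\<^bsub>V\<^esub> C (d 0) \<cdot> b \<oplus>\<^bsub>V\<^esub> \<Theta> \<cdot> \<zero>\<^bsub>V\<^esub> = \<zero>\<^bsub>V\<^esub>"
    using 0(3) by (simp add: lincomb_def)
  then have "c 0 = \<zero>\<^bsub>S\<^esub>" "d 0 = \<zero>\<^bsub>S\<^esub>"
    using independent_step[OF cd V.zero_closed] by simp_all
  then show ?case using 0(4) by simp
next
  case (Suc n)
  let ?f = "\<lambda>i. (C (c i) \<oplus>\<^bsub>V\<^esub> C (d i) \<cdot> b) \<cdot> \<Theta> [^]\<^bsub>V\<^esub> i"
  let ?c = "\<lambda>i. c (Suc i)" and ?d = "\<lambda>i. d (Suc i)"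
  let ?g = "\<lambda>i. (C (?c i) \<oplus>\<^bsub>V\<^esub> C (?d i) \<cdot> b) \<cdot> \<Theta> [^]\<^bsub>V\<^esub> i"
  have cl: "c i \<in> carrier S" "d i \<in> carrier S" for i using Suc.prems by auto
  have f: "?f i \<in> carrier V" and gi: "?g i \<in> carrier V" for i using cl by simp_all
  have g: "lincomb ?c ?d n \<in> carrier V" unfolding lincomb_def by (rule V.finsum_closed) (simp add: gi)
  have step: "?f (Suc i) = \<Theta> \<cdot> ?g i" for i
    using cl by (simp add: V.m_ac)
  have "lincomb c d (Suc n) = (\<Oplus>\<^bsub>V\<^esub>i\<in>{..n}. ?f (Suc i)) \<oplus>\<^bsub>V\<^esub> ?f 0"
    unfolding lincomb_def by (rule V.finsum_Suc2) (use f in blast)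
  also have "(\<Oplus>\<^bsub>V\<^esub>i\<in>{..n}. ?f (Suc i)) = \<Theta> \<cdot> lincomb ?c ?d n"
    unfolding step lincomb_def by (rule V.finsum_rdistr[symmetric]) (simp_all add: gi)
  also have "?f 0 = C (c 0) \<oplus>\<^bsub>V\<^esub> C (d 0) \<cdot> b" using cl by simp
  finally have z: "C (c 0) \<oplus>\<^bsub>V\<^esub> C (d 0) \<cdot> b \<oplus>\<^bsub>V\<^esub> \<Theta> \<cdot> lincomb ?c ?d n = \<zero>\<^bsub>V\<^esub>"
    using Suc.prems(3) cl g by (simp add: V.a_comm)
  note s = independent_step[OF cl(1) cl(2) g z]
  show ?case
  proof (cases i)
    case 0
    then show ?thesis using s by simp
  next
    case (Suc j)
    have "?c j = \<zero>\<^bsub>S\<^esub> \<and> ?d j = \<zero>\<^bsub>S\<^esub>"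
      by (rule Suc.IH[OF _ _ s(3)]) (use cl Suc.prems(4) Suc in auto)
    then show ?thesis using Suc by simp
  qed
qed

end

text \<open>The division theorem scales the dividend by a power of the leading coefficient of the
  divisor. Here this coefficient is one, so zero divisors do no harm.\<close>

lemma (in UP_cring) monic_quadratic_remainder:
  assumes ab: "\<alpha> \<in> carrier R" "\<beta> \<in> carrier R" and p: "p \<in> carrier P"
    and g: "g = UnivPoly.monom P \<one> 2 \<ominus>\<^bsub>P\<^esub> (UnivPoly.monom P \<alpha> 1 \<oplus>\<^bsub>P\<^esub> UnivPoly.monom P \<beta> 0)"
  shows "\<exists>q\<in>carrier P. \<exists>r0\<in>carrier R. \<exists>r1\<in>carrier R.
    p = g \<otimes>\<^bsub>P\<^esub> q \<oplus>\<^bsub>P\<^esub> (UnivPoly.monom P r0 0 \<oplus>\<^bsub>P\<^esub> UnivPoly.monom P r1 1)"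
\<comment> \<open>Over the zero ring \<open>g\<close> does not have degree 2, but there every
  polynomial vanishes.\<close>
proof (cases "\<one> = \<zero>")
  case True
  have "a = \<zero>" if "a \<in> carrier R" for a using R.l_one[OF that] that unfolding True by simp
  then have trivial: "p' = \<zero>\<^bsub>P\<^esub>" if "p' \<in> carrier P" for p'
    using that by (intro up_eqI) simp_all
  let ?z = "g \<otimes>\<^bsub>P\<^esub> \<zero>\<^bsub>P\<^esub> \<oplus>\<^bsub>P\<^esub> (UnivPoly.monom P \<zero> 0 \<oplus>\<^bsub>P\<^esub> UnivPoly.monom P \<zero> 1)"
  have "?z \<in> carrier P" using ab unfolding g by simp
  then have "p = ?z" using trivial[OF p] trivial[of ?z] by simp
  then show ?thesis by blast
next
  case False
  have gP: "g \<in> carrier P" unfolding g using ab by simp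
  have coeff: "UnivPoly.coeff P g n = (if n = 2 then \<one> else if n = 1 then \<ominus> \<alpha> else if n = 0 then \<ominus> \<beta> else \<zero>)" for n
    unfolding g a_minus_def using ab by auto
  have deg: "deg R g = 2"
    by (rule le_antisym[OF deg_aboveI deg_belowI]) (use False gP in \<open>auto simp: coeff\<close>)
  have "g \<noteq> \<zero>\<^bsub>P\<^esub>" using coeff[of 2] False by auto
  then obtain q r k where qr: "q \<in> carrier P" "r \<in> carrier P"
    "(UnivPoly.coeff P g (deg R g)) [^] (k::nat) \<odot>\<^bsub>P\<^esub> p = g \<otimes>\<^bsub>P\<^esub> q \<oplus>\<^bsub>P\<^esub> r" "r = \<zero>\<^bsub>P\<^esub> \<or> deg R r < deg R g"
    using long_div_theorem[OF gP p] by blast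
  have "r = UnivPoly.monom P (UnivPoly.coeff P r 0) 0 \<oplus>\<^bsub>P\<^esub> UnivPoly.monom P (UnivPoly.coeff P r 1) 1"
  proof (rule up_eqI)
    fix n
    have "UnivPoly.coeff P r n = \<zero>" if "n \<ge> 2"
      using qr(2,4) that deg_aboveD[of r n] unfolding deg by auto
    then show "UnivPoly.coeff P r n = UnivPoly.coeff P (UnivPoly.monom P (UnivPoly.coeff P r 0) 0 \<oplus>\<^bsub>P\<^esub> UnivPoly.monom P (UnivPoly.coeff P r 1) 1) n"
      using qr(2) by (cases "n = 0 \<or> n = 1") auto
  qed (use qr in simp_all)
  moreover have "p = g \<otimes>\<^bsub>P\<^esub> q \<oplus>\<^bsub>P\<^esub> r" using qr(3) p unfolding deg coeff by simp
  ultimately show ?thesis using qr(1,2) coeff_closed by metis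
qed

section \<open>The localized Peterson subalgebra\<close>

context fgl_regular
begin

abbreviation N where "N \<equiv> peterson_denoms F"
abbreviation B where "B \<equiv> peterson_loc F"

lemma Theta_pow_in_Pet: "\<Theta> [^]\<^bsub>V\<^esub> (i::nat) \<in> Pet"
  using Pet_Theta_pow[OF Pet_one, of i] by simp

lemma iota_Theta_mult:
  "io (\<Theta> [^]\<^bsub>V\<^esub> (i::nat)) \<otimes>\<^bsub>D\<^esub> io (\<Theta> [^]\<^bsub>V\<^esub> j) = io (\<Theta> [^]\<^bsub>V\<^esub> (i + j))"
  by (simp add: iota_mult[symmetric] V.nat_pow_mult)

lemma denoms_subset: "{io (frakY F (sigma_even i)) | i. i \<ge> 1} \<subseteq> carrier D"
  using Theta_pow_in_Pet by (auto simp: frakY_sigma)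

lemma submonoid_N: "submonoid N D"
  unfolding peterson_denoms_def by (rule submonoid_generated_submonoid[OF D.monoid_axioms denoms_subset])

text \<open>The powers of \<open>\<Theta>\<close> form a submonoid, and by
  \<open>frakY_sigma\<close> they include all generators of \<open>N\<close>.\<close>

lemma N_cases:
  assumes "s \<in> N" obtains i where "s = io (\<Theta> [^]\<^bsub>V\<^esub> (i::nat))"
proof -
  let ?H = "range (\<lambda>i::nat. io (\<Theta> [^]\<^bsub>V\<^esub> i))"
  have "submonoid ?H D"
  proof
    show "?H \<subseteq> carrier D" using Theta_pow_in_Pet by auto
    show "\<one>\<^bsub>D\<^esub> \<in> ?H" by (rule range_eqI[of _ _ 0]) (simp add: iota_one)
    fix s t assume "s \<in> ?H" "t \<in> ?H"
    then show "s \<otimes>\<^bsub>D\<^esub> t \<in> ?H" using iota_Theta_mult by blast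
  qed
  moreover have "{io (frakY F (sigma_even i)) | i. i \<ge> 1} \<subseteq> ?H" by (auto simp: frakY_sigma)
  ultimately have "N \<subseteq> ?H" unfolding peterson_denoms_def by (rule submonoid_generated_minimal)
  then show ?thesis using assms that by blast
qed

lemma multiplicative_N: "multiplicative_set D N"
  by (intro multiplicative_set.intro multiplicative_set_axioms.intro submonoid_N D.cring_axioms)

interpretation B: multiplicative_set D N
  rewrites "localization D N = B"
  by (rule multiplicative_N) (simp add: peterson_loc_def)

interpretation BB: cring B
  by (rule B.cring_L)

lemma iota_Theta_in_N: "io \<Theta> \<in> N"
proof -
  have "io (frakY F (sigma_even 1)) \<in> {io (frakY F (sigma_even i)) | i. i \<ge> 1}" by blast
  then have "io (frakY F (sigma_even 1)) \<in> N"
    unfolding peterson_denoms_def by (rule subsetD[OF submonoid_generated_incl])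
  then show ?thesis unfolding frakY_sigma by simp
qed

text \<open>Repeated use of \<open>Theta_regular\<close>, which holds in all of \<open>QQv F\<close>
  and hence in the subring.\<close>

lemma N_regular: "s \<in> N \<Longrightarrow> regular_elt D s"
proof -
  assume "s \<in> N"
  then obtain i where s: "s = io (\<Theta> [^]\<^bsub>V\<^esub> (i::nat))" by (rule N_cases)
  have reg: "f = \<zero>\<^bsub>V\<^esub>" if "f \<in> carrier V" "\<Theta> [^]\<^bsub>V\<^esub> i \<cdot> f = \<zero>\<^bsub>V\<^esub>" for f
    using that
  proof (induction i)
    case (Suc i)
    have "\<Theta> \<cdot> (\<Theta> [^]\<^bsub>V\<^esub> i \<cdot> f) = \<Theta> [^]\<^bsub>V\<^esub> Suc i \<cdot> f" using Suc.prems by (simp add: V.m_ac)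
    then have "\<Theta> [^]\<^bsub>V\<^esub> i \<cdot> f = \<zero>\<^bsub>V\<^esub>"
      using Suc.prems by (intro Theta_regular[of "\<Theta> [^]\<^bsub>V\<^esub> i \<cdot> f"]) simp_all
    then show ?case by (rule Suc.IH[OF Suc.prems(1)])
  qed simp
  have "a = \<zero>\<^bsub>D\<^esub>" if a: "a \<in> carrier D" "s \<otimes>\<^bsub>D\<^esub> a = \<zero>\<^bsub>D\<^esub>" for a
  proof -
    obtain f where f: "f \<in> Pet" "a = io f" using a(1) unfolding D_simps by (elim imageE)
    note fV = Pet_closed[OF f(1)]
    have "io (\<Theta> [^]\<^bsub>V\<^esub> i \<cdot> f) = io \<zero>\<^bsub>V\<^esub>"
      using a(2) unfolding s f(2) D_simps iota_zero using fV by (simp add: iota_mult)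
    then have "\<Theta> [^]\<^bsub>V\<^esub> i \<cdot> f = \<zero>\<^bsub>V\<^esub>" using fV by (subst (asm) iota_inject) simp_all
    then have "f = \<zero>\<^bsub>V\<^esub>" by (rule reg[OF fV])
    then show ?thesis unfolding f(2) by (simp add: iota_zero)
  qed
  then show ?thesis unfolding regular_elt_def s using Theta_pow_in_Pet by simp
qed

section \<open>Fractions in the localized Peterson subalgebra\<close>

definition embB where "embB f = loc_frac D N (io f) \<one>\<^bsub>D\<^esub>"

lemma embB_closed [simp]: "f \<in> Pet \<Longrightarrow> embB f \<in> carrier B"
  unfolding embB_def by (rule ring_hom_closed[OF B.frac_hom]) simp

lemma embB_mult: "f \<in> Pet \<Longrightarrow> g \<in> Pet \<Longrightarrow> embB (f \<cdot> g) = embB f \<otimes>\<^bsub>B\<^esub> embB g"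
  using ring_hom_mult[OF B.frac_hom, of "io f" "io g"] Pet_closed
  by (simp add: embB_def iota_mult)

lemma embB_add: "f \<in> Pet \<Longrightarrow> g \<in> Pet \<Longrightarrow> embB (f \<oplus>\<^bsub>V\<^esub> g) = embB f \<oplus>\<^bsub>B\<^esub> embB g"
  using ring_hom_add[OF B.frac_hom, of "io f" "io g"] Pet_closed
  by (simp add: embB_def iota_add)

lemma embB_one: "embB \<one>\<^bsub>V\<^esub> = \<one>\<^bsub>B\<^esub>"
  unfolding embB_def iota_one D_simps(3)[symmetric] by (rule ring_hom_one[OF B.frac_hom])

lemma embB_zero: "embB \<zero>\<^bsub>V\<^esub> = \<zero>\<^bsub>B\<^esub>"
  unfolding embB_def iota_zero D_simps(4)[symmetric]
  by (rule ring_hom_zero[OF B.frac_hom D.ring_axioms BB.ring_axioms])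

lemma embB_inject:
  assumes "f \<in> Pet" "embB f = \<zero>\<^bsub>B\<^esub>" shows "f = \<zero>\<^bsub>V\<^esub>"
proof -
  have "io f = io \<zero>\<^bsub>V\<^esub>"
  proof (rule B.frac_inject[OF N_regular])
    show "loc_frac D N (io f) \<one>\<^bsub>D\<^esub> = loc_frac D N (io \<zero>\<^bsub>V\<^esub>) \<one>\<^bsub>D\<^esub>"
      using assms(2) unfolding embB_zero[symmetric] embB_def .
  qed (use assms(1) Pet.zero in simp_all)
  then show ?thesis using Pet_closed[OF assms(1)] iota_inject by simp
qed

lemma embB_pow: "embB (\<Theta> [^]\<^bsub>V\<^esub> (i::nat)) = embB \<Theta> [^]\<^bsub>B\<^esub> i"
  by (induction i) (simp_all add: embB_one embB_mult Theta_pow_in_Pet Theta_in_Pet)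

abbreviation t where "t \<equiv> embB \<Theta>"
definition t' where "t' = loc_frac D N \<one>\<^bsub>D\<^esub> (io \<Theta>)"
abbreviation s where "s \<equiv> embB b"
abbreviation \<phi> where "\<phi> \<equiv> peterson_loc_of F"

lemma t_props: "t \<in> carrier B" "t' \<in> carrier B" "t \<otimes>\<^bsub>B\<^esub> t' = \<one>\<^bsub>B\<^esub>"
proof -
  show "t \<in> carrier B" by (rule embB_closed[OF Theta_in_Pet])
  show "t' \<in> carrier B" unfolding t'_def by (rule B.frac_closed[OF D.one_closed iota_Theta_in_N])
  show "t \<otimes>\<^bsub>B\<^esub> t' = \<one>\<^bsub>B\<^esub>" unfolding t'_def embB_def by (rule B.frac_inverse[OF iota_Theta_in_N])
qed

lemma s_closed: "s \<in> carrier B"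
  by (rule embB_closed[OF b_in_Pet])

lemma phi_eq: "c \<in> carrier S \<Longrightarrow> \<phi> c = embB (C c)"
  unfolding peterson_loc_of_def embB_def C_def by (simp add: iota_e)

lemma phi_hom: "\<phi> \<in> ring_hom S B"
  by (rule ring_hom_memI)
    (simp_all add: phi_eq Pet_gens ring_hom_mult[OF C_hom] ring_hom_add[OF C_hom] C_one embB_mult embB_add embB_one)

text \<open>All denominators are powers of \<open>\<Theta>\<close>, so powers of the single inverse
  \<open>t'\<close> suffice.\<close>

lemma B_cases:
  assumes "z \<in> carrier B"
  obtains f i where "f \<in> Pet" "z = embB f \<otimes>\<^bsub>B\<^esub> t' [^]\<^bsub>B\<^esub> (i::nat)"
proof -
  obtain a n where an: "a \<in> carrier D" "n \<in> N" "z = loc_frac D N a n"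
    using assms by (rule B.L_cases)
  obtain f where f: "f \<in> Pet" "a = io f" using an(1) unfolding D_simps by (elim imageE)
  obtain i where n: "n = io (\<Theta> [^]\<^bsub>V\<^esub> (i::nat))" using an(2) by (rule N_cases)
  \<comment> \<open>Membership in \<open>N\<close> is proved along with the formula because
    multiplying fractions requires it.\<close>
  have *: "io (\<Theta> [^]\<^bsub>V\<^esub> i) \<in> N \<and> loc_frac D N \<one>\<^bsub>D\<^esub> (io (\<Theta> [^]\<^bsub>V\<^esub> i)) = t' [^]\<^bsub>B\<^esub> i" for i :: nat
  proof (induction i)
    case 0
    have "\<one>\<^bsub>D\<^esub> \<in> N" by (rule B.M_one)
    then show ?case by (simp add: iota_one B.one_L)
  next
    case (Suc i)
    have e: "io (\<Theta> [^]\<^bsub>V\<^esub> Suc i) = io (\<Theta> [^]\<^bsub>V\<^esub> i) \<otimes>\<^bsub>D\<^esub> io \<Theta>"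
      using iota_Theta_mult[of i 1] by simp
    have "loc_frac D N (\<one>\<^bsub>D\<^esub> \<otimes>\<^bsub>D\<^esub> \<one>\<^bsub>D\<^esub>) (io (\<Theta> [^]\<^bsub>V\<^esub> i) \<otimes>\<^bsub>D\<^esub> io \<Theta>) = t' [^]\<^bsub>B\<^esub> i \<otimes>\<^bsub>B\<^esub> t'"
      unfolding t'_def using Suc
      by (subst B.frac_mult[symmetric]) (use Suc iota_Theta_in_N D.one_closed in \<open>simp_all add: t'_def del: D_simps\<close>)
    moreover have "io (\<Theta> [^]\<^bsub>V\<^esub> i) \<otimes>\<^bsub>D\<^esub> io \<Theta> \<in> N" using Suc iota_Theta_in_N by (intro B.M_mult) simp_all
    ultimately show ?case unfolding e by simp
  qed
  have "z = embB f \<otimes>\<^bsub>B\<^esub> t' [^]\<^bsub>B\<^esub> i"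
    unfolding an(3) embB_def f(2)[symmetric] using * an n
    by (subst B.frac_split[OF an(1,2)]) simp
  then show ?thesis using f(1) that by blast
qed

section \<open>The homomorphism from Laurent polynomials, with the variable going to
  \<open>\<Theta>\<close>\<close>

abbreviation L where "L \<equiv> laurent S"
abbreviation ell where "ell \<equiv> laurent_monom S"
abbreviation U where "U \<equiv> UP L"
abbreviation zp where "zp \<equiv> zpow B t t'"

lemma comm_group_algebra_L: "comm_group_algebra S integer_group"
  by (intro comm_group_algebraI S.cring_axioms abelian_integer_group)

lemmas twisted_L = comm_group_algebra.axioms(1)[OF comm_group_algebra_L]

lemma L_cring: "cring L"
  unfolding laurent_def by (rule comm_group_algebra.cring_T[OF comm_group_algebra_L])

interpretation L: cring L
  by (rule L_cring)

lemma ell_closed [simp]: "c \<in> carrier S \<Longrightarrow> ell c n \<in> carrier L"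
  unfolding laurent_def by (rule twisted.mono_closed[OF twisted_L])

definition \<psi> where "\<psi> = comm_group_algebra.lift S integer_group B \<phi> zp"

lemma zp_props: "zp n \<in> carrier B" "zp (m + n) = zp m \<otimes>\<^bsub>B\<^esub> zp n" "zp 0 = \<one>\<^bsub>B\<^esub>"
  using BB.zpow_closed[OF t_props] BB.zpow_add[OF t_props] by (simp_all add: zpow_def)

lemma psi_hom: "\<psi> \<in> ring_hom L B"
  unfolding laurent_def \<psi>_def
  by (rule comm_group_algebra.lift_hom[OF comm_group_algebra_L BB.cring_axioms phi_hom]) (simp_all add: zp_props)

lemma psi_ell: "c \<in> carrier S \<Longrightarrow> \<psi> (ell c n) = \<phi> c \<otimes>\<^bsub>B\<^esub> zp n"
  unfolding \<psi>_def
  by (rule comm_group_algebra.lift_mono[OF comm_group_algebra_L BB.cring_axioms phi_hom]) (simp_all add: zp_props)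

lemma psi_sum:
  assumes "f \<in> carrier L" "finite A" "{n. f n \<noteq> \<zero>\<^bsub>S\<^esub>} \<subseteq> A"
  shows "\<psi> f = (\<Oplus>\<^bsub>B\<^esub>n\<in>A. \<phi> (f n) \<otimes>\<^bsub>B\<^esub> zp n)"
  unfolding \<psi>_def
  by (rule comm_group_algebra.lift_eq_sum[OF comm_group_algebra_L BB.cring_axioms phi_hom])
    (use assms in \<open>simp_all add: zp_props laurent_def\<close>)

lemma L_props: "f \<in> carrier L \<Longrightarrow> finite {n. f n \<noteq> \<zero>\<^bsub>S\<^esub>}" "f \<in> carrier L \<Longrightarrow> f n \<in> carrier S"
  using twisted.T_finite[OF twisted_L, of f] twisted.T_coeff[OF twisted_L, of f n] by (simp_all add: laurent_def)

text \<open>Transports linear combinations from \<open>QQv F\<close> to the localization, where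
  Laurent coefficients are compared.\<close>

lemma lincomb_Pet:
  assumes c: "c \<in> UNIV \<rightarrow> carrier S" and d: "d \<in> UNIV \<rightarrow> carrier S"
  shows "lincomb c d n \<in> Pet \<and> embB (lincomb c d n)
    = (\<Oplus>\<^bsub>B\<^esub>i\<in>{..n}. (\<phi> (c i) \<oplus>\<^bsub>B\<^esub> \<phi> (d i) \<otimes>\<^bsub>B\<^esub> s) \<otimes>\<^bsub>B\<^esub> t [^]\<^bsub>B\<^esub> i)"
proof -
  let ?f = "\<lambda>i. (C (c i) \<oplus>\<^bsub>V\<^esub> C (d i) \<cdot> b) \<cdot> \<Theta> [^]\<^bsub>V\<^esub> i"
  let ?g = "\<lambda>i. (\<phi> (c i) \<oplus>\<^bsub>B\<^esub> \<phi> (d i) \<otimes>\<^bsub>B\<^esub> s) \<otimes>\<^bsub>B\<^esub> t [^]\<^bsub>B\<^esub> i"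
  have cl: "c i \<in> carrier S" "d i \<in> carrier S" for i using c d by auto
  have f: "?f i \<in> Pet" for i
    by (intro Pet_mult Pet.add Pet_gens cl b_in_Pet Theta_pow_in_Pet)
  have fV: "?f i \<in> carrier V" for i using f Pet_closed by blast
  have fg: "embB (?f i) = ?g i" for i
    using cl b_in_Pet Theta_pow_in_Pet
    by (simp add: embB_mult embB_add embB_pow phi_eq Pet_mult Pet.add Pet_gens)
  have g: "?g i \<in> carrier B" for i unfolding fg[symmetric] using f by simp
  have "(\<Oplus>\<^bsub>V\<^esub>i\<in>{..n}. ?f i) \<in> Pet \<and> embB (\<Oplus>\<^bsub>V\<^esub>i\<in>{..n}. ?f i) = (\<Oplus>\<^bsub>B\<^esub>i\<in>{..n}. ?g i)"
  proof (induction n)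
    case 0
    have "(\<Oplus>\<^bsub>V\<^esub>i\<in>{..0::nat}. ?f i) = ?f 0" using fV[of 0] by simp
    moreover have "(\<Oplus>\<^bsub>B\<^esub>i\<in>{..0::nat}. ?g i) = ?g 0" using g[of 0] by simp
    ultimately show ?case using f[of 0] fg[of 0] by simp
  next
    case (Suc n)
    have "(\<Oplus>\<^bsub>V\<^esub>i\<in>{..Suc n}. ?f i) = ?f (Suc n) \<oplus>\<^bsub>V\<^esub> (\<Oplus>\<^bsub>V\<^esub>i\<in>{..n}. ?f i)"
      by (rule V.finsum_Suc) (use fV in blast)
    moreover have "(\<Oplus>\<^bsub>B\<^esub>i\<in>{..Suc n}. ?g i) = ?g (Suc n) \<oplus>\<^bsub>B\<^esub> (\<Oplus>\<^bsub>B\<^esub>i\<in>{..n}. ?g i)"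
      by (rule BB.finsum_Suc) (use g in blast)
    ultimately show ?case using Suc f[of "Suc n"] fg[of "Suc n"] Pet.add embB_add by presburger
  qed
  then show ?thesis unfolding lincomb_def .
qed

text \<open>A large power of \<open>t\<close> clears the negative exponents. The resulting equation
  is the image of one in \<open>Pet\<close>, on which \<open>embB\<close> is injective, and there
  \<open>independent\<close> applies.\<close>

lemma psi_independent:
  assumes f: "f \<in> carrier L" "g \<in> carrier L" and z: "\<psi> f \<oplus>\<^bsub>B\<^esub> \<psi> g \<otimes>\<^bsub>B\<^esub> s = \<zero>\<^bsub>B\<^esub>"
  shows "f = \<zero>\<^bsub>L\<^esub> \<and> g = \<zero>\<^bsub>L\<^esub>"
proof -
  let ?X = "{n. f n \<noteq> \<zero>\<^bsub>S\<^esub>} \<union> {n. g n \<noteq> \<zero>\<^bsub>S\<^esub>}"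
  \<comment> \<open>If \<open>f\<close> and \<open>g\<close> are both zero, \<open>Max\<close> is
    taken of the empty set and its value is arbitrary; the absolute value in \<open>M\<close> makes
    this harmless.\<close>
  define m where "m = Max (abs ` ?X) + 1"
  have fin: "finite (abs ` ?X)" using f by (intro finite_imageI) (simp add: L_props)
  have m: "\<bar>n\<bar> < m" if "n \<in> ?X" for n
    using Max_ge[OF fin imageI[OF that]] unfolding m_def by linarith
  define M where "M = nat \<bar>m\<bar>"
  \<comment> \<open>Matches the indices 0 to 2M with the exponents from -M to M.\<close>
  let ?h = "\<lambda>k::nat. int k - int M"
  let ?A = "?h ` {..2 * M}"
  have A: "n \<in> ?A" if "\<bar>n\<bar> < m" for n
    by (rule image_eqI[of _ _ "nat (n + int M)"]) (use that in \<open>auto simp: M_def\<close>)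
  have supp: "{n. f n \<noteq> \<zero>\<^bsub>S\<^esub>} \<subseteq> ?A" "{n. g n \<noteq> \<zero>\<^bsub>S\<^esub>} \<subseteq> ?A"
    using m A by blast+
  have phi: "\<phi> (f n) \<in> carrier B" "\<phi> (g n) \<in> carrier B" for n
    using L_props(2) f ring_hom_closed[OF phi_hom] by blast+
  have inj: "inj_on ?h {..2 * M}" by (auto simp: inj_on_def)
  have psi: "\<psi> f' = (\<Oplus>\<^bsub>B\<^esub>k\<in>{..2 * M}. \<phi> (f' (?h k)) \<otimes>\<^bsub>B\<^esub> zp (?h k))"
    if "f' \<in> {f, g}" for f'
  proof -
    have "\<psi> f' = (\<Oplus>\<^bsub>B\<^esub>n\<in>?A. \<phi> (f' n) \<otimes>\<^bsub>B\<^esub> zp n)"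
      using that f supp by (intro psi_sum) auto
    also have "\<dots> = (\<Oplus>\<^bsub>B\<^esub>k\<in>{..2 * M}. \<phi> (f' (?h k)) \<otimes>\<^bsub>B\<^esub> zp (?h k))"
      by (rule BB.finsum_reindex[OF _ inj]) (use that phi in \<open>auto simp: zp_props\<close>)
    finally show ?thesis .
  qed
  define F1 where "F1 k = \<phi> (f (?h k)) \<otimes>\<^bsub>B\<^esub> zp (?h k)" for k
  define G1 where "G1 k = \<phi> (g (?h k)) \<otimes>\<^bsub>B\<^esub> zp (?h k)" for k
  have F1: "F1 k \<in> carrier B" "G1 k \<in> carrier B" for k
    unfolding F1_def G1_def using phi zp_props(1) by simp_all
  have psi_f: "\<psi> f = (\<Oplus>\<^bsub>B\<^esub>k\<in>{..2 * M}. F1 k)" and psi_g: "\<psi> g = (\<Oplus>\<^bsub>B\<^esub>k\<in>{..2 * M}. G1 k)"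
    unfolding F1_def G1_def by (simp_all add: psi)
  have sum: "\<psi> f \<oplus>\<^bsub>B\<^esub> \<psi> g \<otimes>\<^bsub>B\<^esub> s = (\<Oplus>\<^bsub>B\<^esub>k\<in>{..2 * M}. F1 k \<oplus>\<^bsub>B\<^esub> G1 k \<otimes>\<^bsub>B\<^esub> s)"
  proof -
    have "\<psi> g \<otimes>\<^bsub>B\<^esub> s = (\<Oplus>\<^bsub>B\<^esub>k\<in>{..2 * M}. G1 k \<otimes>\<^bsub>B\<^esub> s)"
      unfolding psi_g by (rule BB.finsum_ldistr) (use F1 s_closed in auto)
    moreover have "(\<Oplus>\<^bsub>B\<^esub>k\<in>{..2 * M}. F1 k \<oplus>\<^bsub>B\<^esub> G1 k \<otimes>\<^bsub>B\<^esub> s)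
        = (\<Oplus>\<^bsub>B\<^esub>k\<in>{..2 * M}. F1 k) \<oplus>\<^bsub>B\<^esub> (\<Oplus>\<^bsub>B\<^esub>k\<in>{..2 * M}. G1 k \<otimes>\<^bsub>B\<^esub> s)"
      by (rule BB.finsum_addf) (use F1 s_closed in auto)
    ultimately show ?thesis unfolding psi_f by simp
  qed
  let ?c = "\<lambda>k. f (?h k)" and ?d = "\<lambda>k. g (?h k)"
  have cd: "?c \<in> UNIV \<rightarrow> carrier S" "?d \<in> UNIV \<rightarrow> carrier S" using L_props(2) f by blast+
  have summand: "(F1 k \<oplus>\<^bsub>B\<^esub> G1 k \<otimes>\<^bsub>B\<^esub> s) \<otimes>\<^bsub>B\<^esub> zp (int M)
      = (\<phi> (?c k) \<oplus>\<^bsub>B\<^esub> \<phi> (?d k) \<otimes>\<^bsub>B\<^esub> s) \<otimes>\<^bsub>B\<^esub> t [^]\<^bsub>B\<^esub> k" for k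
  proof -
    have "zp (?h k) \<otimes>\<^bsub>B\<^esub> zp (int M) = zp (int k)" unfolding zp_props(2)[symmetric] by simp
    also have "\<dots> = t [^]\<^bsub>B\<^esub> k" by (simp add: zpow_def)
    finally have e: "zp (?h k) \<otimes>\<^bsub>B\<^esub> zp (int M) = t [^]\<^bsub>B\<^esub> k" .
    show ?thesis
      unfolding F1_def G1_def e[symmetric]
      using phi[of "?h k"] zp_props(1)[of "?h k"] zp_props(1)[of "int M"] s_closed by algebra
  qed
  have "embB (lincomb ?c ?d (2 * M)) = (\<Oplus>\<^bsub>B\<^esub>k\<in>{..2 * M}. (F1 k \<oplus>\<^bsub>B\<^esub> G1 k \<otimes>\<^bsub>B\<^esub> s) \<otimes>\<^bsub>B\<^esub> zp (int M))"
    unfolding summand using lincomb_Pet[OF cd] by blast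
  also have "\<dots> = (\<Oplus>\<^bsub>B\<^esub>k\<in>{..2 * M}. F1 k \<oplus>\<^bsub>B\<^esub> G1 k \<otimes>\<^bsub>B\<^esub> s) \<otimes>\<^bsub>B\<^esub> zp (int M)"
    by (rule BB.finsum_ldistr[symmetric]) (use F1 s_closed zp_props(1) in auto)
  also have "\<dots> = \<zero>\<^bsub>B\<^esub>" unfolding sum[symmetric] z using zp_props(1) by simp
  finally have lz: "lincomb ?c ?d (2 * M) = \<zero>\<^bsub>V\<^esub>"
    using lincomb_Pet[OF cd] by (intro embB_inject) blast+
  have "f n = \<zero>\<^bsub>S\<^esub> \<and> g n = \<zero>\<^bsub>S\<^esub>" for n
  proof (cases "n \<in> ?A")
    case True
    then obtain k where k: "k \<le> 2 * M" "n = ?h k" by auto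
    show ?thesis unfolding k(2) by (rule independent[OF cd lz k(1)])
  next
    case False
    then show ?thesis using supp by blast
  qed
  moreover have "\<zero>\<^bsub>L\<^esub> n = \<zero>\<^bsub>S\<^esub>" for n
    using twisted.T_zero[OF twisted_L, of n] by (simp add: laurent_def)
  ultimately show ?thesis by (auto intro!: ext)
qed


section \<open>The evaluation of polynomials at \<open>b\<close> and its kernel\<close>

lemma UP_L: "UP_cring L"
  by (intro UP_cring.intro L_cring)

lemma UP_pre: "UP_pre_univ_prop L B \<psi>"
  by (rule UP_pre_univ_propI[OF L_cring BB.cring_axioms psi_hom])

lemma U_cring: "cring U"
  by (rule UP_cring.UP_cring[OF UP_L])

interpretation U: cring U
  by (rule U_cring)

abbreviation mon where "mon \<equiv> UnivPoly.monom U"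

lemma mon_closed [simp]: "a \<in> carrier L \<Longrightarrow> mon a n \<in> carrier U"
  by (rule UP_ring.monom_closed) (simp_all add: UP_ring_def L.ring_axioms)

definition Ev where "Ev = eval L B \<psi> s"

lemma Ev_hom: "Ev \<in> ring_hom U B"
  unfolding Ev_def by (rule UP_pre_univ_prop.eval_ring_hom[OF UP_pre s_closed])

lemma Ev_mon: "a \<in> carrier L \<Longrightarrow> Ev (mon a n) = \<psi> a \<otimes>\<^bsub>B\<^esub> s [^]\<^bsub>B\<^esub> n"
  unfolding Ev_def by (rule UP_pre_univ_prop.eval_monom[OF UP_pre _ s_closed])

abbreviation \<mu> where "\<mu> \<equiv> \<ominus>\<^bsub>S\<^esub> u"
abbreviation rel where "rel \<equiv> quadratic_rel F \<mu>"

lemma rel_eq: "rel = mon \<one>\<^bsub>L\<^esub> 2 \<ominus>\<^bsub>U\<^esub> (mon (ell y 1) 1 \<oplus>\<^bsub>U\<^esub> mon (ell \<mu> 1) 0)"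
  by (simp add: quadratic_rel_def Let_def)

lemma rel_closed: "rel \<in> carrier U"
  unfolding rel_eq by simp

lemma s_square: "s \<otimes>\<^bsub>B\<^esub> s = \<phi> y \<otimes>\<^bsub>B\<^esub> t \<otimes>\<^bsub>B\<^esub> s \<oplus>\<^bsub>B\<^esub> \<phi> \<mu> \<otimes>\<^bsub>B\<^esub> t"
proof -
  have "s \<otimes>\<^bsub>B\<^esub> s = embB (b \<cdot> b)" using b_in_Pet by (simp add: embB_mult)
  then show ?thesis
    unfolding b_square using b_in_Pet Theta_in_Pet
    by (simp add: embB_mult embB_add phi_eq Pet_mult Pet_gens)
qed

lemma Ev_rel: "Ev rel = \<zero>\<^bsub>B\<^esub>"
proof -
  have cl: "mon \<one>\<^bsub>L\<^esub> 2 \<in> carrier U" "mon (ell y 1) 1 \<in> carrier U" "mon (ell \<mu> 1) 0 \<in> carrier U" by simp_all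
  have phi: "\<phi> y \<in> carrier B" "\<phi> \<mu> \<in> carrier B" by (rule ring_hom_closed[OF phi_hom], simp)+
  have zp1: "zp 1 = t" using t_props by (simp add: zpow_def)
  have e: "Ev (mon \<one>\<^bsub>L\<^esub> 2) = s \<otimes>\<^bsub>B\<^esub> s" "Ev (mon (ell y 1) 1) = \<phi> y \<otimes>\<^bsub>B\<^esub> t \<otimes>\<^bsub>B\<^esub> s"
    "Ev (mon (ell \<mu> 1) 0) = \<phi> \<mu> \<otimes>\<^bsub>B\<^esub> t"
    using phi s_closed t_props(1)
    by (simp_all add: Ev_mon psi_ell zp1 ring_hom_one[OF psi_hom] numeral_2_eq_2)
  have "mon \<one>\<^bsub>L\<^esub> 2 = rel \<oplus>\<^bsub>U\<^esub> (mon (ell y 1) 1 \<oplus>\<^bsub>U\<^esub> mon (ell \<mu> 1) 0)"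
    unfolding rel_eq using cl by algebra
  then have "Ev (mon \<one>\<^bsub>L\<^esub> 2) = Ev rel \<oplus>\<^bsub>B\<^esub> (Ev (mon (ell y 1) 1) \<oplus>\<^bsub>B\<^esub> Ev (mon (ell \<mu> 1) 0))"
    using cl rel_closed by (simp add: ring_hom_add[OF Ev_hom])
  then have z: "Ev rel \<oplus>\<^bsub>B\<^esub> s \<otimes>\<^bsub>B\<^esub> s = s \<otimes>\<^bsub>B\<^esub> s"
    unfolding e s_square[symmetric] by (rule sym)
  have "Ev rel = (Ev rel \<oplus>\<^bsub>B\<^esub> s \<otimes>\<^bsub>B\<^esub> s) \<ominus>\<^bsub>B\<^esub> s \<otimes>\<^bsub>B\<^esub> s"
    using ring_hom_closed[OF Ev_hom rel_closed] s_closed by algebra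
  also have "\<dots> = \<zero>\<^bsub>B\<^esub>" unfolding z using s_closed by (simp add: a_minus_def BB.r_neg)
  finally show ?thesis .
qed

text \<open>After division by the monic relation, a polynomial in the kernel leaves a remainder
  \<open>r0 + r1 s\<close> of value zero, which vanishes by \<open>psi_independent\<close>.\<close>

lemma kernel_Ev: "a_kernel U B Ev = PIdl\<^bsub>U\<^esub> rel"
proof
  have Ev0: "Ev (p \<otimes>\<^bsub>U\<^esub> rel) = \<zero>\<^bsub>B\<^esub>" if "p \<in> carrier U" for p
    using that by (simp add: ring_hom_mult[OF Ev_hom] rel_closed Ev_rel ring_hom_closed[OF Ev_hom])
  then show "PIdl\<^bsub>U\<^esub> rel \<subseteq> a_kernel U B Ev"
    unfolding cgenideal_def a_kernel_def' using rel_closed by auto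
  show "a_kernel U B Ev \<subseteq> PIdl\<^bsub>U\<^esub> rel"
  proof
    fix p assume "p \<in> a_kernel U B Ev"
    then have p: "p \<in> carrier U" "Ev p = \<zero>\<^bsub>B\<^esub>" unfolding a_kernel_def' by simp_all
    have "\<exists>q\<in>carrier U. \<exists>r0\<in>carrier L. \<exists>r1\<in>carrier L. p = rel \<otimes>\<^bsub>U\<^esub> q \<oplus>\<^bsub>U\<^esub> (mon r0 0 \<oplus>\<^bsub>U\<^esub> mon r1 1)"
      by (rule UP_cring.monic_quadratic_remainder[OF UP_L _ _ p(1) rel_eq]) simp_all
    then obtain q r0 r1 where q: "q \<in> carrier U" and r: "r0 \<in> carrier L" "r1 \<in> carrier L"
      and p_eq: "p = rel \<otimes>\<^bsub>U\<^esub> q \<oplus>\<^bsub>U\<^esub> (mon r0 0 \<oplus>\<^bsub>U\<^esub> mon r1 1)" by (elim bexE)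
    have psi: "\<psi> r0 \<in> carrier B" "\<psi> r1 \<in> carrier B" using r by (simp_all add: ring_hom_closed[OF psi_hom])
    have "Ev p = Ev (q \<otimes>\<^bsub>U\<^esub> rel) \<oplus>\<^bsub>B\<^esub> (Ev (mon r0 0) \<oplus>\<^bsub>B\<^esub> Ev (mon r1 1))"
      unfolding p_eq U.m_comm[OF rel_closed q] using q r rel_closed by (simp add: ring_hom_add[OF Ev_hom])
    then have "\<psi> r0 \<oplus>\<^bsub>B\<^esub> \<psi> r1 \<otimes>\<^bsub>B\<^esub> s = \<zero>\<^bsub>B\<^esub>"
      using p(2) r psi s_closed by (simp add: Ev0[OF q] Ev_mon)
    then have "r0 = \<zero>\<^bsub>L\<^esub> \<and> r1 = \<zero>\<^bsub>L\<^esub>" by (rule psi_independent[OF r])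
    moreover have "mon \<zero>\<^bsub>L\<^esub> n = \<zero>\<^bsub>U\<^esub>" for n
      by (rule UP_ring.monom_zero) (simp add: UP_ring_def L.ring_axioms)
    ultimately have "p = q \<otimes>\<^bsub>U\<^esub> rel"
      unfolding p_eq using q rel_closed U.m_comm[OF rel_closed q] by simp
    then show "p \<in> PIdl\<^bsub>U\<^esub> rel" unfolding cgenideal_def using q by blast
  qed
qed

text \<open>Generators of \<open>Pet\<close> have monomials as preimages, and division by a power of
  \<open>\<Theta>\<close> is multiplication by the value of a negative power of the Laurent
  variable.\<close>

lemma Ev_surj: "Ev ` carrier U = carrier B"
proof
  show "Ev ` carrier U \<subseteq> carrier B" using ring_hom_closed[OF Ev_hom] by blast
  have Pet: "embB f \<in> Ev ` carrier U" if "f \<in> Pet" for f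
    using that
  proof (induction rule: Pet.induct)
    case zero
    have "Ev \<zero>\<^bsub>U\<^esub> = embB \<zero>\<^bsub>V\<^esub>"
      unfolding embB_zero by (rule ring_hom_zero[OF Ev_hom U.ring_axioms BB.ring_axioms])
    then show ?case by (metis U.zero_closed imageI)
  next
    case (power c i)
    have phi: "\<phi> c \<in> carrier B" by (rule ring_hom_closed[OF phi_hom power])
    have "Ev (mon (ell c (int i)) 0) = embB (C c \<cdot> \<Theta> [^]\<^bsub>V\<^esub> i)"
      using power phi t_props(1) Pet_gens[OF power] Theta_pow_in_Pet[of i]
      by (simp add: Ev_mon psi_ell zpow_def embB_mult embB_pow phi_eq)
    moreover have "mon (ell c (int i)) 0 \<in> carrier U" using power by simp
    ultimately show ?case by (metis imageI)
  next
    case (power_b c i)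
    have phi: "\<phi> c \<in> carrier B" by (rule ring_hom_closed[OF phi_hom power_b])
    have "Ev (mon (ell c (int i)) 1) = embB (C c \<cdot> \<Theta> [^]\<^bsub>V\<^esub> i \<cdot> b)"
      using power_b phi t_props(1) s_closed Pet_gens[OF power_b] Theta_pow_in_Pet[of i] b_in_Pet
      by (simp add: Ev_mon psi_ell zpow_def embB_mult embB_pow phi_eq Pet_mult)
    moreover have "mon (ell c (int i)) 1 \<in> carrier U" using power_b by simp
    ultimately show ?case by (metis imageI)
  next
    case (add f g)
    then obtain p q where p: "p \<in> carrier U" "embB f = Ev p" "q \<in> carrier U" "embB g = Ev q" by (elim imageE)
    then have "Ev (p \<oplus>\<^bsub>U\<^esub> q) = embB (f \<oplus>\<^bsub>V\<^esub> g)" using add(1,2) by (simp add: ring_hom_add[OF Ev_hom] embB_add)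
    moreover have "p \<oplus>\<^bsub>U\<^esub> q \<in> carrier U" using p by simp
    ultimately show ?case by (metis imageI)
  qed
  show "carrier B \<subseteq> Ev ` carrier U"
  proof
    fix z assume "z \<in> carrier B"
    then obtain f i where f: "f \<in> Pet" and z: "z = embB f \<otimes>\<^bsub>B\<^esub> t' [^]\<^bsub>B\<^esub> (i::nat)" by (rule B_cases)
    obtain p where p: "p \<in> carrier U" "embB f = Ev p" using Pet[OF f] by (elim imageE)
    have "zp (- int i) = t' [^]\<^bsub>B\<^esub> i" by (cases "i = 0") (simp_all add: zpow_def)
    then have "Ev (mon (ell \<one>\<^bsub>S\<^esub> (- int i)) 0) = t' [^]\<^bsub>B\<^esub> i"
      using t_props(2) by (simp add: Ev_mon psi_ell ring_hom_one[OF phi_hom])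
    then have "z = Ev (p \<otimes>\<^bsub>U\<^esub> mon (ell \<one>\<^bsub>S\<^esub> (- int i)) 0)"
      unfolding z using p by (simp add: ring_hom_mult[OF Ev_hom])
    moreover have "p \<otimes>\<^bsub>U\<^esub> mon (ell \<one>\<^bsub>S\<^esub> (- int i)) 0 \<in> carrier U" using p by simp
    ultimately show "z \<in> Ev ` carrier U" by blast
  qed
qed

text \<open>The first isomorphism theorem maps the quotient to the localization, while
  \<open>algebra_isomorphic\<close> asks for the opposite direction, so the inverse is taken. That
  \<open>quadratic_alg_of\<close> is a homomorphism is then transported from
  \<open>phi_hom\<close>.\<close>

lemma peterson_loc_iso:
  "algebra_isomorphic S B \<phi> (quadratic_alg F \<mu>) (quadratic_alg_of F \<mu>)"
proof -
  interpret h: ring_hom_ring U B Ev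
    by (rule ring_hom_ringI2[OF U.ring_axioms BB.ring_axioms Ev_hom])
  let ?H = "\<lambda>A. the_elem (Ev ` A)"
  let ?Q = "quadratic_alg F \<mu>"
  have Q: "?Q = U Quot (a_kernel U B Ev)"
    unfolding quadratic_alg_def quadratic_ideal_def kernel_Ev ..
  have ideal: "ideal (a_kernel U B Ev) U" by (rule h.kernel_is_ideal)
  have H: "?H \<in> ring_iso ?Q B" unfolding Q by (rule h.FactRing_iso_set[OF Ev_surj])
  have Qring: "ring ?Q" unfolding Q by (rule ideal.quotient_is_ring[OF ideal])
  have of_closed: "quadratic_alg_of F \<mu> c \<in> carrier ?Q" if "c \<in> carrier S" for c
  proof -
    have "mon (ell c 0) 0 \<in> carrier U" using that by simp
    then show ?thesis
      unfolding quadratic_alg_of_def quadratic_alg_def by (auto simp: FactRing_def A_RCOSETS_def')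
  qed
  have H_of: "?H (quadratic_alg_of F \<mu> c) = \<phi> c" if "c \<in> carrier S" for c
  proof -
    have m: "mon (ell c 0) 0 \<in> carrier U" using that by simp
    have phi: "\<phi> c \<in> carrier B" by (rule ring_hom_closed[OF phi_hom that])
    have "?H (quadratic_alg_of F \<mu> c) = Ev (mon (ell c 0) 0)"
      unfolding quadratic_alg_of_def quadratic_ideal_def kernel_Ev[symmetric] by (rule h.the_elem_simp[OF m])
    also have "\<dots> = \<phi> c" using that phi by (simp add: Ev_mon psi_ell zp_props)
    finally show ?thesis .
  qed
  let ?G = "inv_into (carrier ?Q) ?H"
  have G: "?G \<in> ring_iso B ?Q" by (rule ring_iso_set_sym[OF Qring H])
  have G_phi: "?G (\<phi> c) = quadratic_alg_of F \<mu> c" if "c \<in> carrier S" for c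
  proof -
    have "inj_on ?H (carrier ?Q)" using H unfolding ring_iso_def bij_betw_def by blast
    then show ?thesis unfolding H_of[OF that, symmetric] by (rule inv_into_f_f[OF _ of_closed[OF that]])
  qed
  have "?G \<circ> \<phi> \<in> ring_hom S ?Q"
    using ring_hom_trans[OF phi_hom] G unfolding ring_iso_def by blast
  then have "quadratic_alg_of F \<mu> \<in> ring_hom S ?Q"
    unfolding ring_hom_def using G_phi of_closed by (simp add: Pi_iff)
  then show ?thesis
    unfolding algebra_isomorphic_def using phi_hom G G_phi by blast
qed

lemma mu_props: "\<mu> \<in> carrier S" "emb \<mu> = \<ominus>\<^bsub>K\<^esub> fgrQ_frac F y x"
  using frac_y_x[OF u_props(1) v_props(2)] by (simp_all add: emb_uminus)

end

theorem theorem2: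
  fixes F :: "'r::{comm_ring_1, ring_char_0} fps fps"
  assumes "\<exists>h. h \<in> ring_hom (ring_of_type_algebra :: rat ring) (ring_of_type_algebra :: 'r ring) \<and> inj h"
    and "formal_group_law F"
    and "regular_elt (fgr F) (fgr_x F 1)"
    and "regular_elt (fgr F) (fgr_x F (-1))"
  shows "\<exists>\<mu>\<in>carrier (fgr F).
           fgrQ_of F \<mu> = \<ominus>\<^bsub>fgrQ F\<^esub> fgrQ_frac F (fgr_x F (-1)) (fgr_x F 1) \<and>
           algebra_isomorphic (fgr F)
             (peterson_loc F) (peterson_loc_of F)
             (quadratic_alg F \<mu>) (quadratic_alg_of F \<mu>)"
proof -
  interpret fgl_regular F
    by (intro fgl_regular.intro fgl.intro fgl_regular_axioms.intro assms)
  show ?thesis using mu_props peterson_loc_iso by blast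
qed

end
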